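(* Let $\lambda_1\ge\cdots\ge\lambda_r$ be the ordered eigenvalues of $\Sigma=\Theta\Theta^\top$ and $\Lambda=\mathrm{diag}(\lambda_1,\dots,\lambda_r)$. Consider a prior density of the form $\pi(\Theta)=g(\Sigma)$ where $g$ is orthogonally invariant. Assume that $g(\Sigma)=g(\Lambda)$ and that $g(\Lambda)$ is a twice differentiable function of $\Lambda$. Then the Bayesian predictive density $\hat p_\pi$ with $\pi(\Theta)=g(\Lambda)$ is minimax relative to the Kullback-Leibler loss if $$\mathrm{tr}[\nabla_\Theta\nabla_\Theta^\top\pi(\Theta)]=2\sum_{i=1}^r\bigg\{(q-r+1)\phi_i(\Lambda)+\sum_{j\ne i}^r\frac{\lambda_i\phi_i(\Lambda)-\lambda_j\phi_j(\Lambda)}{\lambda_i-\lambda_j}+2\lambda_i\frac{\partial\phi_i(\Lambda)}{\partial\lambda_i}\bigg\}\le0$$ for all $\Theta$, where $\phi_i(\Lambda)=\partial g(\Lambda)/\partial\lambda_i$; the displayed equality is part of the assertion.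
   Context: Prediction problem: $q\ge r$, and $X\mid\Theta\sim\mathcal N_{r\times q}(\Theta,v_xI_r\otimes I_q)$ and $Y\mid\Theta\sim\mathcal N_{r\times q}(\Theta,v_yI_r\otimes I_q)$ are independent, with $v_x,v_y>0$ known, i.e. $p(X\mid\Theta)=(2\pi v_x)^{-qr/2}\exp(-\|X-\Theta\|^2/(2v_x))$ and similarly $p(Y\mid\Theta)$ with $v_y$, where $\|A\|^2=\mathrm{tr}(AA^\top)$ (in these normalizing constants $\pi$ is the number, elsewhere $\pi$ denotes a prior density). The matrix $\Theta=(\theta_{ij})\in\mathbb R^{r\times q}$ is unknown. A predictive density $\hat p=\hat p(Y\mid X)$ is an estimate of the density $p(Y\mid\Theta)$ based only on $X$. The Kullback-Leibler (KL) loss is $L_{KL}(\Theta,\hat p)=\int_{\mathbb R^{r\times q}}p(Y\mid\Theta)\log\frac{p(Y\mid\Theta)}{\hat p(Y\mid X)}\,dY$ and the risk is $R_{KL}(\Theta,\hat p)=\int_{\mathbb R^{r\times q}} p(X\mid\Theta)L_{KL}(\Theta,\hat p)\,dX$. $\hat p$ is minimax if $\sup_\Theta R_{KL}(\Theta,\hat p)=\inf_{\tilde p}\sup_\Theta R_{KL}(\Theta,\tilde p)$ over all predictive densities $\tilde p$. For a (proper or improper) prior density $\pi(\Theta)$, the Bayesian predictive density is $\hat p_\pi(Y\mid X)=\dfrac{\int p(X\mid\Theta)p(Y\mid\Theta)\pi(\Theta)\,d\Theta}{m_\pi(X;v_x)}$ with $m_\pi(X;v_x)=\int p(X\mid\Theta)\pi(\Theta)\,d\Theta$.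 Standing assumptions: $\pi(\Theta)$ is twice differentiable, $g$ is twice differentiable with respect to $\Sigma$, and $m_\pi(X;v_x)$ is finite for all $X$. Orthogonal invariance of $g$ means $g(\Sigma)=g(P\Sigma P^\top)$ for every orthogonal $r\times r$ matrix $P$; then $g(\Sigma)=g(\Lambda)$ without loss of generality, regarded as a function of $\lambda_1,\dots,\lambda_r$. $\nabla_\Theta=(\partial/\partial\theta_{ij})$ is the $r\times q$ matrix of differential operators, so $\mathrm{tr}[\nabla_\Theta\nabla_\Theta^\top\pi(\Theta)]=\sum_{i=1}^r\sum_{j=1}^q\partial^2\pi(\Theta)/\partial\theta_{ij}^2$. *)

theory Defs
  imports "HOL-Probability.Probability"
begin

text \<open>
  An \<open>r \<times> q\<close> matrix is an element of \<open>real ^ 'q ^ 'r\<close>. The library norm on this type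
  is the Frobenius norm:
\<close>

lemma norm_matrix_eq_trace: "(norm (A :: real ^ 'q ^ 'r))\<^sup>2 = trace (A ** transpose A)"
  by (simp add: norm_vec_def L2_set_def sum_nonneg trace_def matrix_matrix_mult_def
      transpose_def power2_eq_square)

subsection \<open>The prediction problem\<close>

text \<open>Density at \<open>X\<close> of the matrix normal law with mean \<open>\<Theta>\<close> and covariance
  \<open>v I\<^sub>r \<otimes> I\<^sub>q\<close>.\<close>

definition normal_mat_density :: "real \<Rightarrow> real ^ 'q ^ 'r \<Rightarrow> real ^ 'q ^ 'r \<Rightarrow> real" where
  "normal_mat_density v \<Theta> X =
     (2 * pi * v) powr (- (real CARD('q) * real CARD('r)) / 2)
       * exp (- (norm (X - \<Theta>))\<^sup>2 / (2 * v))"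

text \<open>Integral with values in \<open>[-\<infinity>, \<infinity>]\<close>. The Bochner integral returns \<open>0\<close> for
  non-integrable functions, which would turn infinite losses and risks into zero ones.
  For a Kullback-Leibler integrand the negative part always has finite integral, so the
  difference below is never of the form \<open>\<infinity> - \<infinity>\<close>.\<close>

definition ereal_integral :: "'a measure \<Rightarrow> ('a \<Rightarrow> ereal) \<Rightarrow> ereal" where
  "ereal_integral M f =
     enn2ereal (\<integral>\<^sup>+ x. e2ennreal (f x) \<partial>M) - enn2ereal (\<integral>\<^sup>+ x. e2ennreal (- f x) \<partial>M)"

text \<open>\<open>p X Y\<close> stands for \<open>p(Y | X)\<close>.\<close>

definition predictive_density :: "(real ^ 'q ^ 'r \<Rightarrow> real ^ 'q ^ 'r \<Rightarrow> real) \<Rightarrow> bool" where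
  "predictive_density p \<longleftrightarrow>
     (\<lambda>(X, Y). p X Y) \<in> borel_measurable (lborel \<Otimes>\<^sub>M lborel) \<and>
     (\<forall>X Y. 0 \<le> p X Y) \<and>
     (\<forall>X. (\<integral>\<^sup>+ Y. ennreal (p X Y) \<partial>lborel) = 1)"

text \<open>The case distinction is needed because \<open>a / 0 = 0\<close> and \<open>ln 0 = 0\<close>, whereas the
  logarithm in the loss is \<open>\<infinity>\<close> where the predictive density vanishes.\<close>

definition kl_loss ::
  "real \<Rightarrow> real ^ 'q ^ 'r \<Rightarrow> (real ^ 'q ^ 'r \<Rightarrow> real) \<Rightarrow> ereal" where
  "kl_loss vy \<Theta> p = ereal_integral lborel (\<lambda>Y.
     ereal (normal_mat_density vy \<Theta> Y) *
       (if p Y = 0 then \<infinity> else ereal (ln (normal_mat_density vy \<Theta> Y / p Y))))"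

definition kl_risk ::
  "real \<Rightarrow> real \<Rightarrow> real ^ 'q ^ 'r \<Rightarrow> (real ^ 'q ^ 'r \<Rightarrow> real ^ 'q ^ 'r \<Rightarrow> real) \<Rightarrow> ereal" where
  "kl_risk vx vy \<Theta> p = ereal_integral lborel (\<lambda>X.
     ereal (normal_mat_density vx \<Theta> X) * kl_loss vy \<Theta> (p X))"

definition kl_minimax ::
  "real \<Rightarrow> real \<Rightarrow> (real ^ 'q ^ 'r \<Rightarrow> real ^ 'q ^ 'r \<Rightarrow> real) \<Rightarrow> bool" where
  "kl_minimax vx vy p \<longleftrightarrow>
     predictive_density p \<and>
     (SUP \<Theta>. kl_risk vx vy \<Theta> p) =
       (INF p' \<in> {p' :: real ^ 'q ^ 'r \<Rightarrow> real ^ 'q ^ 'r \<Rightarrow> real. predictive_density p'}.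
          SUP \<Theta>. kl_risk vx vy \<Theta> p')"

definition marginal :: "(real ^ 'q ^ 'r \<Rightarrow> real) \<Rightarrow> real \<Rightarrow> real ^ 'q ^ 'r \<Rightarrow> real" where
  "marginal prior v X = (\<integral>\<Theta>. normal_mat_density v \<Theta> X * prior \<Theta> \<partial>lborel)"

definition bayes_predictive ::
  "real \<Rightarrow> real \<Rightarrow> (real ^ 'q ^ 'r \<Rightarrow> real) \<Rightarrow> real ^ 'q ^ 'r \<Rightarrow> real ^ 'q ^ 'r \<Rightarrow> real" where
  "bayes_predictive vx vy prior X Y =
     (\<integral>\<Theta>. normal_mat_density vx \<Theta> X * normal_mat_density vy \<Theta> Y * prior \<Theta> \<partial>lborel)
       / marginal prior vx X"

subsection \<open>Differential operators\<close>

text \<open>Derivatives are taken within \<open>S\<close>, so that boundary points of \<open>S\<close> are admitted.\<close>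

definition twice_differentiable_on ::
  "('a::real_normed_vector \<Rightarrow> real) \<Rightarrow> 'a set \<Rightarrow> bool" where
  "twice_differentiable_on f S \<longleftrightarrow>
     (\<exists>f' :: 'a \<Rightarrow> 'a \<Rightarrow>\<^sub>L real.
        (\<forall>x\<in>S. (f has_derivative blinfun_apply (f' x)) (at x within S)) \<and>
        f' differentiable_on S)"

definition partial_mat ::
  "'r \<Rightarrow> 'q \<Rightarrow> (real ^ 'q ^ 'r \<Rightarrow> real) \<Rightarrow> real ^ 'q ^ 'r \<Rightarrow> real" where
  "partial_mat i j f \<Theta> = deriv (\<lambda>t. f (\<Theta> + t *\<^sub>R axis i (axis j 1))) 0"

text \<open>The \<open>r \<times> r\<close> matrix \<open>\<nabla> \<nabla>\<^sup>T f (\<Theta>)\<close>, where \<open>\<nabla>\<close> is the \<open>r \<times> q\<close> matrix of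
  operators \<open>\<partial> / \<partial>\<theta>\<^sub>i\<^sub>j\<close>.\<close>

definition nabla_nabla_T ::
  "(real ^ 'q ^ 'r \<Rightarrow> real) \<Rightarrow> real ^ 'q ^ 'r \<Rightarrow> real ^ 'r ^ 'r" where
  "nabla_nabla_T f \<Theta> = (\<chi> i k. \<Sum>j\<in>UNIV. partial_mat i j (partial_mat k j f) \<Theta>)"

subsection \<open>Spectral functions\<close>

definition psd_matrices :: "(real ^ 'r ^ 'r) set" where
  "psd_matrices = {\<Sigma>. transpose \<Sigma> = \<Sigma> \<and> (\<forall>x. 0 \<le> x \<bullet> (\<Sigma> *v x))}"

definition nonneg_orthant :: "(real ^ 'r) set" where
  "nonneg_orthant = {l. \<forall>i. 0 \<le> l $ i}"

definition diag_mat :: "real ^ 'r \<Rightarrow> real ^ 'r ^ 'r" where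
  "diag_mat l = (\<chi> i j. if i = j then l $ i else 0)"

text \<open>The entries of \<open>l\<close> are the roots of the characteristic polynomial of \<open>\<Sigma>\<close>, with
  multiplicity and in non-increasing order.\<close>

definition ordered_eigenvalues ::
  "real ^ ('r::{finite,linorder}) ^ ('r::{finite,linorder}) \<Rightarrow>
     real ^ ('r::{finite,linorder}) \<Rightarrow> bool" where
  "ordered_eigenvalues \<Sigma> l \<longleftrightarrow>
     (\<forall>i j. i \<le> j \<longrightarrow> l $ j \<le> l $ i) \<and>
     (\<forall>x. det (mat x - \<Sigma>) = (\<Prod>i\<in>UNIV. x - l $ i))"

definition orthogonally_invariant :: "(real ^ 'r ^ 'r \<Rightarrow> real) \<Rightarrow> bool" where
  "orthogonally_invariant g \<longleftrightarrow>
     (\<forall>\<Sigma>\<in>psd_matrices. \<forall>P. orthogonal_matrix P \<longrightarrow> g \<Sigma> = g (P ** \<Sigma> ** transpose P))"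

definition upd_coord :: "real ^ 'r \<Rightarrow> 'r \<Rightarrow> real \<Rightarrow> real ^ 'r" where
  "upd_coord l i t = (\<chi> k. if k = i then t else l $ k)"

text \<open>Partial derivative on the nonnegative orthant: two-sided where \<open>l $ i > 0\<close>,
  one-sided from the right where \<open>l $ i = 0\<close>.\<close>

definition partial_orthant :: "'r \<Rightarrow> (real ^ 'r \<Rightarrow> real) \<Rightarrow> real ^ 'r \<Rightarrow> real" where
  "partial_orthant i f l =
     vector_derivative (\<lambda>t. f (upd_coord l i t)) (at (l $ i) within {0..})"

definition phi :: "(real ^ 'r ^ 'r \<Rightarrow> real) \<Rightarrow> 'r \<Rightarrow> real ^ 'r \<Rightarrow> real" where
  "phi g i = partial_orthant i (\<lambda>l. g (diag_mat l))"

text \<open>The quotient \<open>(\<lambda>\<^sub>i \<phi>\<^sub>i - \<lambda>\<^sub>j \<phi>\<^sub>j) / (\<lambda>\<^sub>i - \<lambda>\<^sub>j)\<close>. It has a removable singularity at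
  \<open>\<lambda>\<^sub>i = \<lambda>\<^sub>j\<close> (the numerator vanishes there by symmetry of \<open>g\<close>), which is filled with
  the limit as the \<open>i\<close>-th coordinate tends to the common value.\<close>

definition phi_quotient ::
  "(real ^ 'r ^ 'r \<Rightarrow> real) \<Rightarrow> 'r \<Rightarrow> 'r \<Rightarrow> real ^ 'r \<Rightarrow> real" where
  "phi_quotient g i j l =
     (let Q = (\<lambda>\<mu>. (\<mu> $ i * phi g i \<mu> - \<mu> $ j * phi g j \<mu>) / (\<mu> $ i - \<mu> $ j))
      in if l $ i \<noteq> l $ j then Q l
         else Lim (at (l $ i) within {0..}) (\<lambda>t. Q (upd_coord l i t)))"

end

theory Submission
  imports Defs
begin

text \<open>
  The claim has two independent halves.

  \<^bold>\<open>The Laplacian formula.\<close> The trace of \<open>\<nabla> \<nabla>\<^sup>T \<pi>\<close> is the trace of the second derivative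
  of \<open>\<pi>\<close>, so it can be summed over any orthonormal basis of the matrix space, in particular over the
  products \<open>u\<^sub>i v\<^sub>k\<^sup>T\<close> of left and right singular vectors of \<open>\<Theta>\<close>. Moving \<open>\<Theta>\<close> along such a product
  changes at most two eigenvalues of \<open>\<Theta> \<Theta>\<^sup>T\<close>, and these are explicit: \<open>\<lambda>\<^sub>i\<close> becomes
  \<open>(\<surd>\<lambda>\<^sub>i + t)\<^sup>2\<close> when \<open>v\<^sub>k\<close> is the partner of \<open>u\<^sub>i\<close>; it becomes \<open>\<lambda>\<^sub>i + t\<^sup>2\<close> when \<open>v\<^sub>k\<close> is a
  partner of no \<open>u\<^sub>j\<close>; and \<open>\<lambda>\<^sub>i\<close>, \<open>\<lambda>\<^sub>j\<close> become the two eigenvalues of a \<open>2 \<times> 2\<close> block when \<open>v\<^sub>k\<close> is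
  the partner of another \<open>u\<^sub>j\<close>. The last case produces the quotients
  \<open>(\<lambda>\<^sub>i \<phi>\<^sub>i - \<lambda>\<^sub>j \<phi>\<^sub>j) / (\<lambda>\<^sub>i - \<lambda>\<^sub>j)\<close>. Where eigenvalues coincide or vanish, the eigenvalues are not
  smooth in \<open>t\<close> or lie on the boundary of the orthant. Symmetric second differences
  (\<open>symmetric_second_difference\<close>) avoid this: they are computed from the second-order Taylor
  expansion of the spectral function at one point of the orthant, along any curve with a known
  first-order term and a known symmetrised second-order term.

  \<^bold>\<open>Minimaxity.\<close> Let \<open>m\<^sub>v\<close> be the average of the prior over a Gaussian of variance \<open>v\<close>.
  The predictive density of the uniform prior is \<open>N(X, (v\<^sub>x + v\<^sub>y) I)\<close>, with constant risk \<open>R\<close>.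
  \<^item> No predictive density has maximal risk below \<open>R\<close>: its maximal risk bounds its average risk
    under a Gaussian prior of variance \<open>\<tau>\<close>, hence bounds the Bayes risk of that prior, which tends
    to \<open>R\<close> as \<open>\<tau> \<rightarrow> \<infinity>\<close> (\<open>uniform_prior_risk_le_max_risk\<close>).
  \<^item> The risk of the Bayesian predictive density at \<open>\<Theta>\<close> is
    \<open>R + E ln m\<^sub>v (X) - E ln m\<^sub>w (W)\<close> with \<open>v = v\<^sub>x\<close>, \<open>w = v\<^sub>x v\<^sub>y / (v\<^sub>x + v\<^sub>y) < v\<close>,
    \<open>X \<sim> N(\<Theta>, v I)\<close> and \<open>W \<sim> N(\<Theta>, w I)\<close> (\<open>kl_risk_bayes_le\<close>). So it is enough that
    \<open>E ln m\<^sub>v\<close>, taken at variance \<open>v\<close>, decreases in \<open>v\<close>.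

  This monotonicity needs only one consequence of the nonpositive Laplacian, namely that Gaussian
  averages of the prior lie below the prior (\<open>superharmonic.gauss_average_le\<close>). Averaging again
  gives \<open>m\<^sub>w\<^sub>+\<^sub>s \<le> m\<^sub>w\<close>, pointwise and also as the statement that Gaussian averages of \<open>m\<^sub>w\<close> lie
  below \<open>m\<^sub>w\<close>; by Jensen's inequality the same holds for \<open>ln m\<^sub>w\<close>. Both facts together give
  \<open>E ln m\<^sub>w\<^sub>+\<^sub>s (W + Z) \<le> E ln m\<^sub>w (W + Z) \<le> E ln m\<^sub>w (W)\<close> for independent noise \<open>Z\<close> of variance \<open>s\<close>
  (\<open>superharmonic_prior.expected_ln_gauss_avg_antimono\<close>).

  The second derivatives of the prior exist but need not be continuous or even locally bounded, so
  the Laplacian cannot simply be integrated against the heat kernel. The inequality for Gaussian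
  averages comes from a maximum principle instead: the heat flow of a compactly supported minorant
  of the prior is smooth, and at a maximum of its difference to the prior only the pointwise second
  derivatives of the prior enter.
\<close>

section \<open>Isotropic Gaussian measures\<close>

definition gdens :: "real \<Rightarrow> 'a::euclidean_space \<Rightarrow> real" where
  "gdens v x = (2 * pi * v) powr (- real DIM('a) / 2) * exp (- (norm x)\<^sup>2 / (2 * v))"

lemma normal_mat_density_eq_gdens: "normal_mat_density v \<Theta> X = gdens v (X - \<Theta>)"
  by (simp add: normal_mat_density_def gdens_def mult.commute)

lemma gdens_pos: "v > 0 \<Longrightarrow> gdens v x > 0"
  by (simp add: gdens_def)

lemma gdens_nonneg [simp]: "gdens v x \<ge> 0"
  by (simp add: gdens_def)

lemma gdens_minus: "gdens v (x - y) = gdens v (y - x)"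
  by (simp add: gdens_def norm_minus_commute)

lemma borel_measurable_gdens [measurable]: "gdens v \<in> borel_measurable borel"
  unfolding gdens_def[abs_def] by measurable

lemma gdens_prod_std_normal:
  fixes x :: "'a::euclidean_space"
  assumes "v > 0"
  shows "gdens v x = (\<Prod>b\<in>Basis. normal_density 0 (sqrt v) (x \<bullet> b))"
proof -
  have n: "(norm x)\<^sup>2 = (\<Sum>b\<in>Basis. (x \<bullet> b)\<^sup>2)"
    by (simp add: norm_eq_sqrt_inner euclidean_inner[of x x] power2_eq_square sum_nonneg)
  have c: "(2 * pi * v) powr (- real DIM('a) / 2) = (1 / sqrt (2 * pi * v)) ^ DIM('a)"
    using assms
    by (simp add: powr_minus_divide powr_half_sqrt[symmetric] power_one_over
        powr_realpow[symmetric] powr_powr)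
  have "(\<Prod>b\<in>Basis. normal_density 0 (sqrt v) (x \<bullet> b)) =
      (\<Prod>b\<in>Basis. 1 / sqrt (2 * pi * v) * exp (- (x \<bullet> b)\<^sup>2 / (2 * v)))"
    using assms by (simp add: normal_density_def)
  also have "\<dots> = (1 / sqrt (2 * pi * v)) ^ DIM('a) * exp (\<Sum>b\<in>Basis. - (x \<bullet> b)\<^sup>2 / (2 * v))"
    by (simp only: prod.distrib exp_sum[OF finite_Basis] prod_constant)
  finally show ?thesis
    unfolding gdens_def c n by (simp only: sum_negf sum_divide_distrib minus_divide_left[symmetric])
qed

lemma nn_integral_gdens_0:
  assumes "v > 0"
  shows "(\<integral>\<^sup>+ x. ennreal (gdens v (x :: 'a::euclidean_space)) \<partial>lborel) = 1"
proof -
  have 1: "(\<integral>\<^sup>+ x. ennreal (normal_density 0 (sqrt v) x) \<partial>lborel) = 1"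
    using assms by (subst nn_integral_eq_integral) (auto simp: integral_normal_density)
  have "(\<integral>\<^sup>+ x. ennreal (gdens v (x :: 'a)) \<partial>lborel) =
      (\<integral>\<^sup>+ x. (\<Prod>b\<in>Basis. ennreal (normal_density 0 (sqrt v) ((x::'a) \<bullet> b))) \<partial>lborel)"
    by (simp add: gdens_prod_std_normal[OF assms] prod_ennreal)
  also have "\<dots> = 1"
    by (subst nn_integral_lborel_prod) (auto simp: 1)
  finally show ?thesis .
qed

text \<open>The power of \<open>\<bar>a\<bar>\<close> is the Jacobian of the scaling by \<open>a\<close>.\<close>

lemma gdens_scale:
  fixes x :: "'a::euclidean_space"
  assumes "v > 0" "a \<noteq> 0"
  shows "gdens (a\<^sup>2 * v) (a *\<^sub>R x) * \<bar>a\<bar> ^ DIM('a) = gdens v x"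
proof -
  have "(a\<^sup>2) powr (- real DIM('a) / 2) * \<bar>a\<bar> ^ DIM('a) = 1"
  proof -
    have "a\<^sup>2 = \<bar>a\<bar> powr 2" using assms by simp
    then have "(a\<^sup>2) powr (- real DIM('a) / 2) = \<bar>a\<bar> powr (- real DIM('a))"
      by (simp only: powr_powr) simp
    then show ?thesis using assms by (simp add: powr_minus powr_realpow)
  qed
  moreover have "(2 * pi * (a\<^sup>2 * v)) powr (- real DIM('a) / 2)
      = (a\<^sup>2) powr (- real DIM('a) / 2) * (2 * pi * v) powr (- real DIM('a) / 2)"
    using assms by (simp add: powr_mult[symmetric] mult_ac)
  ultimately show ?thesis
    using assms by (simp add: gdens_def power_mult_distrib)
qed

definition gauss :: "real \<Rightarrow> 'a::euclidean_space \<Rightarrow> 'a measure" where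
  "gauss v c = density lborel (\<lambda>x. ennreal (gdens v (x - c)))"

lemma sets_gauss [simp, measurable_cong]: "sets (gauss v c) = sets borel"
  and space_gauss [simp]: "space (gauss v c) = UNIV"
  by (simp_all add: gauss_def)

lemma nn_integral_gauss:
  "f \<in> borel_measurable borel \<Longrightarrow>
    (\<integral>\<^sup>+ x. f x \<partial>gauss v c) = (\<integral>\<^sup>+ x. ennreal (gdens v (x - c)) * f x \<partial>lborel)"
  unfolding gauss_def by (subst nn_integral_density) auto

lemma integral_gauss:
  fixes f :: "_ \<Rightarrow> real"
  shows "f \<in> borel_measurable borel \<Longrightarrow>
    (\<integral> x. f x \<partial>gauss v c) = (\<integral> x. gdens v (x - c) * f x \<partial>lborel)"
  unfolding gauss_def by (subst integral_density) auto

lemma integrable_gauss_iff: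
  fixes f :: "_ \<Rightarrow> real"
  shows "f \<in> borel_measurable borel \<Longrightarrow>
    integrable (gauss v c) f \<longleftrightarrow> integrable lborel (\<lambda>x. gdens v (x - c) * f x)"
  unfolding gauss_def by (subst integrable_density) auto

lemma nn_integral_lborel_affine:
  fixes f :: "'a::euclidean_space \<Rightarrow> ennreal"
  assumes [measurable]: "f \<in> borel_measurable borel" and "a \<noteq> 0"
  shows "(\<integral>\<^sup>+ x. f x \<partial>lborel) = (\<integral>\<^sup>+ x. ennreal (\<bar>a\<bar> ^ DIM('a)) * f (b + a *\<^sub>R x) \<partial>lborel)"
  by (subst lborel_affine[OF \<open>a \<noteq> 0\<close>, of b])
    (simp add: nn_integral_density nn_integral_distr del: ennreal_power)

lemma distr_gauss_affine:
  fixes b c :: "'a::euclidean_space"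
  assumes "v > 0" "a \<noteq> 0"
  shows "distr (gauss v c) borel (\<lambda>x. b + a *\<^sub>R x) = gauss (a\<^sup>2 * v) (b + a *\<^sub>R c)"
proof (rule measure_eqI)
  fix A assume "A \<in> sets (distr (gauss v c) borel (\<lambda>x. b + a *\<^sub>R x))"
  then have [measurable]: "A \<in> sets borel" by simp
  have "emeasure (gauss (a\<^sup>2 * v) (b + a *\<^sub>R c)) A =
      (\<integral>\<^sup>+ x. ennreal (gdens (a\<^sup>2 * v) (x - (b + a *\<^sub>R c))) * indicator A x \<partial>lborel)"
    unfolding gauss_def by (subst emeasure_density) auto
  also have "\<dots> = (\<integral>\<^sup>+ x. ennreal (\<bar>a\<bar> ^ DIM('a)) *
      (ennreal (gdens (a\<^sup>2 * v) ((b + a *\<^sub>R x) - (b + a *\<^sub>R c))) * indicator A (b + a *\<^sub>R x)) \<partial>lborel)"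
    using assms by (subst nn_integral_lborel_affine[of _ a b]) auto
  also have "\<dots> = (\<integral>\<^sup>+ x. ennreal (gdens v (x - c)) * indicator A (b + a *\<^sub>R x) \<partial>lborel)"
  proof (rule nn_integral_cong)
    fix x
    have "(b + a *\<^sub>R x) - (b + a *\<^sub>R c) = a *\<^sub>R (x - c)"
      by (simp add: scaleR_diff_right)
    then show "ennreal (\<bar>a\<bar> ^ DIM('a)) *
      (ennreal (gdens (a\<^sup>2 * v) ((b + a *\<^sub>R x) - (b + a *\<^sub>R c))) * indicator A (b + a *\<^sub>R x))
      = ennreal (gdens v (x - c)) * indicator A (b + a *\<^sub>R x)"
      using gdens_scale[OF assms, of "x - c"]
      by (simp add: mult.assoc[symmetric] ennreal_mult[symmetric] mult.commute del: ennreal_power)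
  qed
  also have "\<dots> = emeasure (distr (gauss v c) borel (\<lambda>x. b + a *\<^sub>R x)) A"
  proof -
    have "(\<lambda>x. b + a *\<^sub>R x) -` A \<in> sets borel"
      using measurable_sets[of "\<lambda>x. b + a *\<^sub>R x" borel borel A] by simp
    then show ?thesis
      by (subst emeasure_distr)
        (auto simp: gauss_def emeasure_density indicator_def intro!: nn_integral_cong)
  qed
  finally show "emeasure (distr (gauss v c) borel (\<lambda>x. b + a *\<^sub>R x)) A =
     emeasure (gauss (a\<^sup>2 * v) (b + a *\<^sub>R c)) A" by simp
qed simp

lemma nn_integral_gdens:
  assumes "v > 0"
  shows "(\<integral>\<^sup>+ x. ennreal (gdens v (x - c)) \<partial>lborel) = 1"
  using nn_integral_lborel_affine[of "\<lambda>x. ennreal (gdens v (x - c))" 1 c] nn_integral_gdens_0[OF assms]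
  by simp

lemma prob_space_gauss: "v > 0 \<Longrightarrow> prob_space (gauss v c)"
  by (rule prob_spaceI) (simp add: gauss_def emeasure_density nn_integral_gdens)

lemma integrable_gdens: "v > 0 \<Longrightarrow> integrable lborel (\<lambda>x. gdens v (x - c))"
  by (rule integrableI_nonneg) (auto simp: nn_integral_gdens)

text \<open>Completing the square. The convolution of two Gaussians, the posterior of a Gaussian prior and
  the predictive density of a general prior are all read off from this one factorisation.\<close>

lemma gdens_mult:
  fixes x y z :: "'a::euclidean_space"
  assumes "s > 0" "t > 0"
  shows "gdens s (x - y) * gdens t (y - z) =
    gdens (s + t) (x - z) * gdens (s * t / (s + t)) (y - (1 / (s + t)) *\<^sub>R (t *\<^sub>R x + s *\<^sub>R z))"
proof -
  define a b where "a = x - z" and "b = y - z"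
  define k where "k = t / (s + t)"
  have st: "s + t \<noteq> 0" "s + t > 0" using assms by auto
  have 1: "x - y = a - b" "y - z = b" "x - z = a" by (auto simp: a_def b_def)
  have 2: "y - (1 / (s + t)) *\<^sub>R (t *\<^sub>R x + s *\<^sub>R z) = b - k *\<^sub>R a"
  proof -
    have "z = (1 / (s+t)) *\<^sub>R ((s + t) *\<^sub>R z)" using st by simp
    then have "b = y - (1 / (s+t)) *\<^sub>R ((s + t) *\<^sub>R z)" by (simp add: b_def)
    then show ?thesis
      by (simp add: a_def k_def algebra_simps diff_divide_distrib add_divide_distrib)
  qed
  have nrm: "(norm (a - b))\<^sup>2 = a \<bullet> a - 2 * (a \<bullet> b) + b \<bullet> b"
    "(norm (b - k *\<^sub>R a))\<^sup>2 = b \<bullet> b - 2 * k * (a \<bullet> b) + k\<^sup>2 * (a \<bullet> a)"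
    unfolding power2_norm_eq_inner
    by (simp_all add: inner_diff_left inner_diff_right inner_commute power2_eq_square algebra_simps)
  \<comment> \<open>After the shift by \<open>z\<close> only the three inner products of \<open>a\<close> and \<open>b\<close> are left to compare.\<close>
  have ex: "(norm (a - b))\<^sup>2 / (2 * s) + (norm b)\<^sup>2 / (2 * t) =
     (norm a)\<^sup>2 / (2 * (s + t)) + (norm (b - k *\<^sub>R a))\<^sup>2 / (2 * (s * t / (s + t)))"
    unfolding nrm unfolding power2_norm_eq_inner k_def using assms st
    by (simp add: divide_simps) (simp add: algebra_simps power2_eq_square)
  have p: "(2 * pi * s) powr p * (2 * pi * t) powr p =
     (2 * pi * (s + t)) powr p * (2 * pi * (s * t / (s + t))) powr p" for p
  proof -
    have "2 * pi * s * (2 * pi * t) = 2 * pi * (s + t) * (2 * pi * (s * t / (s + t)))"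
      using st by simp
    then show ?thesis using assms st by (simp only: powr_mult[symmetric])
  qed
  have "gdens s (a - b) * gdens t b =
     ((2 * pi * s) powr (- real DIM('a) / 2) * (2 * pi * t) powr (- real DIM('a) / 2)) *
      exp (- ((norm (a - b))\<^sup>2 / (2 * s) + (norm b)\<^sup>2 / (2 * t)))"
    unfolding gdens_def by (simp add: exp_add[symmetric] exp_diff exp_minus field_simps)
  also have "\<dots> = gdens (s + t) a * gdens (s * t / (s + t)) (b - k *\<^sub>R a)"
    unfolding p ex unfolding gdens_def by (simp only: minus_add_distrib exp_add minus_divide_left mult_ac)
  finally show ?thesis unfolding 2 unfolding 1 .
qed

lemma nn_integral_gdens_convolution:
  fixes x z :: "'a::euclidean_space"
  assumes "s > 0" "t > 0"
  shows "(\<integral>\<^sup>+ y. ennreal (gdens s (x - y)) * ennreal (gdens t (y - z)) \<partial>lborel) = ennreal (gdens (s + t) (x - z))"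
  using assms
  by (simp add: ennreal_mult[symmetric] gdens_mult)
    (simp add: ennreal_mult nn_integral_cmult nn_integral_gdens)

lemma nn_integral_gauss_gauss:
  fixes c :: "'a::euclidean_space"
  assumes st: "s > 0" "t > 0" and [measurable]: "f \<in> borel_measurable borel"
  shows "(\<integral>\<^sup>+ x. (\<integral>\<^sup>+ y. f y \<partial>gauss t x) \<partial>gauss s c) = (\<integral>\<^sup>+ y. f y \<partial>gauss (s + t) c)"
proof -
  have "(\<integral>\<^sup>+ x. (\<integral>\<^sup>+ y. f y \<partial>gauss t x) \<partial>gauss s c) =
     (\<integral>\<^sup>+ x. \<integral>\<^sup>+ y. ennreal (gdens s (x - c)) * (ennreal (gdens t (y - x)) * f y) \<partial>lborel \<partial>lborel)"
    by (simp add: nn_integral_gauss nn_integral_cmult)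
  also have "\<dots> = (\<integral>\<^sup>+ y. \<integral>\<^sup>+ x. ennreal (gdens s (x - c)) * (ennreal (gdens t (y - x)) * f y) \<partial>lborel \<partial>lborel)"
    by (rule lborel_pair.Fubini') measurable
  also have "\<dots> = (\<integral>\<^sup>+ y. \<integral>\<^sup>+ x. (ennreal (gdens t (y - x)) * ennreal (gdens s (x - c))) * f y \<partial>lborel \<partial>lborel)"
    by (simp add: mult_ac)
  also have "\<dots> = (\<integral>\<^sup>+ y. f y \<partial>gauss (s + t) c)"
    using st by (simp add: nn_integral_multc nn_integral_gdens_convolution nn_integral_gauss add.commute)
  finally show ?thesis .
qed

text \<open>Given the first summand, the sum is a shifted Gaussian; integrating over the first summand is
  then the iterated average of \<open>nn_integral_gauss_gauss\<close>.\<close>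

lemma distr_gauss_add:
  fixes c e :: "'a::euclidean_space"
  assumes st: "s > 0" "t > 0"
  shows "distr (gauss s c \<Otimes>\<^sub>M gauss t e) borel (\<lambda>(x, y). x + y) = gauss (s + t) (c + e)"
proof (rule measure_eqI)
  fix A assume "A \<in> sets (distr (gauss s c \<Otimes>\<^sub>M gauss t e) borel (\<lambda>(x, y). x + y))"
  then have [measurable]: "A \<in> sets borel" by simp
  interpret S: prob_space "gauss s c" by (rule prob_space_gauss) fact
  interpret T: prob_space "gauss t e" by (rule prob_space_gauss) fact
  interpret P: pair_prob_space "gauss s c" "gauss t e" ..
  have [measurable]: "(\<lambda>x. emeasure (gauss t x) A) \<in> borel_measurable borel"
    by (simp add: gauss_def emeasure_density)
  have shift: "(\<integral>\<^sup>+ y. indicator A (x + y) \<partial>gauss t e) = (\<integral>\<^sup>+ y. indicator A y \<partial>gauss t (x + e))" for x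
    using distr_gauss_affine[OF st(2), of 1 e x]
      nn_integral_distr[of "\<lambda>y. x + 1 *\<^sub>R y" "gauss t e" borel "indicator A"] by simp
  have shift2: "(\<integral>\<^sup>+ x. (\<integral>\<^sup>+ y. indicator A y \<partial>gauss t (x + e)) \<partial>gauss s c) =
    (\<integral>\<^sup>+ x. (\<integral>\<^sup>+ y. indicator A y \<partial>gauss t x) \<partial>gauss s (c + e))"
    using distr_gauss_affine[OF st(1), of 1 c e]
      nn_integral_distr[of "\<lambda>y. e + 1 *\<^sub>R y" "gauss s c" borel "\<lambda>x. (\<integral>\<^sup>+ y. indicator A y \<partial>gauss t x)"]
    by (simp add: nn_integral_gauss add.commute)
  have "emeasure (distr (gauss s c \<Otimes>\<^sub>M gauss t e) borel (\<lambda>(x, y). x + y)) A =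
    (\<integral>\<^sup>+ z. indicator A z \<partial>distr (gauss s c \<Otimes>\<^sub>M gauss t e) borel (\<lambda>(x, y). x + y))"
    by (subst nn_integral_indicator) auto
  also have "\<dots> = (\<integral>\<^sup>+ z. indicator A (fst z + snd z) \<partial>(gauss s c \<Otimes>\<^sub>M gauss t e))"
    by (subst nn_integral_distr) (auto simp: case_prod_beta)
  also have "\<dots> = (\<integral>\<^sup>+ x. (\<integral>\<^sup>+ y. indicator A (x + y) \<partial>gauss t e) \<partial>gauss s c)"
    by (subst T.nn_integral_fst[symmetric]) auto
  also have "\<dots> = emeasure (gauss (s + t) (c + e)) A"
    unfolding shift shift2 by (subst nn_integral_gauss_gauss) (auto simp: st)
  finally show "emeasure (distr (gauss s c \<Otimes>\<^sub>M gauss t e) borel (\<lambda>(x, y). x + y)) A =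
    emeasure (gauss (s + t) (c + e)) A" .
qed simp

lemma distr_gauss_linear_combination:
  fixes c e :: "'a::euclidean_space"
  assumes st: "s > 0" "t > 0" and ab: "a \<noteq> 0" "b \<noteq> 0"
  shows "distr (gauss s c \<Otimes>\<^sub>M gauss t e) borel (\<lambda>(x, y). a *\<^sub>R x + b *\<^sub>R y) =
    gauss (a\<^sup>2 * s + b\<^sup>2 * t) (a *\<^sub>R c + b *\<^sub>R e)"
proof -
  have pos: "a\<^sup>2 * s > 0" "b\<^sup>2 * t > 0" using st ab by auto
  have sf: "sigma_finite_measure (gauss (b\<^sup>2 * t) (b *\<^sub>R e))"
    "sigma_finite_measure (gauss t e)" "sigma_finite_measure (gauss s c)"
    using pos st prob_space_gauss prob_space_imp_sigma_finite by blast+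
  have "gauss (a\<^sup>2 * s) (a *\<^sub>R c) \<Otimes>\<^sub>M gauss (b\<^sup>2 * t) (b *\<^sub>R e) =
    distr (gauss s c) borel (\<lambda>x. a *\<^sub>R x) \<Otimes>\<^sub>M distr (gauss t e) borel (\<lambda>x. b *\<^sub>R x)"
    using distr_gauss_affine[OF st(1) ab(1), of c 0] distr_gauss_affine[OF st(2) ab(2), of e 0] by simp
  also have "\<dots> = distr (gauss s c \<Otimes>\<^sub>M gauss t e) (borel \<Otimes>\<^sub>M borel) (\<lambda>(x, y). (a *\<^sub>R x, b *\<^sub>R y))"
    by (rule pair_measure_distr) (auto simp: distr_gauss_affine[OF st(2) ab(2), of e 0, simplified] sf)
  finally have eq: "gauss (a\<^sup>2 * s) (a *\<^sub>R c) \<Otimes>\<^sub>M gauss (b\<^sup>2 * t) (b *\<^sub>R e) =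
    distr (gauss s c \<Otimes>\<^sub>M gauss t e) (borel \<Otimes>\<^sub>M borel) (\<lambda>(x, y). (a *\<^sub>R x, b *\<^sub>R y))" .
  have "gauss (a\<^sup>2 * s + b\<^sup>2 * t) (a *\<^sub>R c + b *\<^sub>R e) =
    distr (gauss (a\<^sup>2 * s) (a *\<^sub>R c) \<Otimes>\<^sub>M gauss (b\<^sup>2 * t) (b *\<^sub>R e)) borel (\<lambda>(x, y). x + y)"
    by (rule distr_gauss_add[symmetric]) (use pos in auto)
  also have "\<dots> = distr (gauss s c \<Otimes>\<^sub>M gauss t e) borel (\<lambda>(x, y). a *\<^sub>R x + b *\<^sub>R y)"
    unfolding eq by (subst distr_distr) (auto simp: comp_def case_prod_beta intro!: distr_cong)
  finally show ?thesis ..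
qed

section \<open>Second moments\<close>

text \<open>The square of the norm is absorbed by half of the exponent, which leaves a Gaussian of twice
  the variance.\<close>

lemma integrable_gauss_norm_sq:
  assumes v: "v > 0"
  shows "integrable (gauss v (0::'a::euclidean_space)) (\<lambda>x. (norm x)\<^sup>2)"
proof -
  define C where "C = (2 * pi * v) powr (- real DIM('a) / 2) / (2 * pi * (2 * v)) powr (- real DIM('a) / 2) * (4 * v)"
  have bd: "gdens v x * (norm x)\<^sup>2 \<le> C * gdens (2 * v) x" for x :: 'a
  proof -
    have "(norm x)\<^sup>2 / (4 * v) \<le> exp ((norm x)\<^sup>2 / (4 * v))"
      using exp_ge_add_one_self[of "(norm x)\<^sup>2 / (4 * v)"] by linarith
    then have "(norm x)\<^sup>2 \<le> (4 * v) * exp ((norm x)\<^sup>2 / (4 * v))"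
      using v by (simp add: field_simps)
    then have "exp (- (norm x)\<^sup>2 / (2 * v)) * (norm x)\<^sup>2 \<le>
      exp (- (norm x)\<^sup>2 / (2 * v)) * ((4 * v) * exp ((norm x)\<^sup>2 / (4 * v)))"
      by (rule mult_left_mono) simp
    also have "\<dots> = 4 * v * exp (- (norm x)\<^sup>2 / (2 * v) + (norm x)\<^sup>2 / (4 * v))"
      by (simp only: exp_add) (simp add: mult_ac)
    also have "- (norm x)\<^sup>2 / (2 * v) + (norm x)\<^sup>2 / (4 * v) = - (norm x)\<^sup>2 / (2 * (2 * v))"
      using v by (simp add: field_simps)
    finally have "exp (- (norm x)\<^sup>2 / (2 * v)) * (norm x)\<^sup>2 \<le> 4 * v * exp (- (norm x)\<^sup>2 / (2 * (2 * v)))" .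
    then have "(2 * pi * v) powr (- real DIM('a) / 2) * (exp (- (norm x)\<^sup>2 / (2 * v)) * (norm x)\<^sup>2) \<le>
      (2 * pi * v) powr (- real DIM('a) / 2) * (4 * v * exp (- (norm x)\<^sup>2 / (2 * (2 * v))))"
      by (rule mult_left_mono) simp
    then show ?thesis using v unfolding gdens_def C_def by (simp add: field_simps)
  qed
  have "integrable lborel (\<lambda>x::'a. gdens v x * (norm x)\<^sup>2)"
  proof (rule Bochner_Integration.integrable_bound)
    show "integrable lborel (\<lambda>x::'a. C * gdens (2 * v) x)"
      using integrable_gdens[of "2 * v" "0::'a"] v by simp
    show "AE x in lborel. norm (gdens v x * (norm x)\<^sup>2) \<le> norm (C * gdens (2 * v) (x::'a))"
      using order_trans[OF bd abs_ge_self] by (intro AE_I2) simp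
  qed auto
  then show ?thesis by (subst integrable_gauss_iff) auto
qed

lemma integral_gauss_affine:
  fixes f :: "'a::euclidean_space \<Rightarrow> real"
  assumes "v > 0" "a \<noteq> 0" and [measurable]: "f \<in> borel_measurable borel"
  shows "(\<integral> x. f (b + a *\<^sub>R x) \<partial>gauss v c) = (\<integral> x. f x \<partial>gauss (a\<^sup>2 * v) (b + a *\<^sub>R c))"
    and "integrable (gauss v c) (\<lambda>x. f (b + a *\<^sub>R x)) \<longleftrightarrow>
      integrable (gauss (a\<^sup>2 * v) (b + a *\<^sub>R c)) f"
  unfolding distr_gauss_affine[OF assms(1,2), symmetric]
  by (subst integral_distr; simp) (subst integrable_distr_eq; simp)

text \<open>This number is the dimension, but only its finiteness matters: it cancels from every risk
  computed below.\<close>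

definition std_second_moment :: "'a::euclidean_space itself \<Rightarrow> real" where
  "std_second_moment _ = (\<integral> x. (norm (x::'a))\<^sup>2 \<partial>gauss 1 0)"

text \<open>After standardising, the mixed term of the expanded square is odd and integrates to zero.\<close>

lemma gauss_second_moment:
  fixes b c :: "'a::euclidean_space"
  assumes v: "v > 0"
  shows "(\<integral> x. (norm (b + a *\<^sub>R x))\<^sup>2 \<partial>gauss v c) =
      (norm (b + a *\<^sub>R c))\<^sup>2 + a\<^sup>2 * v * std_second_moment TYPE('a)"
    and "integrable (gauss v c) (\<lambda>x. (norm (b + a *\<^sub>R x))\<^sup>2)"
proof -
  define u \<alpha> where "u = b + a *\<^sub>R c" and "\<alpha> = a * sqrt v"
  interpret P: prob_space "gauss 1 (0::'a)" by (rule prob_space_gauss) simp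
  have ex: "(norm (u + \<alpha> *\<^sub>R x))\<^sup>2 = (norm u)\<^sup>2 + 2 * \<alpha> * (u \<bullet> x) + \<alpha>\<^sup>2 * (norm x)\<^sup>2" for x
    unfolding power2_norm_eq_inner
    by (simp add: inner_simps inner_commute power2_eq_square algebra_simps)
  have i2: "integrable (gauss 1 (0::'a)) (\<lambda>x. (norm x)\<^sup>2)"
    by (rule integrable_gauss_norm_sq) simp
  have i1: "integrable (gauss 1 (0::'a)) (\<lambda>x. u \<bullet> x)"
  proof (rule Bochner_Integration.integrable_bound)
    show "integrable (gauss 1 (0::'a)) (\<lambda>x. (norm u)\<^sup>2 + (norm x)\<^sup>2)" using i2 by simp
    have "\<bar>u \<bullet> x\<bar> \<le> (norm u)\<^sup>2 + (norm x)\<^sup>2" for x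
    proof -
      have "0 \<le> (norm u - norm x)\<^sup>2" by simp
      then have "2 * (norm u * norm x) \<le> (norm u)\<^sup>2 + (norm x)\<^sup>2" by (simp add: power2_diff)
      moreover have "\<bar>u \<bullet> x\<bar> \<le> norm u * norm x" by (rule Cauchy_Schwarz_ineq2)
      moreover have "0 \<le> norm u * norm x" by simp
      ultimately show ?thesis by linarith
    qed
    then show "AE x in gauss 1 0. norm (u \<bullet> x) \<le> norm ((norm u)\<^sup>2 + (norm x)\<^sup>2)"
      by (intro AE_I2) (auto intro: order_trans)
  qed auto
  have "(\<integral> x. u \<bullet> x \<partial>gauss 1 (0::'a)) = (\<integral> x. u \<bullet> (0 + (-1) *\<^sub>R x) \<partial>gauss 1 (0::'a))"
    by (subst integral_gauss_affine(1)) auto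
  then have z: "(\<integral> x. u \<bullet> x \<partial>gauss 1 (0::'a)) = 0" by simp
  have int: "integrable (gauss 1 (0::'a)) (\<lambda>x. (norm (u + \<alpha> *\<^sub>R x))\<^sup>2)"
    unfolding ex using i1 i2 by simp
  have val: "(\<integral> x. (norm (u + \<alpha> *\<^sub>R x))\<^sup>2 \<partial>gauss 1 (0::'a)) = (norm u)\<^sup>2 + a\<^sup>2 * v * std_second_moment TYPE('a)"
    unfolding ex using i1 i2 z v P.prob_space
    by (simp add: std_second_moment_def \<alpha>_def power_mult_distrib)
  have comp: "b + a *\<^sub>R (c + sqrt v *\<^sub>R x) = u + \<alpha> *\<^sub>R x" for x
    by (simp add: u_def \<alpha>_def algebra_simps)
  have sv: "sqrt v \<noteq> 0" using v by simp
  note A = integral_gauss_affine[OF zero_less_one sv, where f = "\<lambda>x. (norm (b + a *\<^sub>R x))\<^sup>2"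
    and b = c and c = "0::'a"]
  show "(\<integral> x. (norm (b + a *\<^sub>R x))\<^sup>2 \<partial>gauss v c) =
      (norm (b + a *\<^sub>R c))\<^sup>2 + a\<^sup>2 * v * std_second_moment TYPE('a)"
    and "integrable (gauss v c) (\<lambda>x. (norm (b + a *\<^sub>R x))\<^sup>2)"
    using A val int v unfolding comp by (simp_all add: u_def)
qed

section \<open>Superharmonic functions decrease under Gaussian averaging\<close>

lemma second_derivative_nonpos_at_max:
  fixes w w' :: "real \<Rightarrow> real"
  assumes w: "\<And>t. (w has_real_derivative w' t) (at t)"
    and w': "(w' has_real_derivative w2) (at 0)"
    and max: "\<And>t. w t \<le> w 0"
  shows "w2 \<le> 0"
proof (rule ccontr)
  assume "\<not> w2 \<le> 0"
  then have "w2 > 0" by simp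
  have "w' 0 = 0" by (rule DERIV_local_max[OF w[of 0], of 1]) (auto simp: max)
  obtain d where "d > 0" and d: "\<And>h. h > 0 \<Longrightarrow> h < d \<Longrightarrow> w' 0 < w' (0 + h)"
    using DERIV_pos_inc_right[OF w' \<open>w2 > 0\<close>] by blast
  obtain z where z: "0 < z" "z < d / 2" "w (d / 2) - w 0 = (d / 2 - 0) * w' z"
    using MVT2[of 0 "d / 2" w w'] w \<open>d > 0\<close> by auto
  have "w' z > 0" using d[of z] z \<open>w' 0 = 0\<close> \<open>d > 0\<close> by auto
  then have "0 < (d / 2 - 0) * w' z" using \<open>d > 0\<close> by simp
  then show False using z(3) max[of "d / 2"] by linarith
qed

lemma gdens_has_space_derivative:
  fixes D b :: "'a::euclidean_space"
  assumes "t > 0" "norm b = 1"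
  shows "((\<lambda>\<tau>. gdens t (D - \<tau> *\<^sub>R b)) has_real_derivative
      gdens t (D - \<tau> *\<^sub>R b) * ((D \<bullet> b - \<tau>) / t)) (at \<tau> within S)"
proof -
  have "b \<bullet> b = 1" using assms by (simp add: norm_eq_1)
  then have n: "(norm (D - \<tau> *\<^sub>R b))\<^sup>2 = D \<bullet> D - 2 * \<tau> * (D \<bullet> b) + \<tau>\<^sup>2" for \<tau>
    unfolding power2_norm_eq_inner
    by (simp add: inner_simps inner_commute power2_eq_square algebra_simps)
  show ?thesis
    unfolding gdens_def n using \<open>t > 0\<close>
    by (auto intro!: derivative_eq_intros simp: field_simps)
qed

lemma gdens_has_time_derivative:
  fixes x :: "'a::euclidean_space"
  assumes "t > 0"
  shows "((\<lambda>t. gdens t x) has_real_derivative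
      gdens t x * (- real DIM('a) / (2 * t) + (norm x)\<^sup>2 / (2 * t\<^sup>2))) (at t within S)"
proof -
  have p: "(2 * pi * t) powr (- (real DIM('a) / 2) - 1) = (2 * pi * t) powr (- (real DIM('a) / 2)) / (2 * pi * t)"
    using assms by (simp add: powr_diff)
  have 1: "((\<lambda>t. (2 * pi * t) powr (- real DIM('a) / 2)) has_real_derivative
      (2 * pi * t) powr (- real DIM('a) / 2) * (- real DIM('a) / (2 * t))) (at t within S)"
    using assms by (auto intro!: derivative_eq_intros simp: p)
  have 2: "((\<lambda>t. exp (- (norm x)\<^sup>2 / (2 * t))) has_real_derivative
      exp (- (norm x)\<^sup>2 / (2 * t)) * ((norm x)\<^sup>2 / (2 * t\<^sup>2))) (at t within S)"
    using assms by (auto intro!: derivative_eq_intros simp: power2_eq_square field_simps)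
  show ?thesis
    unfolding gdens_def by (rule DERIV_cong[OF DERIV_mult[OF 1 2]]) (simp add: algebra_simps)
qed

text \<open>The heat flow of the restriction of \<open>k\<close> to a box. Over a compact box, differentiation under
  the integral sign only requires continuity of the derivatives of the kernel. Each derivative is
  again a \<open>box_heat\<close>, with \<open>k\<close> multiplied by the logarithmic derivative of the kernel.\<close>

definition box_heat :: "'a::euclidean_space \<Rightarrow> 'a \<Rightarrow> ('a \<Rightarrow> real) \<Rightarrow> real \<Rightarrow> 'a \<Rightarrow> real" where
  "box_heat l u k t x = integral (cbox l u) (\<lambda>y. gdens t (y - x) * k y)"

lemma continuous_on_gdens [continuous_intros]:
  assumes "continuous_on S f" "continuous_on S h" "\<And>z. z \<in> S \<Longrightarrow> f z > 0"
  shows "continuous_on S (\<lambda>z. gdens (f z) (h z))"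
proof -
  have "\<And>z. z \<in> S \<Longrightarrow> f z \<noteq> 0" using assms(3) by force
  then show ?thesis
    unfolding gdens_def using assms(1,2) by (intro continuous_intros) auto
qed

lemma box_heat_has_time_derivative:
  fixes k :: "'a::euclidean_space \<Rightarrow> real"
  assumes k: "continuous_on UNIV k" and "t > 0"
  shows "((\<lambda>t. box_heat l u k t x) has_real_derivative
    box_heat l u (\<lambda>y. (- real DIM('a) / (2 * t) + (norm (y - x))\<^sup>2 / (2 * t\<^sup>2)) * k y) t x) (at t)"
proof -
  note [continuous_intros] = continuous_on_compose2[OF k _ subset_UNIV]
  have "((\<lambda>t. box_heat l u k t x) has_real_derivative
    box_heat l u (\<lambda>y. (- real DIM('a) / (2 * t) + (norm (y - x))\<^sup>2 / (2 * t\<^sup>2)) * k y) t x) (at t within {0<..})"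
    unfolding box_heat_def mult.assoc[symmetric]
  proof (rule leibniz_rule_field_derivative)
    show "((\<lambda>t. gdens t (y - x) * k y) has_real_derivative
      gdens s (y - x) * (- real DIM('a) / (2 * s) + (norm (y - x))\<^sup>2 / (2 * s\<^sup>2)) * k y) (at s within {0<..})"
      if "s \<in> {0<..}" for s y
      using that by (intro DERIV_cmult_right gdens_has_time_derivative) auto
    show "(\<lambda>y. gdens s (y - x) * k y) integrable_on cbox l u" if "s \<in> {0<..}" for s
      using that by (intro integrable_continuous continuous_intros) auto
    show "continuous_on ({0<..} \<times> cbox l u)
      (\<lambda>(s, y). gdens s (y - x) * (- real DIM('a) / (2 * s) + (norm (y - x))\<^sup>2 / (2 * s\<^sup>2)) * k y)"
      unfolding case_prod_beta by (intro continuous_intros) auto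
  qed (use \<open>t > 0\<close> in auto)
  then show ?thesis using \<open>t > 0\<close> by (subst (asm) at_within_open) auto
qed

lemma box_heat_has_space_derivative:
  fixes k :: "'a::euclidean_space \<Rightarrow> real"
  assumes k: "continuous_on UNIV k" and "t > 0" and b: "norm b = 1"
  shows "((\<lambda>\<tau>. box_heat l u k t (x + \<tau> *\<^sub>R b)) has_real_derivative
      box_heat l u (\<lambda>y. (((y - x) \<bullet> b - \<tau>) / t) * k y) t (x + \<tau> *\<^sub>R b)) (at \<tau>)"
    and "((\<lambda>\<tau>. box_heat l u (\<lambda>y. (((y - x) \<bullet> b - \<tau>) / t) * k y) t (x + \<tau> *\<^sub>R b)) has_real_derivative
      box_heat l u (\<lambda>y. (((y - x) \<bullet> b)\<^sup>2 / t\<^sup>2 - 1 / t) * k y) t x) (at 0)"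
proof -
  note [continuous_intros] = continuous_on_compose2[OF k _ subset_UNIV]
  have eq: "y - (x + \<tau> *\<^sub>R b) = y - x - \<tau> *\<^sub>R b" for y \<tau> by simp
  show "((\<lambda>\<tau>. box_heat l u k t (x + \<tau> *\<^sub>R b)) has_real_derivative
      box_heat l u (\<lambda>y. (((y - x) \<bullet> b - \<tau>) / t) * k y) t (x + \<tau> *\<^sub>R b)) (at \<tau>)"
    unfolding box_heat_def eq mult.assoc[symmetric]
  proof (rule leibniz_rule_field_derivative)
    show "((\<lambda>\<tau>. gdens t (y - x - \<tau> *\<^sub>R b) * k y) has_real_derivative
      gdens t (y - x - s *\<^sub>R b) * (((y - x) \<bullet> b - s) / t) * k y) (at s within UNIV)" for s y
      using assms by (intro DERIV_cmult_right gdens_has_space_derivative) auto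
    show "(\<lambda>y. gdens t (y - x - s *\<^sub>R b) * k y) integrable_on cbox l u" for s
      using assms(2) by (intro integrable_continuous continuous_intros) auto
    show "continuous_on (UNIV \<times> cbox l u)
      (\<lambda>(\<tau>, y). gdens t (y - x - \<tau> *\<^sub>R b) * (((y - x) \<bullet> b - \<tau>) / t) * k y)"
      unfolding case_prod_beta using assms(2) by (intro continuous_intros) auto
  qed auto
  have "((\<lambda>\<tau>. box_heat l u (\<lambda>y. (((y - x) \<bullet> b - \<tau>) / t) * k y) t (x + \<tau> *\<^sub>R b)) has_real_derivative
      box_heat l u (\<lambda>y. (((y - x) \<bullet> b - 0)\<^sup>2 / t\<^sup>2 - 1 / t) * k y) t (x + 0 *\<^sub>R b)) (at 0)"
    unfolding box_heat_def eq mult.assoc[symmetric]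
  proof (rule leibniz_rule_field_derivative)
    show "((\<lambda>\<tau>. gdens t (y - x - \<tau> *\<^sub>R b) * (((y - x) \<bullet> b - \<tau>) / t) * k y) has_real_derivative
      gdens t (y - x - s *\<^sub>R b) * (((y - x) \<bullet> b - s)\<^sup>2 / t\<^sup>2 - 1 / t) * k y) (at s within UNIV)" for s y
    proof (rule DERIV_cmult_right, rule DERIV_cong)
      show "((\<lambda>\<tau>. gdens t (y - x - \<tau> *\<^sub>R b) * (((y - x) \<bullet> b - \<tau>) / t)) has_real_derivative
        gdens t (y - x - s *\<^sub>R b) * (((y - x) \<bullet> b - s) / t) * (((y - x) \<bullet> b - s) / t) +
        (- 1 / t) * gdens t (y - x - s *\<^sub>R b)) (at s within UNIV)"
        using assms(2) b
        by (intro DERIV_mult gdens_has_space_derivative) (auto intro!: derivative_eq_intros)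
    qed (use assms(2) in \<open>simp add: power2_eq_square field_simps\<close>)
    show "(\<lambda>y. gdens t (y - x - s *\<^sub>R b) * (((y - x) \<bullet> b - s) / t) * k y) integrable_on cbox l u" for s
      using assms(2) by (intro integrable_continuous continuous_intros) auto
    show "continuous_on (UNIV \<times> cbox l u)
      (\<lambda>(\<tau>, y). gdens t (y - x - \<tau> *\<^sub>R b) * (((y - x) \<bullet> b - \<tau>)\<^sup>2 / t\<^sup>2 - 1 / t) * k y)"
      unfolding case_prod_beta using assms(2) by (intro continuous_intros) auto
  qed auto
  then show "((\<lambda>\<tau>. box_heat l u (\<lambda>y. (((y - x) \<bullet> b - \<tau>) / t) * k y) t (x + \<tau> *\<^sub>R b)) has_real_derivative
      box_heat l u (\<lambda>y. (((y - x) \<bullet> b)\<^sup>2 / t\<^sup>2 - 1 / t) * k y) t x) (at 0)"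
    by simp
qed

text \<open>The heat equation: the two sides are the second space derivatives and the time derivative
  computed above, and already the kernels agree.\<close>

lemma box_heat_equation:
  fixes k :: "'a::euclidean_space \<Rightarrow> real"
  assumes k: "continuous_on UNIV k" and "t > 0"
  shows "(\<Sum>b\<in>Basis. box_heat l u (\<lambda>y. (((y - x) \<bullet> b)\<^sup>2 / t\<^sup>2 - 1 / t) * k y) t x) =
    2 * box_heat l u (\<lambda>y. (- real DIM('a) / (2 * t) + (norm (y - x))\<^sup>2 / (2 * t\<^sup>2)) * k y) t x"
proof -
  note [continuous_intros] = continuous_on_compose2[OF k _ subset_UNIV]
  have n: "(norm z)\<^sup>2 = (\<Sum>b\<in>Basis. (z \<bullet> b)\<^sup>2)" for z :: 'a
    unfolding power2_norm_eq_inner by (simp add: euclidean_inner[of z z] power2_eq_square)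
  have "(\<Sum>b\<in>Basis. (((y - x) \<bullet> b)\<^sup>2 / t\<^sup>2 - 1 / t) * k y) =
      2 * ((- real DIM('a) / (2 * t) + (norm (y - x))\<^sup>2 / (2 * t\<^sup>2)) * k y)" for y
  proof -
    have "(\<Sum>b\<in>Basis. (((y - x) \<bullet> b)\<^sup>2 / t\<^sup>2 - 1 / t) * k y) = ((\<Sum>b\<in>Basis. ((y - x) \<bullet> b)\<^sup>2) / t\<^sup>2 - real DIM('a) / t) * k y"
      by (simp add: sum_distrib_right[symmetric] sum_subtractf sum_divide_distrib[symmetric])
    then show ?thesis unfolding n by (simp add: field_simps)
  qed
  moreover have "(\<Sum>b\<in>Basis. box_heat l u (\<lambda>y. (((y - x) \<bullet> b)\<^sup>2 / t\<^sup>2 - 1 / t) * k y) t x) =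
    box_heat l u (\<lambda>y. \<Sum>b\<in>Basis. (((y - x) \<bullet> b)\<^sup>2 / t\<^sup>2 - 1 / t) * k y) t x"
    unfolding box_heat_def sum_distrib_left using \<open>t > 0\<close>
    by (intro integral_sum[symmetric] integrable_continuous continuous_intros) auto
  ultimately show ?thesis
    unfolding box_heat_def by (simp only: mult.left_commute[of _ 2] integral_mult_right)
qed

lemma gauss_integral_eq_box_heat:
  fixes k :: "'a::euclidean_space \<Rightarrow> real"
  assumes k: "continuous_on UNIV k" and supp: "\<And>y. y \<notin> cbox l u \<Longrightarrow> k y = 0" and "t > 0"
  shows "(\<integral> z. k (x + sqrt t *\<^sub>R z) \<partial>gauss 1 0) = box_heat l u k t x"
proof -
  have [measurable]: "k \<in> borel_measurable borel" using k by (rule borel_measurable_continuous_onI)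
  have cont: "continuous_on (cbox l u) (\<lambda>y. gdens t (y - x) * k y)"
    using \<open>t > 0\<close> by (intro continuous_intros continuous_on_subset[OF k]) auto
  have "(\<integral> z. k (x + sqrt t *\<^sub>R z) \<partial>gauss 1 0) = (\<integral> y. k y \<partial>gauss t x)"
    using \<open>t > 0\<close> by (subst integral_gauss_affine(1)) auto
  also have "\<dots> = (\<integral> y. gdens t (y - x) * k y \<partial>lborel)"
    by (rule integral_gauss) measurable
  also have "\<dots> = (LINT y:cbox l u|lborel. gdens t (y - x) * k y)"
    unfolding set_lebesgue_integral_def
    by (rule Bochner_Integration.integral_cong) (auto simp: indicator_def supp)
  also have "\<dots> = box_heat l u k t x"
    unfolding box_heat_def
    by (rule set_borel_integral_eq_integral)
      (unfold set_integrable_def, rule borel_integrable_compact[OF compact_cbox cont])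
  finally show ?thesis .
qed

text \<open>Written over the standard Gaussian, the heat flow is defined and continuous up to \<open>t = 0\<close>,
  where \<open>box_heat\<close> degenerates.\<close>

lemma continuous_on_gauss_average:
  fixes k :: "'a::euclidean_space \<Rightarrow> real"
  assumes k: "continuous_on UNIV k" and bd: "\<And>y. \<bar>k y\<bar> \<le> M"
  shows "continuous_on S (\<lambda>(x, t). \<integral> z. k (x + sqrt t *\<^sub>R z) \<partial>gauss 1 0)"
proof (rule continuous_on_sequentiallyI)
  interpret P: prob_space "gauss 1 (0::'a)" by (rule prob_space_gauss) simp
  have [measurable]: "k \<in> borel_measurable borel" using k by (rule borel_measurable_continuous_onI)
  fix X and p :: "'a \<times> real" assume X: "X \<longlonglongrightarrow> p"
  have "(\<lambda>n. \<integral> z. k (fst (X n) + sqrt (snd (X n)) *\<^sub>R z) \<partial>gauss 1 0) \<longlonglongrightarrow>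
     (\<integral> z. k (fst p + sqrt (snd p) *\<^sub>R z) \<partial>gauss 1 0)"
  proof (rule integral_dominated_convergence[where w = "\<lambda>_. M"])
    show "AE z in gauss 1 0. (\<lambda>n. k (fst (X n) + sqrt (snd (X n)) *\<^sub>R z)) \<longlonglongrightarrow> k (fst p + sqrt (snd p) *\<^sub>R z)"
      using X by (intro AE_I2 continuous_on_tendsto_compose[OF k] tendsto_intros) auto
    show "AE z in gauss 1 0. norm (k (fst (X n) + sqrt (snd (X n)) *\<^sub>R z)) \<le> M" for n
      using bd by simp
  qed auto
  then show "(\<lambda>n. case X n of (x, t) \<Rightarrow> \<integral> z. k (x + sqrt t *\<^sub>R z) \<partial>gauss 1 0) \<longlonglongrightarrow>
     (case p of (x, t) \<Rightarrow> \<integral> z. k (x + sqrt t *\<^sub>R z) \<partial>gauss 1 0)"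
    by (simp add: case_prod_beta)
qed

text \<open>The derivatives \<open>f1 b\<close> and \<open>f2 b\<close> along the basis vectors are pointwise ones, as in the second
  derivative test at a maximum.\<close>

locale superharmonic =
  fixes f :: "'a::euclidean_space \<Rightarrow> real" and f1 f2 :: "'a \<Rightarrow> 'a \<Rightarrow> real"
  assumes cont: "continuous_on UNIV f"
    and nonneg: "0 \<le> f x"
    and f1: "b \<in> Basis \<Longrightarrow> ((\<lambda>\<tau>. f (x + \<tau> *\<^sub>R b)) has_real_derivative f1 b x) (at 0)"
    and f2: "b \<in> Basis \<Longrightarrow> ((\<lambda>\<tau>. f1 b (x + \<tau> *\<^sub>R b)) has_real_derivative f2 b x) (at 0)"
    and laplacian: "(\<Sum>b\<in>Basis. f2 b x) \<le> 0"
begin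

text \<open>Parabolic maximum principle for the difference \<open>U - f\<close> of the heat flow \<open>U\<close> of the minorant
  \<open>k\<close> and \<open>f\<close>. The barrier \<open>\<epsilon> (\<bar>x\<bar>\<^sup>2 + (d + 1) t)\<close> is subtracted for two purposes: it forces a
  positive maximum to be attained, since \<open>U\<close> is bounded and \<open>f \<ge> 0\<close>, and its time derivative
  \<open>\<epsilon> (d + 1)\<close> exceeds \<open>\<epsilon> d\<close>, half of its Laplacian, which contradicts the heat equation at the
  maximum. The maximum is not attained at \<open>t = 0\<close> because \<open>k \<le> f\<close>.\<close>

lemma gauss_average_le_of_compact_support:
  assumes k: "continuous_on UNIV k" and supp: "\<And>y. y \<notin> cbox l u \<Longrightarrow> k y = 0"
    and k0: "\<And>y. 0 \<le> k y" and kf: "\<And>y. k y \<le> f y" and "T > 0"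
  shows "(\<integral> z. k (x + sqrt T *\<^sub>R z) \<partial>gauss 1 0) \<le> f x"
proof (rule ccontr)
  define d where "d = real DIM('a)"
  define U where "U = (\<lambda>x t. \<integral> z. k (x + sqrt t *\<^sub>R z) \<partial>gauss 1 0)"
  interpret P: prob_space "gauss 1 (0::'a)" by (rule prob_space_gauss) simp
  have [measurable]: "k \<in> borel_measurable borel" using k by (rule borel_measurable_continuous_onI)
  have U: "U x t = box_heat l u k t x" if "t > 0" for x t
    using gauss_integral_eq_box_heat[OF k supp that] by (simp add: U_def)
  obtain M where "M > 0" and M: "\<And>y. k y \<le> M"
  proof -
    have "bounded (k ` cbox l u)"
      by (intro compact_imp_bounded compact_continuous_image continuous_on_subset[OF k]) auto
    then obtain B where "B > 0" "\<And>y. y \<in> cbox l u \<Longrightarrow> norm (k y) \<le> B"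
      unfolding bounded_pos by auto
    then have "k y \<le> B" for y using supp[of y] by (cases "y \<in> cbox l u") force+
    with \<open>B > 0\<close> that show ?thesis by blast
  qed
  have absM: "\<bar>k y\<bar> \<le> M" for y using M k0 by simp
  have UM: "U x t \<le> M" for x t
  proof -
    have "integrable (gauss 1 0) (\<lambda>z. k (x + sqrt t *\<^sub>R z))"
      by (rule P.integrable_const_bound[of _ M]) (use absM in auto)
    then have "U x t \<le> (\<integral> z. M \<partial>gauss 1 (0::'a))"
      unfolding U_def using M by (intro integral_mono) auto
    then show ?thesis using P.prob_space by simp
  qed
  assume "\<not> (\<integral> z. k (x + sqrt T *\<^sub>R z) \<partial>gauss 1 0) \<le> f x"
  then have gap: "U x T - f x > 0" by (simp add: U_def)
  \<comment> \<open>\<open>\<epsilon>\<close> is so small that the barrier at \<open>(x, T)\<close> takes away only half of the gap.\<close>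
  define c where "c = (norm x)\<^sup>2 + (d + 1) * T"
  have "c > 0" using \<open>T > 0\<close> by (simp add: c_def d_def add_nonneg_pos)
  define \<epsilon> where "\<epsilon> = (U x T - f x) / (2 * c)"
  have "\<epsilon> > 0" using gap \<open>c > 0\<close> by (simp add: \<epsilon>_def)
  have ec: "\<epsilon> * c < U x T - f x" using gap \<open>c > 0\<close> by (simp add: \<epsilon>_def)
  define \<Psi> where "\<Psi> = (\<lambda>x t. U x t - f x - \<epsilon> * ((norm x)\<^sup>2 + (d + 1) * t))"
  have \<Psi>pos: "\<Psi> x T > 0" using ec by (simp add: \<Psi>_def c_def)
  \<comment> \<open>Beyond radius \<open>r\<close> the barrier dominates the bound \<open>M\<close> of the heat flow.\<close>
  define r where "r = max (norm x) (sqrt (M / \<epsilon>))"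
  have r0: "r \<ge> 0" "norm x \<le> r" by (auto simp: r_def le_max_iff_disj)
  have rM: "M \<le> \<epsilon> * s\<^sup>2" if "s > r" for s
  proof -
    have "sqrt (M / \<epsilon>) \<le> s" using that by (simp add: r_def)
    then have "M / \<epsilon> \<le> s\<^sup>2" using r0 that by (simp add: real_sqrt_le_iff' sqrt_le_D)
    then show ?thesis using \<open>\<epsilon> > 0\<close> by (simp add: field_simps)
  qed
  define K where "K = cball (0::'a) r \<times> {0..T}"
  have contU: "continuous_on K (\<lambda>p. U (fst p) (snd p))"
    using continuous_on_gauss_average[OF k absM, of K] by (simp add: U_def case_prod_beta)
  have cont\<Psi>: "continuous_on K (\<lambda>p. \<Psi> (fst p) (snd p))"
    unfolding \<Psi>_def
    by (intro continuous_intros contU continuous_on_compose2[OF cont]) auto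
  have "compact K" by (simp add: K_def compact_Times)
  moreover have xT: "(x, T) \<in> K" using r0 \<open>T > 0\<close> by (simp add: K_def)
  ultimately obtain p where p: "p \<in> K" and pmax: "\<And>q. q \<in> K \<Longrightarrow> \<Psi> (fst q) (snd q) \<le> \<Psi> (fst p) (snd p)"
    using continuous_attains_sup[OF _ _ cont\<Psi>] by blast
  obtain x0 t0 where [simp]: "p = (x0, t0)" by (cases p)
  have t0: "0 \<le> t0" "t0 \<le> T" using p by (auto simp: K_def)
  have max0: "0 < \<Psi> x0 t0" using pmax[OF xT] \<Psi>pos by simp
  have maxi: "\<Psi> y t \<le> \<Psi> x0 t0" if "0 \<le> t" "t \<le> T" for y t
  proof (cases "norm y \<le> r")
    case True
    then show ?thesis using pmax[of "(y, t)"] that by (simp add: K_def)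
  next
    case False
    then have "M \<le> \<epsilon> * (norm y)\<^sup>2" using rM by simp
    moreover have "\<epsilon> * ((d + 1) * t) \<ge> 0" using \<open>\<epsilon> > 0\<close> that by (simp add: d_def)
    ultimately have "\<Psi> y t \<le> 0"
      using UM[of y t] nonneg[of y] by (simp add: \<Psi>_def algebra_simps)
    then show ?thesis using max0 by simp
  qed
  have "t0 \<noteq> 0"
  proof
    assume "t0 = 0"
    then have "\<Psi> x0 t0 = k x0 - f x0 - \<epsilon> * (norm x0)\<^sup>2"
      using P.prob_space by (simp add: \<Psi>_def U_def)
    also have "\<dots> \<le> 0" using kf[of x0] \<open>\<epsilon> > 0\<close> by (simp add: add_increasing diff_le_eq)
    finally show False using max0 by simp
  qed
  then have "t0 > 0" using t0 by simp
  define Ut where "Ut = box_heat l u (\<lambda>y. (- d / (2 * t0) + (norm (y - x0))\<^sup>2 / (2 * t0\<^sup>2)) * k y) t0 x0"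
  have "((\<lambda>t. U x0 t) has_real_derivative Ut) (at t0)"
    unfolding Ut_def d_def
    by (rule has_field_derivative_transform_within_open[OF box_heat_has_time_derivative[OF k \<open>t0 > 0\<close>]
          open_greaterThan[of 0]]) (use \<open>t0 > 0\<close> U in auto)
  then have dt: "((\<lambda>t. \<Psi> x0 t) has_real_derivative Ut - \<epsilon> * (d + 1)) (at t0)"
    unfolding \<Psi>_def by (auto intro!: derivative_eq_intros)
  \<comment> \<open>The maximum may lie at the final time \<open>T\<close>, so it is compared with earlier times only.\<close>
  have time: "Ut - \<epsilon> * (d + 1) \<ge> 0"
  proof (rule ccontr)
    assume "\<not> Ut - \<epsilon> * (d + 1) \<ge> 0"
    then obtain \<delta> where "\<delta> > 0" and \<delta>: "\<And>h. 0 < h \<Longrightarrow> h < \<delta> \<Longrightarrow> \<Psi> x0 t0 < \<Psi> x0 (t0 - h)"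
      using DERIV_neg_dec_left[OF dt] by auto
    define h where "h = min (\<delta> / 2) t0"
    have "0 < h" "h < \<delta>" "h \<le> t0" using \<open>\<delta> > 0\<close> \<open>t0 > 0\<close> by (auto simp: h_def)
    then show False using \<delta>[of h] maxi[of "t0 - h" x0] t0 by simp
  qed
  define I where "I b = box_heat l u (\<lambda>y. (((y - x0) \<bullet> b)\<^sup>2 / t0\<^sup>2 - 1 / t0) * k y) t0 x0" for b
  have space: "I b - f2 b x0 - 2 * \<epsilon> \<le> 0" if b: "b \<in> Basis" for b
  proof (rule second_derivative_nonpos_at_max)
    have nb: "norm b = 1" using b by simp
    have n: "(norm (x0 + \<tau> *\<^sub>R b))\<^sup>2 = x0 \<bullet> x0 + 2 * \<tau> * (x0 \<bullet> b) + \<tau>\<^sup>2" for \<tau>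
      unfolding power2_norm_eq_inner using b
      by (simp add: inner_simps inner_commute power2_eq_square algebra_simps)
    define J where "J \<tau> = box_heat l u (\<lambda>y. (((y - x0) \<bullet> b - \<tau>) / t0) * k y) t0 (x0 + \<tau> *\<^sub>R b)" for \<tau>
    have dJ: "((\<lambda>\<tau>. U (x0 + \<tau> *\<^sub>R b) t0) has_real_derivative J \<tau>) (at \<tau>)" for \<tau>
      unfolding J_def U[OF \<open>t0 > 0\<close>] by (rule box_heat_has_space_derivative(1)[OF k \<open>t0 > 0\<close> nb])
    have dI: "(J has_real_derivative I b) (at 0)"
      unfolding J_def I_def by (rule box_heat_has_space_derivative(2)[OF k \<open>t0 > 0\<close> nb])
    have df: "((\<lambda>\<tau>. f (x0 + \<tau> *\<^sub>R b)) has_real_derivative f1 b (x0 + \<tau> *\<^sub>R b)) (at \<tau>)" for \<tau>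
    proof -
      have "((\<lambda>s. f (x0 + (s + \<tau>) *\<^sub>R b)) has_real_derivative f1 b (x0 + \<tau> *\<^sub>R b)) (at 0)"
        using f1[OF b, of "x0 + \<tau> *\<^sub>R b"] by (simp add: algebra_simps)
      then show ?thesis
        using DERIV_shift[of "\<lambda>\<tau>. f (x0 + \<tau> *\<^sub>R b)" _ 0 \<tau>] by simp
    qed
    show "((\<lambda>\<tau>. \<Psi> (x0 + \<tau> *\<^sub>R b) t0) has_real_derivative
        (J \<tau> - f1 b (x0 + \<tau> *\<^sub>R b) - \<epsilon> * (2 * (x0 \<bullet> b) + 2 * \<tau>))) (at \<tau>)" for \<tau>
      unfolding \<Psi>_def n
      by (rule DERIV_cong[OF DERIV_diff[OF DERIV_diff[OF dJ df]]])
        (auto intro!: derivative_eq_intros)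
    show "((\<lambda>\<tau>. J \<tau> - f1 b (x0 + \<tau> *\<^sub>R b) - \<epsilon> * (2 * (x0 \<bullet> b) + 2 * \<tau>)) has_real_derivative
        I b - f2 b x0 - 2 * \<epsilon>) (at 0)"
      by (auto intro!: derivative_eq_intros dI f2[OF b])
    show "\<Psi> (x0 + \<tau> *\<^sub>R b) t0 \<le> \<Psi> (x0 + 0 *\<^sub>R b) t0" for \<tau>
      using maxi[OF t0] by simp
  qed
  have "(\<Sum>b\<in>Basis. I b) = 2 * Ut"
    unfolding I_def Ut_def d_def by (rule box_heat_equation[OF k \<open>t0 > 0\<close>])
  moreover have "(\<Sum>b\<in>Basis. I b - f2 b x0 - 2 * \<epsilon>) \<le> 0"
    by (rule sum_nonpos) (rule space)
  moreover have "(\<Sum>b\<in>Basis. I b - f2 b x0 - 2 * \<epsilon>) = (\<Sum>b\<in>Basis. I b) - (\<Sum>b\<in>Basis. f2 b x0) - 2 * (\<epsilon> * d)"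
    by (simp add: sum_subtractf d_def)
  ultimately have "Ut \<le> \<epsilon> * d"
    using laplacian[of x0] by linarith
  then show False using time \<open>\<epsilon> > 0\<close> by (simp add: algebra_simps)
qed

text \<open>The cut-offs of \<open>f\<close> are compactly supported minorants that increase to \<open>f\<close>. The inequality
  includes that \<open>f\<close> has finite Gaussian averages.\<close>

theorem gauss_average_le:
  assumes "t > 0"
  shows "(\<integral>\<^sup>+ y. ennreal (f y) \<partial>gauss t x) \<le> ennreal (f x)"
proof -
  define cut where "cut = (\<lambda>n y::'a. max 0 (min 1 (real n - norm y)))"
  define k where "k = (\<lambda>n y. cut n y * f y)"
  have cut01: "0 \<le> cut n y" "cut n y \<le> 1" for n y by (auto simp: cut_def)
  have kc: "continuous_on UNIV (k n)" for n
    unfolding k_def cut_def by (intro continuous_intros cont)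
  have km [measurable]: "k n \<in> borel_measurable borel" for n
    using kc by (rule borel_measurable_continuous_onI)
  have [measurable]: "f \<in> borel_measurable borel" using cont by (rule borel_measurable_continuous_onI)
  have k0: "0 \<le> k n y" for n y using cut01 nonneg by (simp add: k_def)
  have kf: "k n y \<le> f y" for n y using cut01 nonneg by (simp add: k_def mult_left_le_one_le)
  have le: "(\<integral>\<^sup>+ y. ennreal (k n y) \<partial>gauss t x) \<le> ennreal (f x)" for n
  proof -
    interpret P: prob_space "gauss t x" by (rule prob_space_gauss) fact
    obtain u where u: "cball (0::'a) (real n) \<subseteq> cbox (- u) u"
      using bounded_subset_cbox_symmetric[OF bounded_cball] by blast
    have supp: "k n y = 0" if "y \<notin> cbox (- u) u" for y
      using that u by (auto simp: k_def cut_def subset_eq)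
    have "bounded (k n ` cbox (- u) u)"
      by (intro compact_imp_bounded compact_continuous_image continuous_on_subset[OF kc]) auto
    then obtain B where "\<And>y. y \<in> cbox (- u) u \<Longrightarrow> norm (k n y) \<le> B" "B > 0"
      unfolding bounded_pos by auto
    then have "norm (k n y) \<le> B" for y using supp[of y] by (cases "y \<in> cbox (- u) u") force+
    then have int: "integrable (gauss t x) (k n)"
      by (intro P.integrable_const_bound[of _ B]) auto
    have "(\<integral> y. k n y \<partial>gauss t x) = (\<integral> z. k n (x + sqrt t *\<^sub>R z) \<partial>gauss 1 0)"
      using assms by (subst integral_gauss_affine(1)) auto
    also have "\<dots> \<le> f x"
      by (rule gauss_average_le_of_compact_support[OF kc supp k0 kf assms])
    finally show ?thesis
      using int k0 by (subst nn_integral_eq_integral) (auto intro: ennreal_leI)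
  qed
  have "(\<integral>\<^sup>+ y. ennreal (f y) \<partial>gauss t x) \<le> (\<integral>\<^sup>+ y. (SUP n. ennreal (k n y)) \<partial>gauss t x)"
  proof (rule nn_integral_mono)
    fix y :: 'a
    obtain n where "norm y + 1 \<le> real n" using real_arch_simple by blast
    then have "k n y = f y" by (simp add: k_def cut_def)
    then show "ennreal (f y) \<le> (SUP n. ennreal (k n y))" by (metis SUP_upper UNIV_I)
  qed
  also have "\<dots> = (SUP n. \<integral>\<^sup>+ y. ennreal (k n y) \<partial>gauss t x)"
  proof (rule nn_integral_monotone_convergence_SUP)
    show "incseq (\<lambda>n y. ennreal (k n y))"
      by (auto simp: incseq_def le_fun_def k_def cut_def intro!: ennreal_leI mult_right_mono nonneg)
  qed auto
  also have "\<dots> \<le> ennreal (f x)" by (rule SUP_least) (rule le)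
  finally show ?thesis .
qed

end

section \<open>The logarithm of a marginal density of a superharmonic prior\<close>

definition gauss_avg :: "('a::euclidean_space \<Rightarrow> real) \<Rightarrow> real \<Rightarrow> 'a \<Rightarrow> real" where
  "gauss_avg f v x = (\<integral> y. f y \<partial>gauss v x)"

lemma integral_gauss_shift:
  fixes F :: "'a::euclidean_space \<Rightarrow> real"
  assumes "s > 0" and [measurable]: "F \<in> borel_measurable borel"
  shows "(\<integral> z. F (w + z) \<partial>gauss s 0) = (\<integral> y. F y \<partial>gauss s w)"
  using integral_gauss_affine(1)[where v = s and a = 1 and f = F and b = w and c = 0] assms by simp

lemma integral_gauss_gauss:
  fixes F :: "'a::euclidean_space \<Rightarrow> real"
  assumes st: "s > 0" "t > 0" and int: "integrable (gauss (s + t) c) F"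
  shows "(\<integral> y. F y \<partial>gauss (s + t) c) = (\<integral> x. (\<integral> y. F y \<partial>gauss t x) \<partial>gauss s c)"
    and "integrable (gauss s c) (\<lambda>x. \<integral> y. F y \<partial>gauss t x)"
proof -
  have [measurable]: "F \<in> borel_measurable borel"
    using borel_measurable_integrable[OF int] by (simp add: measurable_cong_sets[OF sets_gauss refl])
  interpret S: prob_space "gauss s c" by (rule prob_space_gauss) fact
  interpret T: prob_space "gauss t (0::'a)" by (rule prob_space_gauss) fact
  interpret P: pair_prob_space "gauss s c" "gauss t (0::'a)" ..
  have d: "distr (gauss s c \<Otimes>\<^sub>M gauss t 0) borel (\<lambda>(x, y). x + y) = gauss (s + t) c"
    using distr_gauss_add[OF st, of c 0] by simp
  have i: "integrable (gauss s c \<Otimes>\<^sub>M gauss t 0) (\<lambda>(x, y). F (x + y))"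
    using int unfolding d[symmetric] by (subst (asm) integrable_distr_eq) (auto simp: case_prod_unfold)
  have "(\<integral> y. F y \<partial>gauss (s + t) c) = (\<integral> p. F (fst p + snd p) \<partial>(gauss s c \<Otimes>\<^sub>M gauss t 0))"
    unfolding d[symmetric] by (subst integral_distr) (auto simp: case_prod_beta)
  also have "\<dots> = (\<integral> x. (\<integral> y. F (x + y) \<partial>gauss t 0) \<partial>gauss s c)"
    using P.integral_fst'[OF i[unfolded case_prod_beta]] by simp
  finally show "(\<integral> y. F y \<partial>gauss (s + t) c) = (\<integral> x. (\<integral> y. F y \<partial>gauss t x) \<partial>gauss s c)"
    by (simp add: integral_gauss_shift st)
  show "integrable (gauss s c) (\<lambda>x. \<integral> y. F y \<partial>gauss t x)"
    using P.integrable_fst'[OF i[unfolded case_prod_beta]] by (simp add: integral_gauss_shift st)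
qed

locale superharmonic_prior = superharmonic +
  assumes nonzero: "\<exists>x. f x \<noteq> 0"
begin

lemma measurable_f [measurable]: "f \<in> borel_measurable borel"
  using cont by (rule borel_measurable_continuous_onI)

lemma integrable_f:
  assumes "v > 0"
  shows "integrable (gauss v x) f"
  by (rule integrableI_nonneg)
    (use nonneg gauss_average_le[OF assms, of x] in \<open>auto simp: less_top[symmetric] top_unique\<close>)

lemma ennreal_gauss_avg:
  assumes "v > 0"
  shows "ennreal (gauss_avg f v x) = (\<integral>\<^sup>+ y. ennreal (f y) \<partial>gauss v x)"
  unfolding gauss_avg_def
  by (rule nn_integral_eq_integral[symmetric]) (auto simp: integrable_f assms nonneg)

lemma measurable_gauss_avg [measurable]: "gauss_avg f v \<in> borel_measurable borel"
proof -
  have "gauss_avg f v = (\<lambda>x. \<integral> y. gdens v (y - x) * f y \<partial>lborel)"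
    unfolding gauss_avg_def by (auto simp: integral_gauss)
  then show ?thesis by simp
qed

text \<open>The prior is bounded below on some ball, and the Gaussian weight of that ball decays no faster
  than \<open>exp (- \<bar>x\<bar>\<^sup>2 / v)\<close>. The bound makes the negative part of \<open>ln (gauss_avg f v)\<close> grow at
  most quadratically, hence integrable.\<close>

lemma gauss_avg_lower_bound:
  assumes "v > 0"
  obtains A where "A > 0" "\<And>x. A * exp (- (norm x)\<^sup>2 / v) \<le> gauss_avg f v x"
proof -
  obtain x1 where "f x1 \<noteq> 0" using nonzero by blast
  then have "f x1 > 0" using nonneg[of x1] by simp
  then obtain \<delta> where "\<delta> > 0" and \<delta>: "\<And>y. dist y x1 < \<delta> \<Longrightarrow> dist (f y) (f x1) < f x1 / 2"
    using cont[unfolded continuous_on_iff] by (metis UNIV_I half_gt_zero)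
  define B where "B = ball x1 \<delta>"
  have [measurable]: "B \<in> sets borel" by (simp add: B_def)
  have fB: "f x1 / 2 \<le> f y" if "y \<in> B" for y
    using \<delta>[of y] that by (simp add: B_def dist_commute dist_real_def abs_if split: if_splits)
  define R where "R = norm x1 + \<delta>"
  have R: "norm y \<le> R" if "y \<in> B" for y
    using that norm_triangle_ineq2[of y x1] by (simp add: B_def R_def dist_norm norm_minus_commute)
  define C where "C = (2 * pi * v) powr (- real DIM('a) / 2) * exp (- R\<^sup>2 / v)"
  have "C > 0" using \<open>v > 0\<close> by (simp add: C_def)
  have mB: "emeasure lborel B < \<infinity>" using emeasure_lborel_ball_finite[of x1 \<delta>] by (simp add: B_def)
  have "emeasure lborel B \<noteq> 0"
    using open_not_negligible[of B] \<open>\<delta> > 0\<close> by (auto simp: B_def negligible_iff_null_sets null_sets_def emeasure_completion)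
  then have "measure lborel B > 0"
    using mB by (simp add: measure_def enn2real_positive_iff zero_less_iff_neq_zero less_top)
  define A where "A = C * (f x1 / 2) * measure lborel B"
  have "A > 0" using \<open>C > 0\<close> \<open>f x1 > 0\<close> \<open>measure lborel B > 0\<close> by (simp add: A_def)
  moreover have "A * exp (- (norm x)\<^sup>2 / v) \<le> gauss_avg f v x" for x
  proof -
    have pt: "indicator B y * (C * exp (- (norm x)\<^sup>2 / v) * (f x1 / 2)) \<le> gdens v (y - x) * f y" for y
    proof (cases "y \<in> B")
      case True
      have "norm (y - x) \<le> R + norm x" using norm_triangle_ineq4[of y x] R[OF True] by simp
      then have "(norm (y - x))\<^sup>2 \<le> (R + norm x)\<^sup>2" by (rule power_mono) simp
      also have "\<dots> \<le> 2 * R\<^sup>2 + 2 * (norm x)\<^sup>2"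
        using zero_le_power2[of "R - norm x"] by (simp add: power2_eq_square algebra_simps)
      finally have "(norm (y - x))\<^sup>2 / (2 * v) \<le> (2 * R\<^sup>2 + 2 * (norm x)\<^sup>2) / (2 * v)"
        using \<open>v > 0\<close> by (intro divide_right_mono) auto
      then have "- R\<^sup>2 / v + - (norm x)\<^sup>2 / v \<le> - (norm (y - x))\<^sup>2 / (2 * v)"
        using \<open>v > 0\<close> by (simp add: add_divide_distrib)
      then have "exp (- R\<^sup>2 / v) * exp (- (norm x)\<^sup>2 / v) \<le> exp (- (norm (y - x))\<^sup>2 / (2 * v))"
        by (simp only: exp_add[symmetric] exp_le_cancel_iff)
      then have "C * exp (- (norm x)\<^sup>2 / v) \<le> gdens v (y - x)"
        unfolding C_def gdens_def by (simp add: mult.assoc mult_left_mono)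
      then have "C * exp (- (norm x)\<^sup>2 / v) * (f x1 / 2) \<le> gdens v (y - x) * f y"
        using fB[OF True] \<open>f x1 > 0\<close> by (intro mult_mono) auto
      then show ?thesis using True by simp
    qed (simp add: nonneg)
    have "(\<integral> y. indicator B y * (C * exp (- (norm x)\<^sup>2 / v) * (f x1 / 2)) \<partial>lborel) \<le>
        (\<integral> y. gdens v (y - x) * f y \<partial>lborel)"
      using integrable_f[OF assms, of x] mB
      by (intro integral_mono pt) (auto simp: integrable_gauss_iff)
    then show ?thesis
      unfolding gauss_avg_def by (simp add: integral_gauss A_def mult_ac)
  qed
  ultimately show ?thesis using that by blast
qed

lemma gauss_avg_pos:
  assumes "v > 0"
  shows "gauss_avg f v x > 0"
proof -
  obtain A where "A > 0" "\<And>x. A * exp (- (norm x)\<^sup>2 / v) \<le> gauss_avg f v x"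
    using gauss_avg_lower_bound[OF assms] by blast
  then show ?thesis by (meson exp_gt_zero less_le_trans mult_pos_pos)
qed

lemma nn_integral_gauss_avg:
  assumes "s > 0" "v > 0"
  shows "(\<integral>\<^sup>+ y. ennreal (gauss_avg f v y) \<partial>gauss s x) = ennreal (gauss_avg f (s + v) x)"
  using assms by (simp add: ennreal_gauss_avg nn_integral_gauss_gauss)

lemma integrable_gauss_avg:
  assumes "s > 0" "v > 0"
  shows "integrable (gauss s x) (gauss_avg f v)"
  by (rule integrableI_nonneg)
    (use assms in \<open>auto simp: nn_integral_gauss_avg intro!: less_imp_le gauss_avg_pos\<close>)

lemma integral_gauss_avg:
  assumes "s > 0" "v > 0"
  shows "(\<integral> y. gauss_avg f v y \<partial>gauss s x) = gauss_avg f (s + v) x"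
  using nn_integral_gauss_avg[OF assms, of x] gauss_avg_pos[of "s + v" x] assms
  by (intro integral_eq_nn_integral[THEN trans])
    (auto simp: nn_integral_gauss_avg intro!: less_imp_le gauss_avg_pos AE_I2)

text \<open>Averaging the inequality ``average of \<open>f\<close> at most \<open>f\<close>'' once more shows that the
  marginals decrease in the variance.\<close>

lemma gauss_avg_antimono:
  assumes "s > 0" "v > 0"
  shows "gauss_avg f (s + v) x \<le> gauss_avg f v x"
proof -
  have "ennreal (gauss_avg f (v + s) x) = (\<integral>\<^sup>+ y. (\<integral>\<^sup>+ z. ennreal (f z) \<partial>gauss s y) \<partial>gauss v x)"
    using assms by (simp add: ennreal_gauss_avg nn_integral_gauss_gauss)
  also have "\<dots> \<le> (\<integral>\<^sup>+ y. ennreal (f y) \<partial>gauss v x)"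
    by (intro nn_integral_mono gauss_average_le assms)
  also have "\<dots> = ennreal (gauss_avg f v x)" using assms by (simp add: ennreal_gauss_avg)
  finally show ?thesis
    using gauss_avg_pos[OF assms(2), of x] by (simp add: add.commute)
qed

text \<open>Above, the logarithm is dominated by \<open>gauss_avg f v\<close> itself, which has finite averages; below,
  by a quadratic.\<close>

lemma integrable_ln_gauss_avg:
  assumes "s > 0" "v > 0"
  shows "integrable (gauss s c) (\<lambda>x. ln (gauss_avg f v x))"
proof -
  obtain A where A: "A > 0" "\<And>x. A * exp (- (norm x)\<^sup>2 / v) \<le> gauss_avg f v x"
    using gauss_avg_lower_bound[OF assms(2)] by blast
  interpret S: prob_space "gauss s c" by (rule prob_space_gauss) fact
  show ?thesis
  proof (rule Bochner_Integration.integrable_bound)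
    show "integrable (gauss s c) (\<lambda>x. gauss_avg f v x + (\<bar>ln A\<bar> + (norm x)\<^sup>2 / v))"
      using integrable_gauss_avg[OF assms] gauss_second_moment(2)[OF assms(1), where a = 1 and b = 0 and c = c] by simp
    have "\<bar>ln (gauss_avg f v x)\<bar> \<le> gauss_avg f v x + (\<bar>ln A\<bar> + (norm x)\<^sup>2 / v)" for x
    proof -
      have pos: "gauss_avg f v x > 0" by (rule gauss_avg_pos) fact
      have "ln (A * exp (- (norm x)\<^sup>2 / v)) \<le> ln (gauss_avg f v x)"
        using A pos by (intro ln_mono) auto
      then have "ln A - (norm x)\<^sup>2 / v \<le> ln (gauss_avg f v x)"
        using A(1) by (simp add: ln_mult)
      moreover have "ln (gauss_avg f v x) \<le> gauss_avg f v x - 1" using pos by (rule ln_le_minus_one)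
      moreover have "0 \<le> (norm x)\<^sup>2 / v" using assms by simp
      ultimately show ?thesis using pos by linarith
    qed
    then show "AE x in gauss s c. norm (ln (gauss_avg f v x)) \<le> norm (gauss_avg f v x + (\<bar>ln A\<bar> + (norm x)\<^sup>2 / v))"
      by (intro AE_I2) (auto intro: order_trans[OF _ abs_ge_self])
  qed auto
qed

text \<open>Jensen's inequality for the logarithm, in the form \<open>ln z \<le> z - 1\<close>.\<close>

lemma integral_ln_gauss_avg_le:
  assumes "s > 0" "v > 0"
  shows "(\<integral> y. ln (gauss_avg f v y) \<partial>gauss s x) \<le> ln (gauss_avg f v x)"
proof -
  interpret S: prob_space "gauss s x" by (rule prob_space_gauss) fact
  let ?m = "gauss_avg f v"
  have m: "?m y > 0" for y by (rule gauss_avg_pos) fact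
  have "(\<integral> y. ln (?m y) \<partial>gauss s x) \<le> (\<integral> y. ln (?m x) - 1 + ?m y / ?m x \<partial>gauss s x)"
  proof (rule integral_mono)
    show "ln (?m y) \<le> ln (?m x) - 1 + ?m y / ?m x" for y
      using ln_le_minus_one[of "?m y / ?m x"] m[of x] m[of y] by (simp add: ln_div)
  qed (use assms in \<open>auto simp: integrable_ln_gauss_avg integrable_gauss_avg\<close>)
  also have "\<dots> = ln (?m x) - 1 + gauss_avg f (s + v) x / ?m x"
    using assms S.prob_space by (simp add: integrable_gauss_avg integral_gauss_avg)
  also have "\<dots> \<le> ln (?m x)"
    using gauss_avg_antimono[OF assms, of x] m[of x] by simp
  finally show ?thesis .
qed

text \<open>Two effects point in the same direction when the variance grows from \<open>v\<close> to \<open>v + s\<close>: the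
  marginal decreases pointwise, and the additional noise of variance \<open>s\<close> decreases the expectation
  of the superharmonic function \<open>ln (gauss_avg f v)\<close>.\<close>

lemma expected_ln_gauss_avg_antimono:
  assumes "s > 0" "v > 0"
  shows "(\<integral> x. ln (gauss_avg f (v + s) x) \<partial>gauss (v + s) c) \<le> (\<integral> x. ln (gauss_avg f v x) \<partial>gauss v c)"
proof -
  have "(\<integral> x. ln (gauss_avg f (v + s) x) \<partial>gauss (v + s) c) \<le> (\<integral> x. ln (gauss_avg f v x) \<partial>gauss (v + s) c)"
    using assms gauss_avg_antimono[OF assms] gauss_avg_pos
    by (intro integral_mono integrable_ln_gauss_avg) (auto simp: add.commute)
  also have "\<dots> = (\<integral> x. (\<integral> y. ln (gauss_avg f v y) \<partial>gauss s x) \<partial>gauss v c)"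
    using assms by (intro integral_gauss_gauss integrable_ln_gauss_avg) auto
  also have "\<dots> \<le> (\<integral> x. ln (gauss_avg f v x) \<partial>gauss v c)"
    using assms by (intro integral_mono integral_gauss_gauss integral_ln_gauss_avg_le integrable_ln_gauss_avg) auto
  finally show ?thesis .
qed

end

section \<open>The risk of the Bayesian predictive density\<close>

lemma ereal_integral_eq_integral:
  assumes "integrable M h"
  shows "ereal_integral M (\<lambda>x. ereal (h x)) = ereal (\<integral> x. h x \<partial>M)"
proof -
  have fin: "(\<integral>\<^sup>+ x. ennreal (h x) \<partial>M) \<noteq> \<infinity>" "(\<integral>\<^sup>+ x. ennreal (- h x) \<partial>M) \<noteq> \<infinity>"
    using assms by (auto simp: real_integrable_def)
  obtain a where a: "(\<integral>\<^sup>+ x. ennreal (h x) \<partial>M) = ennreal a" "a \<ge> 0"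
    using fin(1) by (cases "\<integral>\<^sup>+ x. ennreal (h x) \<partial>M") auto
  obtain b where b: "(\<integral>\<^sup>+ x. ennreal (- h x) \<partial>M) = ennreal b" "b \<ge> 0"
    using fin(2) by (cases "\<integral>\<^sup>+ x. ennreal (- h x) \<partial>M") auto
  show ?thesis
    unfolding ereal_integral_def real_lebesgue_integral_def[OF assms] using a b by simp
qed

lemma ln_gdens:
  fixes x :: "'a::euclidean_space"
  assumes "v > 0"
  shows "ln (gdens v x) = - real DIM('a) / 2 * ln (2 * pi * v) - (norm x)\<^sup>2 / (2 * v)"
proof -
  have "(2 * pi * v) powr (- real DIM('a) / 2) > 0" "v \<noteq> 0" using assms by simp_all
  then show ?thesis unfolding gdens_def by (simp add: ln_mult ln_powr)
qed

text \<open>The loss of a Gaussian predictive density centred at \<open>c\<close>. It serves twice: for the uniform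
  prior, with \<open>c = X\<close>, and for the Gaussian priors of the lower bound, with \<open>c = s X\<close>.\<close>

lemma integral_ln_gdens_ratio:
  fixes \<theta> c :: "'a::euclidean_space"
  assumes "v > 0" "w > 0"
  shows "integrable (gauss v \<theta>) (\<lambda>y. ln (gdens v (y - \<theta>)) - ln (gdens w (y - c)))"
    and "(\<integral> y. ln (gdens v (y - \<theta>)) - ln (gdens w (y - c)) \<partial>gauss v \<theta>) =
      real DIM('a) / 2 * ln (w / v) - std_second_moment TYPE('a) / 2 +
        ((norm (\<theta> - c))\<^sup>2 + v * std_second_moment TYPE('a)) / (2 * w)"
proof -
  interpret P: prob_space "gauss v \<theta>" by (rule prob_space_gauss) fact
  have eq: "ln (gdens v (y - \<theta>)) - ln (gdens w (y - c)) =
    real DIM('a) / 2 * ln (w / v) - (norm (y - \<theta>))\<^sup>2 / (2 * v) + (norm (y - c))\<^sup>2 / (2 * w)" for y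
    using assms by (simp add: ln_gdens ln_div ln_mult field_simps)
  have i: "integrable (gauss v \<theta>) (\<lambda>y. (norm (y - e))\<^sup>2)"
    and m: "(\<integral> y. (norm (y - e))\<^sup>2 \<partial>gauss v \<theta>) = (norm (\<theta> - e))\<^sup>2 + v * std_second_moment TYPE('a)" for e
    using gauss_second_moment[OF assms(1), where a = 1 and b = "- e" and c = \<theta>] by simp_all
  show "integrable (gauss v \<theta>) (\<lambda>y. ln (gdens v (y - \<theta>)) - ln (gdens w (y - c)))"
    unfolding eq using i by simp
  show "(\<integral> y. ln (gdens v (y - \<theta>)) - ln (gdens w (y - c)) \<partial>gauss v \<theta>) =
      real DIM('a) / 2 * ln (w / v) - std_second_moment TYPE('a) / 2 +
        ((norm (\<theta> - c))\<^sup>2 + v * std_second_moment TYPE('a)) / (2 * w)"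
    unfolding eq using i m P.prob_space assms by simp
qed

lemma kl_loss_eq_integral:
  fixes \<theta> :: "real ^ 'q ^ 'r"
  assumes pos: "\<And>Y. p Y > 0" and v: "vy > 0" and [measurable]: "p \<in> borel_measurable borel"
    and int: "integrable (gauss vy \<theta>) (\<lambda>Y. ln (gdens vy (Y - \<theta>)) - ln (p Y))"
  shows "kl_loss vy \<theta> p = ereal (\<integral> Y. ln (gdens vy (Y - \<theta>)) - ln (p Y) \<partial>gauss vy \<theta>)"
proof -
  have nz: "p Y \<noteq> 0" "gdens vy (Y - \<theta>) \<noteq> 0" for Y
    using pos[of Y] gdens_pos[OF v, of "Y - \<theta>"] by simp_all
  have "kl_loss vy \<theta> p =
    ereal_integral lborel (\<lambda>Y. ereal (gdens vy (Y - \<theta>) * (ln (gdens vy (Y - \<theta>)) - ln (p Y))))"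
    unfolding kl_loss_def normal_mat_density_eq_gdens
    using nz by (simp add: ln_div)
  also have "\<dots> = ereal (\<integral> Y. ln (gdens vy (Y - \<theta>)) - ln (p Y) \<partial>gauss vy \<theta>)"
    using int by (subst ereal_integral_eq_integral) (simp_all add: integrable_gauss_iff integral_gauss)
  finally show ?thesis .
qed

lemma kl_risk_eq_integral:
  fixes \<theta> :: "real ^ 'q ^ 'r"
  assumes "\<And>X. kl_loss vy \<theta> (p X) = ereal (L X)" and "integrable (gauss vx \<theta>) L"
  shows "kl_risk vx vy \<theta> p = ereal (\<integral> X. L X \<partial>gauss vx \<theta>)"
proof -
  have [measurable]: "L \<in> borel_measurable borel"
    using borel_measurable_integrable[OF assms(2)] by (simp add: measurable_cong_sets[OF sets_gauss refl])
  have "kl_risk vx vy \<theta> p = ereal_integral lborel (\<lambda>X. ereal (gdens vx (X - \<theta>) * L X))"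
    unfolding kl_risk_def normal_mat_density_eq_gdens assms(1) by simp
  also have "\<dots> = ereal (\<integral> X. L X \<partial>gauss vx \<theta>)"
    using assms(2) by (subst ereal_integral_eq_integral) (simp_all add: integrable_gauss_iff integral_gauss)
  finally show ?thesis .
qed

text \<open>The constant risk of the predictive density \<open>N(X, (v\<^sub>x + v\<^sub>y) I)\<close> of the uniform prior.\<close>

definition uniform_prior_risk :: "real \<Rightarrow> real \<Rightarrow> nat \<Rightarrow> real" where
  "uniform_prior_risk vx vy d = real d / 2 * ln ((vx + vy) / vy)"

lemma marginal_eq_gauss_avg:
  assumes [measurable]: "prior \<in> borel_measurable borel"
  shows "marginal prior v X = gauss_avg prior v X"
  unfolding marginal_def gauss_avg_def normal_mat_density_eq_gdens
  by (simp add: integral_gauss gdens_minus[of v X])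

text \<open>Completing the square in \<open>\<Theta>\<close> splits off the predictive density of the uniform prior; what
  remains is the average of the prior around the pooled observation
  \<open>(v\<^sub>y X + v\<^sub>x Y) / (v\<^sub>x + v\<^sub>y)\<close>, with the variance of that observation.\<close>

lemma bayes_predictive_eq:
  fixes prior :: "real ^ 'q ^ 'r \<Rightarrow> real"
  assumes "vx > 0" "vy > 0" and [measurable]: "prior \<in> borel_measurable borel"
  shows "bayes_predictive vx vy prior X Y =
    gdens (vx + vy) (X - Y) * gauss_avg prior (vx * vy / (vx + vy))
      ((vy / (vx + vy)) *\<^sub>R X + (vx / (vx + vy)) *\<^sub>R Y) / gauss_avg prior vx X"
proof -
  have w: "(1 / (vx + vy)) *\<^sub>R (vy *\<^sub>R X + vx *\<^sub>R Y) = (vy / (vx + vy)) *\<^sub>R X + (vx / (vx + vy)) *\<^sub>R Y"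
    by (simp add: scaleR_add_right)
  have "gdens vx (X - \<Theta>) * gdens vy (Y - \<Theta>) * prior \<Theta> =
    gdens (vx + vy) (X - Y) * (gdens (vx * vy / (vx + vy)) (\<Theta> - ((vy / (vx + vy)) *\<^sub>R X + (vx / (vx + vy)) *\<^sub>R Y)) * prior \<Theta>)"
    for \<Theta> :: "real ^ 'q ^ 'r"
    unfolding gdens_minus[of vy Y \<Theta>] gdens_mult[OF assms(1,2)] w by simp
  then have "(\<integral> \<Theta>. gdens vx (X - \<Theta>) * gdens vy (Y - \<Theta>) * prior \<Theta> \<partial>lborel) =
    gdens (vx + vy) (X - Y) * gauss_avg prior (vx * vy / (vx + vy)) ((vy / (vx + vy)) *\<^sub>R X + (vx / (vx + vy)) *\<^sub>R Y)"
    unfolding gauss_avg_def integral_gauss[OF assms(3)] by (simp only: integral_mult_right_zero)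
  then show ?thesis
    unfolding bayes_predictive_def normal_mat_density_eq_gdens by (simp add: marginal_eq_gauss_avg)
qed

context
  fixes vx vy :: real and prior :: "real ^ ('q::finite) ^ ('r::finite) \<Rightarrow> real" and f1 f2
  assumes v: "vx > 0" "vy > 0" and prior: "superharmonic_prior prior f1 f2"
begin

interpretation superharmonic_prior prior f1 f2 by (rule prior)

private abbreviation (input) "a \<equiv> vy / (vx + vy)"
private abbreviation (input) "b \<equiv> vx / (vx + vy)"
private abbreviation (input) "vw \<equiv> vx * vy / (vx + vy)"
private abbreviation (input) "p \<equiv> bayes_predictive vx vy prior"

private lemma pos: "vw > 0" "a > 0" "b > 0" "vx + vy > 0"
  using v by auto

private lemma p_eq: "p X Y = gdens (vx + vy) (X - Y) * gauss_avg prior vw (a *\<^sub>R X + b *\<^sub>R Y) / gauss_avg prior vx X"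
  by (rule bayes_predictive_eq[OF v measurable_f])

private lemma p_pos: "p X Y > 0"
  unfolding p_eq by (intro divide_pos_pos mult_pos_pos gdens_pos gauss_avg_pos pos v)

text \<open>Integrating the joint density over \<open>Y\<close> first, by Tonelli, leaves the marginal of \<open>X\<close>.\<close>

lemma predictive_density_bayes: "predictive_density (bayes_predictive vx vy prior)"
  unfolding predictive_density_def
proof (intro conjI allI)
  show "(\<lambda>(X, Y). p X Y) \<in> borel_measurable (lborel \<Otimes>\<^sub>M lborel)"
    unfolding p_eq by measurable
  show "0 \<le> p X Y" for X Y using p_pos less_imp_le by blast
  fix X :: "real ^ 'q ^ 'r"
  let ?m = "gauss_avg prior vx X"
  have m: "?m > 0" by (rule gauss_avg_pos) (rule v)
  have "ennreal (gdens (vx + vy) (X - Y) * gauss_avg prior vw (a *\<^sub>R X + b *\<^sub>R Y)) =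
    (\<integral>\<^sup>+ \<Theta>. ennreal (gdens vx (\<Theta> - X)) * (ennreal (gdens vy (Y - \<Theta>)) * ennreal (prior \<Theta>)) \<partial>lborel)" for Y
  proof -
    have w: "(1 / (vx + vy)) *\<^sub>R (vy *\<^sub>R X + vx *\<^sub>R Y) = a *\<^sub>R X + b *\<^sub>R Y"
      by (simp add: scaleR_add_right)
    have "ennreal (gdens (vx + vy) (X - Y) * gauss_avg prior vw (a *\<^sub>R X + b *\<^sub>R Y)) =
      (\<integral>\<^sup>+ \<Theta>. ennreal (gdens (vx + vy) (X - Y)) * (ennreal (gdens vw (\<Theta> - (a *\<^sub>R X + b *\<^sub>R Y))) * ennreal (prior \<Theta>)) \<partial>lborel)"
      using pos(1) by (simp add: ennreal_mult' ennreal_gauss_avg nn_integral_gauss nn_integral_cmult)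
    also have "\<dots> = (\<integral>\<^sup>+ \<Theta>. ennreal (gdens vx (\<Theta> - X)) * (ennreal (gdens vy (Y - \<Theta>)) * ennreal (prior \<Theta>)) \<partial>lborel)"
    proof (rule nn_integral_cong)
      fix \<Theta> :: "real ^ 'q ^ 'r"
      have "gdens vx (\<Theta> - X) * gdens vy (Y - \<Theta>) = gdens (vx + vy) (X - Y) * gdens vw (\<Theta> - (a *\<^sub>R X + b *\<^sub>R Y))"
        unfolding gdens_minus[of vx \<Theta> X] gdens_minus[of vy Y \<Theta>] gdens_mult[OF v] w ..
      then show "ennreal (gdens (vx + vy) (X - Y)) * (ennreal (gdens vw (\<Theta> - (a *\<^sub>R X + b *\<^sub>R Y))) * ennreal (prior \<Theta>)) =
        ennreal (gdens vx (\<Theta> - X)) * (ennreal (gdens vy (Y - \<Theta>)) * ennreal (prior \<Theta>))"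
        by (simp add: mult.assoc[symmetric] ennreal_mult[symmetric])
    qed
    finally show ?thesis .
  qed
  then have "(\<integral>\<^sup>+ Y. ennreal (gdens (vx + vy) (X - Y) * gauss_avg prior vw (a *\<^sub>R X + b *\<^sub>R Y)) \<partial>lborel) =
    (\<integral>\<^sup>+ Y. \<integral>\<^sup>+ \<Theta>. ennreal (gdens vx (\<Theta> - X)) * (ennreal (gdens vy (Y - \<Theta>)) * ennreal (prior \<Theta>)) \<partial>lborel \<partial>lborel)"
    by simp
  also have "\<dots> = (\<integral>\<^sup>+ \<Theta>. \<integral>\<^sup>+ Y. ennreal (gdens vx (\<Theta> - X)) * (ennreal (gdens vy (Y - \<Theta>)) * ennreal (prior \<Theta>)) \<partial>lborel \<partial>lborel)"
    by (rule lborel_pair.Fubini') measurable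
  also have "\<dots> = ennreal ?m"
    using v by (simp add: nn_integral_cmult nn_integral_multc nn_integral_gdens ennreal_gauss_avg nn_integral_gauss)
  finally have num: "(\<integral>\<^sup>+ Y. ennreal (gdens (vx + vy) (X - Y) * gauss_avg prior vw (a *\<^sub>R X + b *\<^sub>R Y)) \<partial>lborel) = ennreal ?m" .
  have "(\<integral>\<^sup>+ Y. ennreal (p X Y) \<partial>lborel) =
    (\<integral>\<^sup>+ Y. ennreal (gdens (vx + vy) (X - Y) * gauss_avg prior vw (a *\<^sub>R X + b *\<^sub>R Y)) / ennreal ?m \<partial>lborel)"
    unfolding p_eq using m gauss_avg_pos[OF pos(1)] by (simp add: divide_ennreal less_imp_le)
  also have "\<dots> = 1"
    using m by (simp add: nn_integral_divide num)
  finally show "(\<integral>\<^sup>+ Y. ennreal (p X Y) \<partial>lborel) = 1" .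
qed

text \<open>By \<open>bayes_predictive_eq\<close> the logarithm of the predictive density is that of the uniform prior
  plus the difference of two log-marginals. The pooled observation \<open>a X + b Y\<close> has law
  \<open>N(\<theta>, vw I)\<close>, so the expected difference compares the log-marginals at the variances \<open>vw < vx\<close>.\<close>

theorem kl_risk_bayes_le:
  "kl_risk vx vy \<theta> (bayes_predictive vx vy prior) \<le> ereal (uniform_prior_risk vx vy DIM(real ^ 'q ^ 'r))"
proof -
  let ?\<kappa> = "std_second_moment TYPE(real ^ 'q ^ 'r)"
  define F where "F z = ln (gauss_avg prior vw z)" for z
  define G where "G X = (\<integral> Y. F (a *\<^sub>R X + b *\<^sub>R Y) \<partial>gauss vy \<theta>)" for X
  define A where "A X = real DIM(real ^ 'q ^ 'r) / 2 * ln ((vx + vy) / vy) - ?\<kappa> / 2 + ((norm (\<theta> - X))\<^sup>2 + vy * ?\<kappa>) / (2 * (vx + vy))" for X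
  have [measurable]: "F \<in> borel_measurable borel" unfolding F_def by measurable
  have F_int: "integrable (gauss s c) F" if "s > 0" for s c
    unfolding F_def using integrable_ln_gauss_avg[OF that pos(1)] .
  have F_sec: "integrable (gauss vy \<theta>) (\<lambda>Y. F (a *\<^sub>R X + b *\<^sub>R Y))" for X
    using pos v by (subst integral_gauss_affine(2)) (auto intro!: F_int)
  interpret PX: prob_space "gauss vx \<theta>" by (rule prob_space_gauss) (rule v)
  interpret PY: prob_space "gauss vy \<theta>" by (rule prob_space_gauss) (rule v)
  interpret P: pair_prob_space "gauss vx \<theta>" "gauss vy \<theta>" ..
  \<comment> \<open>The weights \<open>a\<close> and \<open>b\<close> are inversely proportional to the variances they belong to.\<close>
  have vw: "a\<^sup>2 * vx + b\<^sup>2 * vy = vw"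
  proof -
    have "a\<^sup>2 * vx + b\<^sup>2 * vy = (vx * vy) * (vx + vy) / (vx + vy)\<^sup>2"
      by (simp add: power_divide power2_eq_square add_divide_distrib algebra_simps)
    then show ?thesis using pos(4) by (simp add: power2_eq_square)
  qed
  have ab: "a *\<^sub>R \<theta> + b *\<^sub>R \<theta> = \<theta>"
    using pos(4) by (simp add: scaleR_add_left[symmetric] add_divide_distrib[symmetric] add.commute)
  have dst: "distr (gauss vx \<theta> \<Otimes>\<^sub>M gauss vy \<theta>) borel (\<lambda>(X, Y). a *\<^sub>R X + b *\<^sub>R Y) = gauss vw \<theta>"
    using distr_gauss_linear_combination[OF v, of a b \<theta> \<theta>] pos v vw ab by simp
  have F_prod: "integrable (gauss vx \<theta> \<Otimes>\<^sub>M gauss vy \<theta>) (\<lambda>(X, Y). F (a *\<^sub>R X + b *\<^sub>R Y))"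
    using F_int[OF pos(1), of \<theta>] unfolding dst[symmetric]
    by (subst (asm) integrable_distr_eq) (auto simp: case_prod_unfold)
  have G_int: "integrable (gauss vx \<theta>) G"
    unfolding G_def using P.integrable_fst'[OF F_prod] by simp
  have G_val: "(\<integral> X. G X \<partial>gauss vx \<theta>) = (\<integral> z. F z \<partial>gauss vw \<theta>)"
    unfolding G_def using P.integral_fst'[OF F_prod] unfolding dst[symmetric]
    by (subst integral_distr) (auto simp: case_prod_unfold)
  have A_int: "integrable (gauss vx \<theta>) A" and A_val: "(\<integral> X. A X \<partial>gauss vx \<theta>) = uniform_prior_risk vx vy DIM(real ^ 'q ^ 'r)"
  proof -
    have i: "integrable (gauss vx \<theta>) (\<lambda>X. (norm (\<theta> - X))\<^sup>2)"
      and m: "(\<integral> X. (norm (\<theta> - X))\<^sup>2 \<partial>gauss vx \<theta>) = vx * ?\<kappa>"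
      using gauss_second_moment[OF v(1), where a = "-1" and b = \<theta> and c = \<theta>] by simp_all
    show "integrable (gauss vx \<theta>) A" unfolding A_def using i by simp
    have "(\<integral> X. A X \<partial>gauss vx \<theta>) =
      real DIM(real ^ 'q ^ 'r) / 2 * ln ((vx + vy) / vy) - ?\<kappa> / 2 + (vx * ?\<kappa> + vy * ?\<kappa>) / (2 * (vx + vy))"
      unfolding A_def using i m PX.prob_space by simp
    also have "(vx * ?\<kappa> + vy * ?\<kappa>) / (2 * (vx + vy)) = ?\<kappa> / 2"
      using pos(4) by (simp add: field_simps)
    finally show "(\<integral> X. A X \<partial>gauss vx \<theta>) = uniform_prior_risk vx vy DIM(real ^ 'q ^ 'r)"
      by (simp add: uniform_prior_risk_def)
  qed
  have ln_p: "ln (gdens vy (Y - \<theta>)) - ln (p X Y) =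
    (ln (gdens vy (Y - \<theta>)) - ln (gdens (vx + vy) (Y - X))) + (ln (gauss_avg prior vx X) - F (a *\<^sub>R X + b *\<^sub>R Y))" for X Y
    unfolding p_eq F_def
    using gdens_pos[OF pos(4), of "X - Y", THEN less_imp_neq, symmetric] gauss_avg_pos[OF pos(1), THEN less_imp_neq, symmetric]
      gauss_avg_pos[OF v(1), THEN less_imp_neq, symmetric]
    by (simp add: ln_div ln_mult gdens_minus[of _ Y X])
  have loss: "kl_loss vy \<theta> (p X) = ereal (A X + (ln (gauss_avg prior vx X) - G X))" for X
  proof -
    have [measurable]: "p X \<in> borel_measurable borel" unfolding p_eq by measurable
    note R = integral_ln_gdens_ratio[OF v(2) pos(4), of \<theta> X]
    have D: "integrable (gauss vy \<theta>) (\<lambda>Y. ln (gauss_avg prior vx X) - F (a *\<^sub>R X + b *\<^sub>R Y))"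
      using F_sec by simp
    have "integrable (gauss vy \<theta>) (\<lambda>Y. ln (gdens vy (Y - \<theta>)) - ln (p X Y))"
      unfolding ln_p by (rule Bochner_Integration.integrable_add[OF R(1) D])
    then have "kl_loss vy \<theta> (p X) = ereal (\<integral> Y. ln (gdens vy (Y - \<theta>)) - ln (p X Y) \<partial>gauss vy \<theta>)"
      by (intro kl_loss_eq_integral p_pos v) auto
    also have "(\<integral> Y. ln (gdens vy (Y - \<theta>)) - ln (p X Y) \<partial>gauss vy \<theta>) = A X + (ln (gauss_avg prior vx X) - G X)"
      unfolding ln_p Bochner_Integration.integral_add[OF R(1) D] R(2)
      using F_sec PY.prob_space by (simp add: A_def G_def)
    finally show ?thesis .
  qed
  have ln_int: "integrable (gauss vx \<theta>) (\<lambda>X. ln (gauss_avg prior vx X))"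
    by (intro integrable_ln_gauss_avg v)
  have "kl_risk vx vy \<theta> p = ereal (\<integral> X. A X + (ln (gauss_avg prior vx X) - G X) \<partial>gauss vx \<theta>)"
    by (rule kl_risk_eq_integral[OF loss]) (use A_int G_int ln_int in auto)
  also have "(\<integral> X. A X + (ln (gauss_avg prior vx X) - G X) \<partial>gauss vx \<theta>) =
    uniform_prior_risk vx vy DIM(real ^ 'q ^ 'r) + ((\<integral> X. ln (gauss_avg prior vx X) \<partial>gauss vx \<theta>) - (\<integral> z. F z \<partial>gauss vw \<theta>))"
    using A_int G_int ln_int by (simp add: A_val G_val)
  also have "\<dots> \<le> uniform_prior_risk vx vy DIM(real ^ 'q ^ 'r)"
  proof -
    have "vw < vx" using v by (simp add: field_simps)
    then show ?thesis
      using expected_ln_gauss_avg_antimono[of "vx - vw" vw \<theta>] pos(1) by (simp add: F_def)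
  qed
  finally show ?thesis by simp
qed

end

section \<open>No predictive density has smaller maximal risk than the uniform prior\<close>

lemma ereal_integral_ge_integral:
  assumes h: "integrable M h" and le: "AE x in M. ereal (h x) \<le> f x"
  shows "ereal (\<integral> x. h x \<partial>M) \<le> ereal_integral M f"
proof -
  have "ereal (\<integral> x. h x \<partial>M) = ereal_integral M (\<lambda>x. ereal (h x))"
    by (rule ereal_integral_eq_integral[OF h, symmetric])
  also have "\<dots> \<le> ereal_integral M f"
    unfolding ereal_integral_def
  proof (intro ereal_minus_mono)
    show "enn2ereal (\<integral>\<^sup>+ x. e2ennreal (ereal (h x)) \<partial>M) \<le> enn2ereal (\<integral>\<^sup>+ x. e2ennreal (f x) \<partial>M)"
      unfolding less_eq_ennreal.rep_eq[symmetric]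
      by (intro nn_integral_mono_AE eventually_mono[OF le] e2ennreal_mono)
    show "enn2ereal (\<integral>\<^sup>+ x. e2ennreal (- f x) \<partial>M) \<le> enn2ereal (\<integral>\<^sup>+ x. e2ennreal (- ereal (h x)) \<partial>M)"
      unfolding less_eq_ennreal.rep_eq[symmetric]
      by (intro nn_integral_mono_AE eventually_mono[OF le] e2ennreal_mono)
        (simp flip: uminus_ereal.simps)
  qed
  finally show ?thesis .
qed

text \<open>Here \<open>f\<close> may be non-measurable, which is why the bounds are integrated separately instead of
  adding \<open>r\<close> to \<open>f\<close>. If \<open>r\<close> has infinite integral, the left-hand side is \<open>-\<infinity>\<close>.\<close>

lemma ereal_integral_ge_diff:
  assumes h: "integrable M h" and r [measurable]: "r \<in> borel_measurable M"
    and le: "\<And>x. ereal (h x) - enn2ereal (r x) \<le> f x"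
  shows "ereal (\<integral> x. h x \<partial>M) - enn2ereal (\<integral>\<^sup>+ x. r x \<partial>M) \<le> ereal_integral M f"
proof (cases "(\<integral>\<^sup>+ x. r x \<partial>M) = \<infinity>")
  case True
  then show ?thesis by simp
next
  case False
  then have fin: "AE x in M. r x \<noteq> \<infinity>" by (intro nn_integral_PInf_AE) auto
  define r' where "r' x = enn2real (r x)" for x
  have rr: "AE x in M. r x = ennreal (r' x)"
    using fin by eventually_elim (simp add: r'_def less_top)
  have [measurable]: "r' \<in> borel_measurable M" unfolding r'_def by measurable
  have nn: "(\<integral>\<^sup>+ x. r x \<partial>M) = (\<integral>\<^sup>+ x. ennreal (r' x) \<partial>M)"
    using rr by (intro nn_integral_cong_AE) auto
  have r'_fin: "(\<integral>\<^sup>+ x. ennreal (r' x) \<partial>M) < \<infinity>"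
    using False nn by (simp add: less_top)
  have int: "integrable M r'"
    by (rule integrableI_nonneg) (use r'_fin in \<open>auto simp: r'_def\<close>)
  have val: "(\<integral>\<^sup>+ x. r x \<partial>M) = ennreal (\<integral> x. r' x \<partial>M)" and ge0: "0 \<le> (\<integral> x. r' x \<partial>M)"
  proof -
    have "0 \<le> r' x" for x by (simp add: r'_def)
    then show "(\<integral>\<^sup>+ x. r x \<partial>M) = ennreal (\<integral> x. r' x \<partial>M)" "0 \<le> (\<integral> x. r' x \<partial>M)"
      unfolding nn using int by (simp_all add: nn_integral_eq_integral)
  qed
  have "ereal (\<integral> x. h x - r' x \<partial>M) \<le> ereal_integral M f"
  proof (rule ereal_integral_ge_integral)
    show "AE x in M. ereal (h x - r' x) \<le> f x"
      using rr
    proof eventually_elim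
      case (elim x)
      have "enn2ereal (r x) = ereal (r' x)" by (subst elim) (simp add: r'_def)
      then show ?case using le[of x] by simp
    qed
  qed (use h int in simp)
  then show ?thesis using val ge0 h int by simp
qed

text \<open>Gibbs' inequality in the pointwise form \<open>ln (q / p) \<ge> 1 - p / q\<close>, with the Gaussian \<open>q\<close> of
  variance \<open>w\<close> and centre \<open>c\<close>. It covers every density \<open>p\<close>, whether or not \<open>ln p\<close> is integrable,
  and its error term \<open>p / q\<close> is nonnegative, so that Tonelli's theorem applies to it later.\<close>

lemma kl_loss_ge:
  fixes \<theta> :: "real ^ 'q ^ 'r"
  assumes v: "vy > 0" and w: "w > 0" and [measurable]: "p \<in> borel_measurable borel" and p0: "\<And>Y. 0 \<le> p Y"
  shows "ereal (real DIM(real ^ 'q ^ 'r) / 2 * ln (w / vy) - std_second_moment TYPE(real ^ 'q ^ 'r) / 2 +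
      ((norm (\<theta> - c))\<^sup>2 + vy * std_second_moment TYPE(real ^ 'q ^ 'r)) / (2 * w) + 1)
    - enn2ereal (\<integral>\<^sup>+ Y. ennreal (gdens vy (Y - \<theta>)) * ennreal (p Y / gdens w (Y - c)) \<partial>lborel)
    \<le> kl_loss vy \<theta> p"
proof -
  interpret P: prob_space "gauss vy \<theta>" by (rule prob_space_gauss) (rule v)
  define h where "h Y = ln (gdens vy (Y - \<theta>)) - ln (gdens w (Y - c)) + 1" for Y
  have [measurable]: "h \<in> borel_measurable borel" unfolding h_def by measurable
  have h_int: "integrable (gauss vy \<theta>) h"
    unfolding h_def using integral_ln_gdens_ratio(1)[OF v w, of \<theta> c] by simp
  have h_val: "(\<integral> Y. h Y \<partial>gauss vy \<theta>) =
    real DIM(real ^ 'q ^ 'r) / 2 * ln (w / vy) - std_second_moment TYPE(real ^ 'q ^ 'r) / 2 +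
      ((norm (\<theta> - c))\<^sup>2 + vy * std_second_moment TYPE(real ^ 'q ^ 'r)) / (2 * w) + 1"
    unfolding h_def using integral_ln_gdens_ratio[OF v w, of \<theta> c] P.prob_space
    by (subst Bochner_Integration.integral_add) auto
  have "ereal (\<integral> Y. gdens vy (Y - \<theta>) * h Y \<partial>lborel) -
     enn2ereal (\<integral>\<^sup>+ Y. ennreal (gdens vy (Y - \<theta>)) * ennreal (p Y / gdens w (Y - c)) \<partial>lborel) \<le> kl_loss vy \<theta> p"
    unfolding kl_loss_def normal_mat_density_eq_gdens
  proof (rule ereal_integral_ge_diff)
    show "integrable lborel (\<lambda>Y. gdens vy (Y - \<theta>) * h Y)"
      using h_int by (simp add: integrable_gauss_iff)
    fix Y
    have g: "gdens vy (Y - \<theta>) > 0" "gdens w (Y - c) > 0" using v w by (auto intro: gdens_pos)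
    show "ereal (gdens vy (Y - \<theta>) * h Y) - enn2ereal (ennreal (gdens vy (Y - \<theta>)) * ennreal (p Y / gdens w (Y - c)))
      \<le> ereal (gdens vy (Y - \<theta>)) * (if p Y = 0 then \<infinity> else ereal (ln (gdens vy (Y - \<theta>) / p Y)))"
    proof (cases "p Y = 0")
      case True
      then show ?thesis using g by simp
    next
      case False
      then have "p Y > 0" using p0[of Y] by simp
      have "ln (p Y / gdens w (Y - c)) \<le> p Y / gdens w (Y - c) - 1"
        using \<open>p Y > 0\<close> g by (intro ln_le_minus_one) simp
      then have "h Y - p Y / gdens w (Y - c) \<le> ln (gdens vy (Y - \<theta>) / p Y)"
        using \<open>p Y > 0\<close> g by (simp add: h_def ln_div)
      then have "gdens vy (Y - \<theta>) * (h Y - p Y / gdens w (Y - c)) \<le> gdens vy (Y - \<theta>) * ln (gdens vy (Y - \<theta>) / p Y)"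
        using g by (intro mult_left_mono) auto
      then show ?thesis
        using False g p0[of Y] by (simp add: ennreal_mult[symmetric] right_diff_distrib)
    qed
  qed measurable
  then show ?thesis using h_val by (simp add: integral_gauss)
qed

text \<open>A bound on the risk at every \<open>\<theta>\<close> bounds its average over the prior \<open>N(0, \<tau> I)\<close>, and the left-hand
  side is the Bayes risk of that prior. Its Bayesian predictive density is
  \<open>N(s X, (s v\<^sub>x + v\<^sub>y) I)\<close>, which is therefore the density \<open>q\<close> put into \<open>kl_loss_ge\<close>. With this choice
  the error terms \<open>p / q\<close> average to \<open>1\<close>, because \<open>p\<close> integrates to \<open>1\<close> in \<open>Y\<close>; they cancel the
  constant \<open>1\<close> of the linearised inequality.\<close>

lemma uniform_prior_risk_approx_le:
  fixes p :: "real ^ 'q ^ 'r \<Rightarrow> real ^ 'q ^ 'r \<Rightarrow> real"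
  assumes v: "vx > 0" "vy > 0" and \<tau>: "\<tau> > 0" and p: "predictive_density p"
    and c: "\<And>\<theta>. kl_risk vx vy \<theta> p \<le> ereal c"
  defines "s \<equiv> \<tau> / (\<tau> + vx)"
  shows "real DIM(real ^ 'q ^ 'r) / 2 * ln ((s * vx + vy) / vy) \<le> c"
proof -
  let ?d = "real DIM(real ^ 'q ^ 'r)" and ?\<kappa> = "std_second_moment TYPE(real ^ 'q ^ 'r)"
  define w where "w = s * vx + vy"
  have s: "0 < s" using v \<tau> by (simp add: s_def add_pos_pos)
  have w: "w > 0" using v s by (simp add: w_def add_pos_pos)
  have [measurable]: "(\<lambda>x. p (fst x) (snd x)) \<in> borel_measurable (borel \<Otimes>\<^sub>M borel)"
    using p unfolding predictive_density_def case_prod_unfold by (simp add: measurable_lborel1 cong: measurable_cong_sets)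
  have pm [measurable (raw)]: "(\<lambda>x. p (f x) (g x)) \<in> borel_measurable M"
    if [measurable]: "f \<in> borel_measurable M" "g \<in> borel_measurable M" for f g M
  proof -
    have "(\<lambda>x. (\<lambda>x. p (fst x) (snd x)) (f x, g x)) \<in> borel_measurable M" by measurable
    then show ?thesis by simp
  qed
  have p0: "0 \<le> p X Y" and p1: "(\<integral>\<^sup>+ Y. ennreal (p X Y) \<partial>lborel) = 1" for X Y
    using p by (auto simp: predictive_density_def)
  define A where "A \<theta> X = ?d / 2 * ln (w / vy) - ?\<kappa> / 2 + ((norm (\<theta> - s *\<^sub>R X))\<^sup>2 + vy * ?\<kappa>) / (2 * w) + 1" for \<theta> X :: "real ^ 'q ^ 'r"
  define B where "B \<theta> = ?d / 2 * ln (w / vy) - ?\<kappa> / 2 + ((norm ((1 - s) *\<^sub>R \<theta>))\<^sup>2 + s\<^sup>2 * vx * ?\<kappa> + vy * ?\<kappa>) / (2 * w) + 1" for \<theta> :: "real ^ 'q ^ 'r"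
  define \<rho> where "\<rho> \<theta> X = (\<integral>\<^sup>+ Y. ennreal (gdens vy (Y - \<theta>)) * ennreal (p X Y / gdens w (Y - s *\<^sub>R X)) \<partial>lborel)" for \<theta> X
  define R where "R \<theta> = (\<integral>\<^sup>+ X. ennreal (gdens vx (X - \<theta>)) * \<rho> \<theta> X \<partial>lborel)" for \<theta> :: "real ^ 'q ^ 'r"
  have loss: "ereal (A \<theta> X) - enn2ereal (\<rho> \<theta> X) \<le> kl_loss vy \<theta> (p X)" for \<theta> X
    unfolding A_def \<rho>_def by (rule kl_loss_ge) (use v w p0 in auto)
  have A: "integrable (gauss vx \<theta>) (A \<theta>)" "(\<integral> X. A \<theta> X \<partial>gauss vx \<theta>) = B \<theta>" for \<theta>
  proof -
    interpret P: prob_space "gauss vx \<theta>" by (rule prob_space_gauss) (rule v)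
    have i: "integrable (gauss vx \<theta>) (\<lambda>X. (norm (\<theta> - s *\<^sub>R X))\<^sup>2)"
      and m: "(\<integral> X. (norm (\<theta> - s *\<^sub>R X))\<^sup>2 \<partial>gauss vx \<theta>) = (norm ((1 - s) *\<^sub>R \<theta>))\<^sup>2 + s\<^sup>2 * vx * ?\<kappa>"
      using gauss_second_moment[OF v(1), where a = "- s" and b = \<theta> and c = \<theta>]
      by (simp_all add: scaleR_diff_left)
    show "integrable (gauss vx \<theta>) (A \<theta>)" unfolding A_def using i by simp
    show "(\<integral> X. A \<theta> X \<partial>gauss vx \<theta>) = B \<theta>"
      unfolding A_def B_def using i m P.prob_space by simp
  qed
  have risk: "ereal (B \<theta>) - enn2ereal (R \<theta>) \<le> kl_risk vx vy \<theta> p" for \<theta>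
  proof -
    have [measurable]: "A \<theta> \<in> borel_measurable borel" unfolding A_def by measurable
    have [measurable]: "\<rho> \<theta> \<in> borel_measurable borel" unfolding \<rho>_def by measurable
    have "ereal (\<integral> X. gdens vx (X - \<theta>) * A \<theta> X \<partial>lborel) - enn2ereal (R \<theta>) \<le> kl_risk vx vy \<theta> p"
      unfolding kl_risk_def normal_mat_density_eq_gdens R_def
    proof (rule ereal_integral_ge_diff)
      show "integrable lborel (\<lambda>X. gdens vx (X - \<theta>) * A \<theta> X)"
        using A(1)[of \<theta>] by (simp add: integrable_gauss_iff)
      fix X
      have g: "gdens vx (X - \<theta>) > 0" using v by (auto intro: gdens_pos)
      show "ereal (gdens vx (X - \<theta>) * A \<theta> X) - enn2ereal (ennreal (gdens vx (X - \<theta>)) * \<rho> \<theta> X)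
        \<le> ereal (gdens vx (X - \<theta>)) * kl_loss vy \<theta> (p X)"
      proof (cases "\<rho> \<theta> X")
        case (real r)
        have "ereal (gdens vx (X - \<theta>)) * ereal (A \<theta> X - r) \<le> ereal (gdens vx (X - \<theta>)) * kl_loss vy \<theta> (p X)"
          using loss[of \<theta> X] real g by (intro ereal_mult_left_mono) auto
        then show ?thesis using real g by (simp add: ennreal_mult[symmetric] right_diff_distrib)
      next
        case top
        then show ?thesis using g by (simp add: ennreal_mult_top)
      qed
    qed measurable
    then show ?thesis using A(2)[of \<theta>] by (simp add: integral_gauss)
  qed
  have BR: "ennreal (B \<theta> - c) \<le> R \<theta>" for \<theta>
  proof (cases "R \<theta>")
    case (real r)
    have "ereal (B \<theta>) - enn2ereal (R \<theta>) \<le> ereal c" using risk c order_trans by blast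
    then show ?thesis using real by (simp add: ennreal_leI)
  qed simp
  have [measurable]: "R \<in> borel_measurable borel" unfolding R_def \<rho>_def by measurable
  \<comment> \<open>The joint law of \<open>(X, Y)\<close> under the prior is the marginal of \<open>X\<close> times \<open>q\<close>.\<close>
  have marg: "(\<integral>\<^sup>+ \<theta>. ennreal (gdens \<tau> \<theta>) * (ennreal (gdens vx (X - \<theta>)) * ennreal (gdens vy (Y - \<theta>))) \<partial>lborel)
    = ennreal (gdens (vx + \<tau>) X) * ennreal (gdens w (Y - s *\<^sub>R X))" for X Y :: "real ^ 'q ^ 'r"
  proof -
    have e1: "vx * \<tau> / (vx + \<tau>) = s * vx" by (simp add: s_def add.commute mult.commute)
    have e2: "(1 / (vx + \<tau>)) *\<^sub>R (\<tau> *\<^sub>R X + vx *\<^sub>R 0) = s *\<^sub>R X" by (simp add: s_def add.commute)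
    have "gdens \<tau> \<theta> * gdens vx (X - \<theta>) = gdens (vx + \<tau>) X * gdens (s * vx) (\<theta> - s *\<^sub>R X)" for \<theta>
      using gdens_mult[OF v(1) \<tau>, of X \<theta> 0] unfolding e1 e2 by (simp add: mult.commute)
    then have "ennreal (gdens \<tau> \<theta>) * (ennreal (gdens vx (X - \<theta>)) * ennreal (gdens vy (Y - \<theta>))) =
      ennreal (gdens (vx + \<tau>) X) * (ennreal (gdens vy (Y - \<theta>)) * ennreal (gdens (s * vx) (\<theta> - s *\<^sub>R X)))" for \<theta>
      by (simp add: ennreal_mult[symmetric] mult.assoc[symmetric])
    then show ?thesis
      using nn_integral_gdens_convolution[OF v(2), of "s * vx" Y "s *\<^sub>R X"] s v
      by (simp add: nn_integral_cmult w_def add.commute)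
  qed
  have total: "(\<integral>\<^sup>+ \<theta>. R \<theta> \<partial>gauss \<tau> 0) = 1"
  proof -
    define W where "W \<theta> X Y = ennreal (gdens \<tau> \<theta>) * (ennreal (gdens vx (X - \<theta>)) *
        (ennreal (gdens vy (Y - \<theta>)) * ennreal (p X Y / gdens w (Y - s *\<^sub>R X))))" for \<theta> X Y
    have "(\<integral>\<^sup>+ \<theta>. R \<theta> \<partial>gauss \<tau> 0) = (\<integral>\<^sup>+ \<theta>. \<integral>\<^sup>+ X. \<integral>\<^sup>+ Y. W \<theta> X Y \<partial>lborel \<partial>lborel \<partial>lborel)"
      by (simp add: nn_integral_gauss R_def \<rho>_def W_def nn_integral_cmult)
    also have "\<dots> = (\<integral>\<^sup>+ X. \<integral>\<^sup>+ \<theta>. \<integral>\<^sup>+ Y. W \<theta> X Y \<partial>lborel \<partial>lborel \<partial>lborel)"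
      unfolding W_def by (rule lborel_pair.Fubini') measurable
    also have "\<dots> = (\<integral>\<^sup>+ X. \<integral>\<^sup>+ Y. \<integral>\<^sup>+ \<theta>. W \<theta> X Y \<partial>lborel \<partial>lborel \<partial>lborel)"
      unfolding W_def by (intro nn_integral_cong lborel_pair.Fubini') measurable
    also have "\<dots> = (\<integral>\<^sup>+ X. \<integral>\<^sup>+ Y. ennreal (gdens (vx + \<tau>) X) * ennreal (p X Y) \<partial>lborel \<partial>lborel)"
    proof (intro nn_integral_cong)
      fix X Y :: "real ^ 'q ^ 'r"
      have g: "gdens w (Y - s *\<^sub>R X) > 0" using w by (rule gdens_pos)
      have "(\<integral>\<^sup>+ \<theta>. W \<theta> X Y \<partial>lborel) = (\<integral>\<^sup>+ \<theta>. (ennreal (gdens \<tau> \<theta>) * (ennreal (gdens vx (X - \<theta>)) *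
        ennreal (gdens vy (Y - \<theta>)))) * ennreal (p X Y / gdens w (Y - s *\<^sub>R X)) \<partial>lborel)"
        by (simp add: W_def mult.assoc)
      also have "\<dots> = ennreal (gdens (vx + \<tau>) X) * ennreal (gdens w (Y - s *\<^sub>R X)) * ennreal (p X Y / gdens w (Y - s *\<^sub>R X))"
        by (subst nn_integral_multc) (auto simp: marg)
      also have "\<dots> = ennreal (gdens (vx + \<tau>) X) * ennreal (p X Y)"
        using g p0[of X Y] by (simp add: ennreal_mult[symmetric] mult.assoc)
      finally show "(\<integral>\<^sup>+ \<theta>. W \<theta> X Y \<partial>lborel) = \<dots>" .
    qed
    also have "\<dots> = 1"
      using v \<tau> nn_integral_gdens_0[of "vx + \<tau>", where 'a = "real ^ 'q ^ 'r"]
      by (simp add: nn_integral_cmult p1)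
    finally show ?thesis .
  qed
  interpret P: prob_space "gauss \<tau> (0::real ^ 'q ^ 'r)" by (rule prob_space_gauss) (rule \<tau>)
  have iB: "integrable (gauss \<tau> (0::real ^ 'q ^ 'r)) (\<lambda>\<theta>. (norm ((1 - s) *\<^sub>R \<theta>))\<^sup>2)"
    and mB: "(\<integral> \<theta>. (norm ((1 - s) *\<^sub>R \<theta>))\<^sup>2 \<partial>gauss \<tau> (0::real ^ 'q ^ 'r)) = (1 - s)\<^sup>2 * \<tau> * ?\<kappa>"
    using gauss_second_moment[OF \<tau>, where a = "1 - s" and b = 0 and c = "0::real ^ 'q ^ 'r"] by simp_all
  have B_int: "integrable (gauss \<tau> 0) B" unfolding B_def using iB by simp
  \<comment> \<open>The expected squared distance from \<open>\<theta>\<close> to the posterior mean \<open>s X\<close>, per coordinate, is the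
    posterior variance \<open>s v\<^sub>x\<close>.\<close>
  have key: "(1 - s)\<^sup>2 * \<tau> + s\<^sup>2 * vx = s * vx"
  proof -
    have "\<tau> + vx \<noteq> 0" using v \<tau> by simp
    then have s1: "1 - s = vx / (\<tau> + vx)" by (simp add: s_def field_simps)
    have "(1 - s)\<^sup>2 * \<tau> + s\<^sup>2 * vx = (\<tau> * vx) * (\<tau> + vx) / (\<tau> + vx)\<^sup>2"
      unfolding s1 unfolding s_def by (simp add: power_divide power2_eq_square add_divide_distrib algebra_simps)
    then show ?thesis using \<open>\<tau> + vx \<noteq> 0\<close> by (simp add: s_def power2_eq_square)
  qed
  have "(\<integral> \<theta>. B \<theta> \<partial>gauss \<tau> 0) = ?d / 2 * ln (w / vy) - ?\<kappa> / 2 + (((1 - s)\<^sup>2 * \<tau> + s\<^sup>2 * vx + vy) * ?\<kappa>) / (2 * w) + 1"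
    unfolding B_def using iB mB P.prob_space by (simp add: algebra_simps)
  also have "\<dots> = ?d / 2 * ln (w / vy) + 1"
    unfolding key w_def[symmetric] using w by simp
  finally have B_val: "(\<integral> \<theta>. B \<theta> - c \<partial>gauss \<tau> 0) = ?d / 2 * ln (w / vy) + 1 - c"
    using B_int P.prob_space by simp
  have "(\<integral> \<theta>. B \<theta> - c \<partial>gauss \<tau> 0) \<le> 1"
  proof -
    have "ennreal (\<integral> \<theta>. B \<theta> - c \<partial>gauss \<tau> 0) \<le> ennreal (\<integral> \<theta>. max 0 (B \<theta> - c) \<partial>gauss \<tau> 0)"
      using B_int by (intro ennreal_leI integral_mono) auto
    also have "\<dots> = (\<integral>\<^sup>+ \<theta>. ennreal (max 0 (B \<theta> - c)) \<partial>gauss \<tau> 0)"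
      using B_int by (intro nn_integral_eq_integral[symmetric]) auto
    also have "\<dots> = (\<integral>\<^sup>+ \<theta>. ennreal (B \<theta> - c) \<partial>gauss \<tau> 0)"
      by (intro nn_integral_cong) (simp add: max_def ennreal_neg)
    also have "\<dots> \<le> (\<integral>\<^sup>+ \<theta>. R \<theta> \<partial>gauss \<tau> 0)" by (intro nn_integral_mono BR)
    finally show ?thesis unfolding total by (simp add: ennreal_le_1)
  qed
  then show ?thesis unfolding B_val by (simp add: w_def)
qed

text \<open>The Bayes risks of the priors \<open>N(0, \<tau> I)\<close> tend to the risk of the uniform prior.\<close>

theorem uniform_prior_risk_le_max_risk:
  fixes p :: "real ^ 'q ^ 'r \<Rightarrow> real ^ 'q ^ 'r \<Rightarrow> real"
  assumes v: "vx > 0" "vy > 0" and p: "predictive_density p"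
  shows "ereal (uniform_prior_risk vx vy DIM(real ^ 'q ^ 'r)) \<le> (SUP \<theta>. kl_risk vx vy \<theta> p)"
proof (rule ereal_le_real)
  fix c assume "(SUP \<theta>. kl_risk vx vy \<theta> p) \<le> ereal c"
  then have c: "kl_risk vx vy \<theta> p \<le> ereal c" for \<theta> by (simp add: SUP_le_iff)
  have "((\<lambda>\<tau>. real DIM(real ^ 'q ^ 'r) / 2 * ln ((\<tau> / (\<tau> + vx) * vx + vy) / vy)) \<longlongrightarrow>
    real DIM(real ^ 'q ^ 'r) / 2 * ln ((1 * vx + vy) / vy)) at_top"
  proof (intro tendsto_intros)
    have "((\<lambda>\<tau>. 1 - vx / (\<tau> + vx)) \<longlongrightarrow> 1 - 0) at_top"
      by (intro tendsto_intros real_tendsto_divide_at_top[OF tendsto_const]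
          filterlim_tendsto_add_at_top[OF tendsto_const filterlim_ident, THEN filterlim_cong[OF refl refl, THEN iffD1, rotated]])
        (auto simp: add.commute)
    moreover have "eventually (\<lambda>\<tau>. 1 - vx / (\<tau> + vx) = \<tau> / (\<tau> + vx)) at_top"
      using eventually_gt_at_top[of 0] by eventually_elim (use v in \<open>simp add: field_simps\<close>)
    ultimately show "((\<lambda>\<tau>. \<tau> / (\<tau> + vx)) \<longlongrightarrow> 1) at_top"
      by (simp add: tendsto_cong)
  qed (use v in auto)
  moreover have "eventually (\<lambda>\<tau>. real DIM(real ^ 'q ^ 'r) / 2 * ln ((\<tau> / (\<tau> + vx) * vx + vy) / vy) \<le> c) at_top"
    using eventually_gt_at_top[of 0] by eventually_elim (rule uniform_prior_risk_approx_le[OF v _ p c])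
  ultimately have "real DIM(real ^ 'q ^ 'r) / 2 * ln ((1 * vx + vy) / vy) \<le> c"
    by (intro tendsto_upperbound) auto
  then show "ereal (uniform_prior_risk vx vy DIM(real ^ 'q ^ 'r)) \<le> ereal c"
    by (simp add: uniform_prior_risk_def)
qed

section \<open>Symmetric second differences\<close>

text \<open>Along the segment from \<open>x\<close> to \<open>x + v\<close>, the derivative of the remainder is controlled by the
  differentiability of \<open>F'\<close> at the single point \<open>x\<close>. All derivatives are taken within the convex
  set \<open>S\<close>, so \<open>x\<close> may be a boundary point, as eigenvalue vectors of singular matrices are.\<close>

lemma second_order_taylor:
  fixes F :: "'a::real_normed_vector \<Rightarrow> real" and F' :: "'a \<Rightarrow> 'a \<Rightarrow>\<^sub>L real"
  assumes S: "convex S" "x \<in> S"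
    and F: "\<And>y. y \<in> S \<Longrightarrow> (F has_derivative blinfun_apply (F' y)) (at y within S)"
    and F': "(F' has_derivative F'') (at x within S)" and "e > 0"
  obtains d where "d > 0" "\<And>v. x + v \<in> S \<Longrightarrow> norm v < d \<Longrightarrow>
    \<bar>F (x + v) - F x - F' x v - F'' v v / 2\<bar> \<le> e * (norm v)\<^sup>2"
proof -
  have lin: "linear F''" using F' by (simp add: has_derivative_def bounded_linear.linear)
  obtain d where "d > 0" and d: "\<And>y. y \<in> S \<Longrightarrow> norm (y - x) < d \<Longrightarrow>
      norm (F' y - F' x - F'' (y - x)) \<le> e * norm (y - x)"
    using F' \<open>e > 0\<close> unfolding has_derivative_within_alt by blast
  have "\<bar>F (x + v) - F x - F' x v - F'' v v / 2\<bar> \<le> e * (norm v)\<^sup>2"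
    if v: "x + v \<in> S" "norm v < d" for v
  proof -
    have seg: "x + s *\<^sub>R v \<in> S" if "s \<in> {0..1}" for s
    proof -
      have "(1 - s) *\<^sub>R x + s *\<^sub>R (x + v) \<in> S"
        using S v that by (intro convexD) auto
      then show ?thesis by (simp add: algebra_simps)
    qed
    define \<phi> where "\<phi> s = F (x + s *\<^sub>R v) - s * F' x v - s\<^sup>2 / 2 * F'' v v" for s
    have der: "(\<phi> has_real_derivative F' (x + s *\<^sub>R v) v - F' x v - s * F'' v v) (at s within {0..1})"
      if s: "s \<in> {0..1}" for s
    proof -
      have "((\<lambda>s. F (x + s *\<^sub>R v)) has_derivative (\<lambda>y. F' (x + s *\<^sub>R v) (y *\<^sub>R v))) (at s within {0..1})"
      proof (rule has_derivative_in_compose2[OF F _ s])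
        show "((\<lambda>s. x + s *\<^sub>R v) has_derivative (\<lambda>y. y *\<^sub>R v)) (at s within {0..1})"
          by (auto intro!: derivative_eq_intros)
      qed (use seg in auto)
      then have "((\<lambda>s. F (x + s *\<^sub>R v)) has_real_derivative F' (x + s *\<^sub>R v) v) (at s within {0..1})"
        by (simp add: has_field_derivative_def blinfun.scaleR_right mult_commute_abs)
      then show ?thesis
        unfolding \<phi>_def by (auto intro!: derivative_eq_intros)
    qed
    have "norm (\<phi> 1 - \<phi> 0) \<le> e * norm v * norm v * norm (1 - 0 :: real)"
    proof (rule field_differentiable_bound[of "{0..1}", OF _ der])
      fix s :: real assume s: "s \<in> {0..1}"
      have "norm (s *\<^sub>R v) \<le> norm v" using s by (simp add: mult_left_le_one_le)
      then have "norm (F' (x + s *\<^sub>R v) - F' x - F'' (s *\<^sub>R v)) \<le> e * norm (s *\<^sub>R v)"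
        using d[OF seg[OF s]] v by simp
      also have "\<dots> \<le> e * norm v"
        using \<open>norm (s *\<^sub>R v) \<le> norm v\<close> \<open>e > 0\<close> by (intro mult_left_mono) auto
      finally have b: "norm (F' (x + s *\<^sub>R v) - F' x - F'' (s *\<^sub>R v)) \<le> e * norm v" .
      have "F' (x + s *\<^sub>R v) v - F' x v - s * F'' v v = (F' (x + s *\<^sub>R v) - F' x - F'' (s *\<^sub>R v)) v"
        by (simp add: blinfun.diff_left linear_cmul[OF lin] blinfun.scaleR_left)
      also have "norm \<dots> \<le> norm (F' (x + s *\<^sub>R v) - F' x - F'' (s *\<^sub>R v)) * norm v"
        by (rule norm_blinfun)
      also have "\<dots> \<le> e * norm v * norm v" using b by (rule mult_right_mono) simp
      finally show "norm (F' (x + s *\<^sub>R v) v - F' x v - s * F'' v v) \<le> e * norm v * norm v" .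
    qed auto
    moreover have "\<phi> 1 - \<phi> 0 = F (x + v) - F x - F' x v - F'' v v / 2"
      by (simp add: \<phi>_def)
    ultimately show ?thesis by (simp add: power2_eq_square mult.assoc)
  qed
  then show ?thesis using \<open>d > 0\<close> that by blast
qed

lemma filterlim_uminus_at_0: "filterlim (\<lambda>t::real. - t) (at 0) (at 0)"
  using filtermap_at_minus[of "0::real"] by (simp add: filterlim_def)

text \<open>In the symmetrised difference the first-order terms \<open>\<kappa> t\<close> of the curve cancel inside \<open>F' x\<close>,
  while they contribute to the quadratic term. The form of the hypotheses suits eigenvalue curves,
  which have no better regularity than this at multiple eigenvalues.\<close>

lemma symmetric_second_difference:
  fixes F :: "'a::real_normed_vector \<Rightarrow> real" and F' :: "'a \<Rightarrow> 'a \<Rightarrow>\<^sub>L real"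
  assumes S: "convex S" "x \<in> S"
    and F: "\<And>y. y \<in> S \<Longrightarrow> (F has_derivative blinfun_apply (F' y)) (at y within S)"
    and F': "(F' has_derivative F'') (at x within S)"
    and c: "\<forall>\<^sub>F t in at 0. c t \<in> S"
    and \<kappa>: "((\<lambda>t::real. (1 / t) *\<^sub>R (c t - x)) \<longlongrightarrow> \<kappa>) (at 0)"
    and \<nu>: "((\<lambda>t. (1 / t\<^sup>2) *\<^sub>R (c t + c (- t) - 2 *\<^sub>R x)) \<longlongrightarrow> \<nu>) (at 0)"
  shows "((\<lambda>t. (F (c t) + F (c (- t)) - 2 * F x) / t\<^sup>2) \<longlongrightarrow> F' x \<nu> + F'' \<kappa> \<kappa>) (at 0)"
proof -
  have lin: "bounded_linear F''" using F' by (simp add: has_derivative_def)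
  define \<delta> where "\<delta> t = c t - x" for t
  define r where "r v = F (x + v) - F x - F' x v - F'' v v / 2" for v
  have \<delta>0: "(\<delta> \<longlongrightarrow> 0) (at 0)"
  proof -
    have "((\<lambda>t. t *\<^sub>R ((1 / t) *\<^sub>R \<delta> t)) \<longlongrightarrow> 0 *\<^sub>R \<kappa>) (at 0)"
      using \<kappa> unfolding \<delta>_def by (intro tendsto_intros)
    then have "((\<lambda>t. t *\<^sub>R ((1 / t) *\<^sub>R \<delta> t)) \<longlongrightarrow> 0) (at 0)" by simp
    then show ?thesis
      by (rule Lim_transform_eventually) (simp add: eventually_at_filter)
  qed
  have r0: "((\<lambda>t. r (\<delta> t) / t\<^sup>2) \<longlongrightarrow> 0) (at 0)"
  proof (rule tendstoI)
    fix e :: real assume "e > 0"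
    define K where "K = (norm \<kappa> + 1)\<^sup>2"
    have "K > 0" unfolding K_def by (intro zero_less_power add_nonneg_pos) auto
    obtain d where "d > 0" and d: "\<And>v. x + v \<in> S \<Longrightarrow> norm v < d \<Longrightarrow>
        \<bar>F (x + v) - F x - F' x v - F'' v v / 2\<bar> \<le> e / (2 * K) * (norm v)\<^sup>2"
      using second_order_taylor[OF S F F', of "e / (2 * K)"] \<open>e > 0\<close> \<open>K > 0\<close> by auto
    have "\<forall>\<^sub>F t in at 0. norm ((1 / t) *\<^sub>R \<delta> t) < norm \<kappa> + 1"
      using tendsto_norm[OF \<kappa>] unfolding \<delta>_def by (rule order_tendstoD) simp
    moreover have "\<forall>\<^sub>F t in at 0. norm (\<delta> t) < d"
      using tendsto_norm[OF \<delta>0] \<open>d > 0\<close> by (auto dest: order_tendstoD)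
    moreover have "\<forall>\<^sub>F t in at (0::real). t \<noteq> 0" by (simp add: eventually_at_filter)
    ultimately show "\<forall>\<^sub>F t in at 0. dist (r (\<delta> t) / t\<^sup>2) 0 < e"
      using c
    proof eventually_elim
      case (elim t)
      have "(norm ((1 / t) *\<^sub>R \<delta> t))\<^sup>2 \<le> K"
        unfolding K_def using elim by (intro power_mono) auto
      then have nd: "(norm (\<delta> t))\<^sup>2 / t\<^sup>2 \<le> K"
        by (simp add: power_divide)
      have "\<bar>r (\<delta> t)\<bar> \<le> e / (2 * K) * (norm (\<delta> t))\<^sup>2"
        using elim d[of "\<delta> t"] by (simp add: r_def \<delta>_def)
      then have "\<bar>r (\<delta> t)\<bar> / t\<^sup>2 \<le> e / (2 * K) * (norm (\<delta> t))\<^sup>2 / t\<^sup>2"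
        by (rule divide_right_mono) simp
      also have "\<dots> = e / (2 * K) * ((norm (\<delta> t))\<^sup>2 / t\<^sup>2)" by simp
      also have "\<dots> \<le> e / (2 * K) * K"
        using nd \<open>e > 0\<close> \<open>K > 0\<close> by (intro mult_left_mono) auto
      also have "\<dots> < e" using \<open>e > 0\<close> \<open>K > 0\<close> by simp
      finally show ?case by simp
    qed
  qed
  have q: "((\<lambda>t. F'' ((1 / t) *\<^sub>R \<delta> t) ((1 / t) *\<^sub>R \<delta> t)) \<longlongrightarrow> F'' \<kappa> \<kappa>) (at 0)"
    using \<kappa> unfolding \<delta>_def by (intro tendsto_intros bounded_linear.tendsto[OF lin])
  have mirror: "((\<lambda>t. G (- t)) \<longlongrightarrow> L) (at 0)" if "(G \<longlongrightarrow> L) (at 0)" for G :: "real \<Rightarrow> real" and L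
    using filterlim_compose[OF that filterlim_uminus_at_0] .
  have "((\<lambda>t. F' x ((1 / t\<^sup>2) *\<^sub>R (c t + c (- t) - 2 *\<^sub>R x))
      + (F'' ((1 / t) *\<^sub>R \<delta> t) ((1 / t) *\<^sub>R \<delta> t) / 2 + F'' ((1 / - t) *\<^sub>R \<delta> (- t)) ((1 / - t) *\<^sub>R \<delta> (- t)) / 2)
      + (r (\<delta> t) / t\<^sup>2 + r (\<delta> (- t)) / (- t)\<^sup>2)) \<longlongrightarrow>
      F' x \<nu> + (F'' \<kappa> \<kappa> / 2 + F'' \<kappa> \<kappa> / 2) + (0 + 0)) (at 0)"
    by (intro tendsto_add tendsto_divide tendsto_const q r0 mirror[OF q] mirror[OF r0]
        bounded_linear.tendsto[OF blinfun.bounded_linear_right \<nu>]) auto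
  also have "F' x \<nu> + (F'' \<kappa> \<kappa> / 2 + F'' \<kappa> \<kappa> / 2) + (0 + 0) = F' x \<nu> + F'' \<kappa> \<kappa>" by simp
  finally show ?thesis
  proof (rule Lim_transform_eventually)
    have "\<forall>\<^sub>F t in at (0::real). t \<noteq> 0" by (simp add: eventually_at_filter)
    then show "\<forall>\<^sub>F t in at 0. F' x ((1 / t\<^sup>2) *\<^sub>R (c t + c (- t) - 2 *\<^sub>R x))
      + (F'' ((1 / t) *\<^sub>R \<delta> t) ((1 / t) *\<^sub>R \<delta> t) / 2 + F'' ((1 / - t) *\<^sub>R \<delta> (- t)) ((1 / - t) *\<^sub>R \<delta> (- t)) / 2)
      + (r (\<delta> t) / t\<^sup>2 + r (\<delta> (- t)) / (- t)\<^sup>2) = (F (c t) + F (c (- t)) - 2 * F x) / t\<^sup>2"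
    proof eventually_elim
      case (elim t)
      have s: "c t + c (- t) - 2 *\<^sub>R x = \<delta> t + \<delta> (- t)" by (simp add: \<delta>_def scaleR_2)
      have quad: "F'' (a *\<^sub>R v) (a *\<^sub>R v) = a\<^sup>2 * F'' v v" for a v
        by (simp add: linear_cmul[OF bounded_linear.linear[OF lin]] blinfun.scaleR_left blinfun.scaleR_right power2_eq_square)
      have rr: "F (c t) = F x + F' x (\<delta> t) + F'' (\<delta> t) (\<delta> t) / 2 + r (\<delta> t)" for t
        by (simp add: r_def \<delta>_def)
      show ?case
        unfolding s quad unfolding rr blinfun.scaleR_right blinfun.add_right using elim
        by (simp add: power_divide add_divide_distrib diff_divide_distrib)
    qed
  qed
qed

lemma second_difference_line:
  fixes F :: "'a::real_normed_vector \<Rightarrow> real" and F' :: "'a \<Rightarrow> 'a \<Rightarrow>\<^sub>L real"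
  assumes F: "\<And>y. (F has_derivative blinfun_apply (F' y)) (at y)"
    and F': "(F' has_derivative F'') (at x)"
  shows "((\<lambda>t. (F (x + t *\<^sub>R b) + F (x + (- t) *\<^sub>R b) - 2 * F x) / t\<^sup>2) \<longlongrightarrow> F'' b b) (at 0)"
proof -
  have "((\<lambda>t. (F (x + t *\<^sub>R b) + F (x + (- t) *\<^sub>R b) - 2 * F x) / t\<^sup>2) \<longlongrightarrow> F' x 0 + F'' b b) (at 0)"
  proof (rule symmetric_second_difference[where S = UNIV])
    show "((\<lambda>t. (1 / t) *\<^sub>R (x + t *\<^sub>R b - x)) \<longlongrightarrow> b) (at 0)"
      by (rule Lim_transform_eventually[OF tendsto_const]) (auto simp: eventually_at_filter)
  qed (use F F' in \<open>auto simp: scaleR_2\<close>)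
  then show ?thesis by (simp add: blinfun.zero_right)
qed

section \<open>Orthonormal bases and the singular value decomposition\<close>

text \<open>A Parseval frame. This is the property of an orthonormal basis that the computation of traces
  uses, and it passes from bases of two spaces to the family of their outer products.\<close>

definition parseval_family :: "'i set \<Rightarrow> ('i \<Rightarrow> 'a::euclidean_space) \<Rightarrow> bool" where
  "parseval_family I u \<longleftrightarrow> finite I \<and> (\<forall>x. (\<Sum>i\<in>I. (x \<bullet> u i) *\<^sub>R u i) = x)"

lemma bilinear_blinfun_apply:
  assumes "linear f"
  shows "bilinear (\<lambda>x y. blinfun_apply (f x) y)"
  unfolding bilinear_def
  by (auto intro!: linearI simp: linear_add[OF assms] linear_cmul[OF assms]
      blinfun.add_left blinfun.scaleR_left blinfun.add_right blinfun.scaleR_right)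

lemma trace_bilinear_parseval:
  fixes u :: "'i \<Rightarrow> 'a::euclidean_space"
  assumes u: "parseval_family I u" and B: "bilinear B"
  shows "(\<Sum>i\<in>I. B (u i) (u i)) = (\<Sum>b\<in>Basis. B b b :: real)"
proof -
  have l: "linear (\<lambda>x. B x y)" and r: "linear (B x)" for x y
    using B by (auto simp: bilinear_def)
  have exp: "B x x = (\<Sum>b\<in>Basis. \<Sum>b'\<in>Basis. (x \<bullet> b) * (x \<bullet> b') * B b b')" for x
  proof -
    have e1: "B x y = (\<Sum>b\<in>Basis. (x \<bullet> b) * B b y)" for y
      using arg_cong[OF euclidean_representation[of x], of "\<lambda>x. B x y"]
      by (simp only: linear_sum[OF l] linear_cmul[OF l] real_scaleR_def)
    have e2: "B b x = (\<Sum>b'\<in>Basis. (x \<bullet> b') * B b b')" for b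
      using arg_cong[OF euclidean_representation[of x], of "B b"]
      by (simp only: linear_sum[OF r] linear_cmul[OF r] real_scaleR_def)
    show ?thesis unfolding e1[of x] unfolding e2 sum_distrib_left mult.assoc ..
  qed
  have pars: "(\<Sum>i\<in>I. (x \<bullet> u i) * (y \<bullet> u i)) = x \<bullet> y" for x y
  proof -
    have "(\<Sum>i\<in>I. (x \<bullet> u i) *\<^sub>R u i) \<bullet> y = x \<bullet> y"
      using u by (simp add: parseval_family_def)
    then show ?thesis by (simp add: inner_sum_left inner_commute[of y])
  qed
  have "(\<Sum>i\<in>I. B (u i) (u i)) = (\<Sum>i\<in>I. \<Sum>b\<in>Basis. \<Sum>b'\<in>Basis. (b \<bullet> u i) * (b' \<bullet> u i) * B b b')"
    by (intro sum.cong refl) (simp only: exp inner_commute)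
  also have "\<dots> = (\<Sum>b\<in>Basis. \<Sum>b'\<in>Basis. \<Sum>i\<in>I. (b \<bullet> u i) * (b' \<bullet> u i) * B b b')"
    by (subst sum.swap, intro sum.cong refl, subst sum.swap, rule refl)
  also have "\<dots> = (\<Sum>b\<in>Basis. \<Sum>b'\<in>Basis. (b \<bullet> b') * B b b')"
    by (simp add: sum_distrib_right[symmetric] pars)
  also have "\<dots> = (\<Sum>b\<in>Basis. B b b)"
    by (intro sum.cong refl) (simp add: inner_Basis if_distrib[of "\<lambda>x. x * _"] sum.delta cong: if_cong)
  finally show ?thesis .
qed

definition outer :: "real ^ 'r \<Rightarrow> real ^ 'q \<Rightarrow> real ^ 'q ^ 'r" where
  "outer a c = (\<chi> i. a $ i *\<^sub>R c)"

lemma outer_mult_vec: "outer a c *v x = (c \<bullet> x) *\<^sub>R a"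
  by (simp add: outer_def matrix_vector_mult_def vec_eq_iff inner_vec_def sum_distrib_left sum_distrib_right mult_ac)

lemma inner_outer: "A \<bullet> outer a c = a \<bullet> (A *v c)"
  by (simp add: outer_def inner_vec_def matrix_vector_mult_def sum_distrib_left mult_ac)

lemma parseval_family_outer:
  fixes u :: "'i \<Rightarrow> real ^ 'r" and w :: "'j \<Rightarrow> real ^ 'q"
  assumes u: "parseval_family I u" and w: "parseval_family J w"
  shows "parseval_family (I \<times> J) (\<lambda>(i, j). outer (u i) (w j))"
proof -
  have "(\<Sum>(i, j)\<in>I \<times> J. (A \<bullet> outer (u i) (w j)) *\<^sub>R outer (u i) (w j)) = A" for A
  proof -
    have row: "(\<Sum>i\<in>I. (A \<bullet> outer (u i) (w j)) *\<^sub>R outer (u i) (w j)) = outer (A *v w j) (w j)" for j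
    proof -
      have "(\<Sum>i\<in>I. (A \<bullet> outer (u i) (w j)) *\<^sub>R outer (u i) (w j)) =
        outer (\<Sum>i\<in>I. ((A *v w j) \<bullet> u i) *\<^sub>R u i) (w j)"
        unfolding inner_outer
        by (simp add: outer_def vec_eq_iff sum_distrib_right inner_commute mult.assoc)
      then show ?thesis using u by (simp add: parseval_family_def)
    qed
    have "(\<Sum>j\<in>J. outer (A *v w j) (w j)) $ k = (\<Sum>j\<in>J. (A $ k \<bullet> w j) *\<^sub>R w j)" for k
      by (simp add: outer_def matrix_vector_mul_component sum_component[symmetric])
    then have "(\<Sum>j\<in>J. outer (A *v w j) (w j)) = A"
      using w by (simp add: parseval_family_def vec_eq_iff)
    then show ?thesis
      by (simp add: sum.cartesian_product[symmetric] sum.swap[of _ J I] row)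
  qed
  then show ?thesis using u w by (simp add: parseval_family_def case_prod_unfold)
qed

definition orthonormal :: "('i \<Rightarrow> 'a::real_inner) \<Rightarrow> bool" where
  "orthonormal u \<longleftrightarrow> (\<forall>i j. u i \<bullet> u j = (if i = j then 1 else 0))"

lemma orthonormal_inner: "orthonormal u \<Longrightarrow> u i \<bullet> u j = (if i = j then 1 else 0)"
  by (simp add: orthonormal_def)

lemma orthonormal_set_basis:
  fixes C :: "'a::euclidean_space set"
  assumes "pairwise orthogonal C" "\<And>c. c \<in> C \<Longrightarrow> norm c = 1" "span C = UNIV"
  shows "finite C" "card C = DIM('a)" "parseval_family C (\<lambda>c. c)"
proof -
  have "0 \<notin> C" using assms(2) by force
  then have ind: "independent C" using assms(1) by (rule pairwise_orthogonal_independent[rotated])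
  then show fin: "finite C" by (rule independent_imp_finite)
  show "card C = DIM('a)" using dim_eq_card_independent[OF ind] assms(3) by (metis dim_UNIV dim_span)
  show "parseval_family C (\<lambda>c. c)"
    unfolding parseval_family_def using orthonormal_basis_expand[OF assms(1,2) _ fin] assms(3) fin by auto
qed

lemma orthonormal_inj: "orthonormal u \<Longrightarrow> inj u"
  by (rule injI) (metis orthonormal_inner zero_neq_one)

lemma orthonormal_parseval:
  fixes u :: "'r::finite \<Rightarrow> real ^ 'r"
  assumes u: "orthonormal u"
  shows "parseval_family UNIV u"
proof -
  have o: "pairwise orthogonal (range u)"
    using u by (auto simp: pairwise_def orthogonal_def orthonormal_def)
  have n: "norm c = 1" if "c \<in> range u" for c
    using that u by (auto simp: norm_eq_1 orthonormal_def)
  have "0 \<notin> range u" using n[of 0] by auto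
  then have ind: "independent (range u)" using o by (rule pairwise_orthogonal_independent[rotated])
  have card: "card (range u) = DIM(real ^ 'r)"
    using card_image[OF orthonormal_inj[OF u]] by simp
  have "span (range u) = UNIV"
    using card_ge_dim_independent[of "range u" UNIV] ind card by auto
  from orthonormal_set_basis(3)[OF o n this] show ?thesis
    unfolding parseval_family_def using orthonormal_inj[OF u] by (simp add: sum.reindex)
qed

text \<open>An orthogonal extension that spans the space only has to be normalised; vectors of norm
  \<open>1\<close> stay fixed.\<close>

lemma orthonormal_set_extension:
  fixes S :: "'a::euclidean_space set"
  assumes S: "pairwise orthogonal S" "\<And>c. c \<in> S \<Longrightarrow> norm c = 1"
  obtains C where "S \<subseteq> C" "pairwise orthogonal C" "\<And>c. c \<in> C \<Longrightarrow> norm c = 1" "span C = UNIV"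
proof -
  obtain U where U: "pairwise orthogonal (S \<union> U)" "span (S \<union> U) = span (S \<union> Basis)"
    using orthogonal_extension[OF S(1)] by metis
  define D where "D = (S \<union> U) - {0}"
  define C where "C = (\<lambda>x. (1 / norm x) *\<^sub>R x) ` D"
  show ?thesis
  proof
    show "S \<subseteq> C"
    proof
      fix x assume "x \<in> S"
      then have "norm x = 1" using S(2) by blast
      then have "x \<in> D" using \<open>x \<in> S\<close> by (auto simp: D_def)
      then show "x \<in> C" unfolding C_def using \<open>norm x = 1\<close> by (intro image_eqI[of _ _ x]) auto
    qed
    show "pairwise orthogonal C"
      unfolding pairwise_def
    proof (intro ballI impI)
      fix c c' assume "c \<in> C" "c' \<in> C" "c \<noteq> c'"
      then obtain x y where "x \<in> D" "y \<in> D" and c: "c = (1 / norm x) *\<^sub>R x" "c' = (1 / norm y) *\<^sub>R y"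
        by (auto simp: C_def)
      moreover have "x \<noteq> y" using c \<open>c \<noteq> c'\<close> by blast
      ultimately have "orthogonal x y" using pairwiseD[OF U(1), of x y] by (simp add: D_def)
      then show "orthogonal c c'" by (simp add: c orthogonal_def)
    qed
    show "norm c = 1" if "c \<in> C" for c using that by (auto simp: C_def D_def split: if_splits)
    have "x \<in> span C" if "x \<in> S \<union> U" for x
    proof (cases "x = 0")
      case False
      then have "(1 / norm x) *\<^sub>R x \<in> span C" using that by (auto simp: C_def D_def intro!: span_base)
      then have "norm x *\<^sub>R ((1 / norm x) *\<^sub>R x) \<in> span C" by (rule span_scale)
      then show ?thesis using False by simp
    qed (simp add: span_zero)
    then have "span (S \<union> U) \<subseteq> span C" by (intro span_minimal) auto
    moreover have "span (S \<union> Basis) = (UNIV :: 'a set)"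
      using span_mono[of Basis "S \<union> Basis"] by auto
    ultimately show "span C = UNIV" using U(2) by auto
  qed
qed

text \<open>A maximiser \<open>u\<close> of the Rayleigh quotient on \<open>V\<close> is an eigenvector: moving \<open>u\<close> in a direction
  \<open>w\<close> orthogonal to it changes the quotient to first order by \<open>2 (f u \<bullet> w)\<close>, which must vanish.\<close>

lemma self_adjoint_eigenvector:
  fixes f :: "'a::euclidean_space \<Rightarrow> 'a"
  assumes lin: "linear f" and adj: "\<And>x y. f x \<bullet> y = x \<bullet> f y"
    and V: "subspace V" "V \<noteq> {0}" and inv: "\<And>x. x \<in> V \<Longrightarrow> f x \<in> V"
  obtains u \<mu> where "u \<in> V" "norm u = 1" "f u = \<mu> *\<^sub>R u"
proof -
  define K where "K = V \<inter> sphere 0 1"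
  have "compact K" unfolding K_def using closed_subspace[OF V(1)] by (simp add: closed_Int_compact)
  moreover have "K \<noteq> {}"
  proof -
    obtain x where "x \<in> V" "x \<noteq> 0" using V subspace_0 by blast
    then have "(1 / norm x) *\<^sub>R x \<in> K" using V(1) by (simp add: K_def subspace_scale)
    then show ?thesis by blast
  qed
  moreover have "continuous_on K (\<lambda>x. f x \<bullet> x)"
    using lin by (intro continuous_on_inner continuous_on_id linear_continuous_on)
      (simp add: linear_conv_bounded_linear)
  ultimately have "\<exists>u\<in>K. \<forall>x\<in>K. f x \<bullet> x \<le> f u \<bullet> u" by (rule continuous_attains_sup)
  then obtain u where u: "u \<in> K" and max: "\<And>x. x \<in> K \<Longrightarrow> f x \<bullet> x \<le> f u \<bullet> u"
    by blast
  define \<mu> where "\<mu> = f u \<bullet> u"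
  have uV: "u \<in> V" "norm u = 1" and uu: "u \<bullet> u = 1" using u by (auto simp: K_def norm_eq_1)
  have ray: "f x \<bullet> x \<le> \<mu> * (x \<bullet> x)" if "x \<in> V" for x
  proof (cases "x = 0")
    case False
    define n where "n = norm x"
    have "n > 0" using False by (simp add: n_def)
    have "(1 / n) *\<^sub>R x \<in> K" using V(1) that False by (simp add: K_def subspace_scale n_def)
    then have "f ((1 / n) *\<^sub>R x) \<bullet> ((1 / n) *\<^sub>R x) \<le> \<mu>" unfolding \<mu>_def by (rule max)
    then have "(f x \<bullet> x) / n\<^sup>2 \<le> \<mu>" by (simp add: linear_cmul[OF lin] power2_eq_square)
    then show ?thesis using \<open>n > 0\<close> by (simp add: field_simps n_def power2_norm_eq_inner)
  qed (simp add: linear_0[OF lin])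
  have orth: "f u \<bullet> w = 0" if "w \<in> V" "u \<bullet> w = 0" for w
  proof -
    define a where "a = f w \<bullet> w - \<mu> * (w \<bullet> w)"
    define b where "b = f u \<bullet> w"
    have q: "2 * t * b + t\<^sup>2 * a \<le> 0" for t
    proof -
      have "u + t *\<^sub>R w \<in> V" using V(1) uV that by (simp add: subspace_add subspace_scale)
      from ray[OF this] show ?thesis
        using that uu adj[of w u]
        by (simp add: linear_add[OF lin] linear_cmul[OF lin] inner_add_left inner_add_right a_def b_def
            \<mu>_def inner_commute power2_eq_square algebra_simps)
    qed
    \<comment> \<open>At \<open>t = b / p\<close> the linear term of \<open>2 t b + t\<^sup>2 a\<close> outweighs the quadratic one.\<close>
    define p where "p = \<bar>a\<bar> + 1"
    have p: "p > 0" by (simp add: p_def)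
    have "2 * (b / p) * b + (b / p)\<^sup>2 * a = b\<^sup>2 * (2 * p + a) / p\<^sup>2"
      using p by (simp add: field_simps power2_eq_square)
    with q[of "b / p"] p have "b\<^sup>2 * (2 * p + a) \<le> 0"
      by (simp add: divide_le_0_iff)
    moreover have "2 * p + a > 0"
      by (cases "a \<ge> 0") (auto simp: p_def)
    ultimately have "b = 0" by (simp add: mult_le_0_iff)
    then show ?thesis by (simp add: b_def)
  qed
  define w where "w = f u - \<mu> *\<^sub>R u"
  have "w \<in> V" using V(1) uV inv by (simp add: w_def subspace_diff subspace_scale)
  have uw: "u \<bullet> w = 0" using uu by (simp add: w_def \<mu>_def inner_diff_right inner_commute)
  have "w \<bullet> w = f u \<bullet> w - \<mu> * (u \<bullet> w)" by (simp add: w_def inner_diff_left)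
  also have "\<dots> = 0" using orth[OF \<open>w \<in> V\<close> uw] uw by simp
  finally have "f u = \<mu> *\<^sub>R u" by (simp add: w_def)
  then show ?thesis using uV that by blast
qed

text \<open>The orthogonal complement of an eigenvector in \<open>V\<close> is again invariant.\<close>

lemma self_adjoint_eigenbasis_subspace:
  fixes f :: "'a::euclidean_space \<Rightarrow> 'a"
  assumes lin: "linear f" and adj: "\<And>x y. f x \<bullet> y = x \<bullet> f y"
    and V: "subspace V" and inv: "\<And>x. x \<in> V \<Longrightarrow> f x \<in> V"
  shows "\<exists>B. pairwise orthogonal B \<and> (\<forall>b\<in>B. norm b = 1 \<and> (\<exists>\<mu>. f b = \<mu> *\<^sub>R b)) \<and> span B = V"
  using V inv
proof (induction "dim V" arbitrary: V rule: less_induct)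
  case (less V)
  show ?case
  proof (cases "V = {0}")
    case True
    then show ?thesis by (intro exI[of _ "{}"]) auto
  next
    case False
    obtain u \<mu> where u: "u \<in> V" "norm u = 1" "f u = \<mu> *\<^sub>R u"
      using self_adjoint_eigenvector[OF lin adj less.prems(1) False less.prems(2)] by blast
    have uu: "u \<bullet> u = 1" using u by (simp add: norm_eq_1)
    define W where "W = V \<inter> {x. u \<bullet> x = 0}"
    have sW: "subspace W" unfolding W_def by (intro subspace_inter less.prems subspace_hyperplane)
    have "u \<notin> W" using uu by (simp add: W_def)
    moreover have "W \<subseteq> V" by (simp add: W_def)
    ultimately have "W \<subset> V" using u by blast
    have "span W = W" "span V = V" using sW less.prems(1) by (simp_all add: span_eq_iff)
    then have "dim W < dim V"
      using \<open>W \<subset> V\<close> by (intro dim_psubset) (simp only:)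
    moreover have "f x \<in> W" if "x \<in> W" for x
      using that less.prems(2) adj[of u x] u by (auto simp: W_def)
    ultimately obtain B where B: "pairwise orthogonal B" "\<And>b. b \<in> B \<Longrightarrow> norm b = 1 \<and> (\<exists>\<mu>. f b = \<mu> *\<^sub>R b)" "span B = W"
      using less.hyps[OF _ sW] by blast
    have ort: "u \<bullet> b = 0" if "b \<in> B" for b
      using that B(3) span_base[of b B] by (auto simp: W_def)
    have "span (insert u B) = V"
    proof
      show "span (insert u B) \<subseteq> V"
        using u B(3) \<open>W \<subset> V\<close> span_superset[of B] by (intro span_minimal less.prems) auto
      show "V \<subseteq> span (insert u B)"
      proof
        fix x assume "x \<in> V"
        have "x - (u \<bullet> x) *\<^sub>R u \<in> W"
          using \<open>x \<in> V\<close> u less.prems(1) uu by (simp add: W_def subspace_diff subspace_scale inner_diff_right)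
        then show "x \<in> span (insert u B)" using B(3) by (auto simp: span_insert)
      qed
    qed
    moreover have "pairwise orthogonal (insert u B)"
      using B(1) ort by (auto simp: pairwise_insert orthogonal_def inner_commute)
    ultimately show ?thesis using B(2) u by (intro exI[of _ "insert u B"]) auto
  qed
qed

lemma symmetric_matrix_eigenbasis:
  fixes M :: "real ^ 'r ^ 'r"
  assumes "transpose M = M"
  shows "\<exists>u e. orthonormal u \<and> (\<forall>i::'r. M *v u i = e i *\<^sub>R u i)"
proof -
  have adj: "(M *v x) \<bullet> y = x \<bullet> (M *v y)" for x y
  proof -
    have "(M *v x) \<bullet> y = (x v* M) \<bullet> y"
      using assms transpose_matrix_vector[of M x] by simp
    then show ?thesis by (simp add: dot_lmul_matrix)
  qed
  obtain B where B: "pairwise orthogonal B" "\<And>b. b \<in> B \<Longrightarrow> norm b = 1" "\<And>b. b \<in> B \<Longrightarrow> \<exists>\<mu>. M *v b = \<mu> *\<^sub>R b"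
    "span B = UNIV"
    using self_adjoint_eigenbasis_subspace[OF matrix_vector_mul_linear adj subspace_UNIV] by auto
  have "finite B" "card B = CARD('r)" using orthonormal_set_basis[OF B(1,2,4)] by auto
  then obtain u where u: "bij_betw u (UNIV :: 'r set) B"
    using finite_same_card_bij[of "UNIV :: 'r set" B] by auto
  have uB: "u i \<in> B" for i using u by (auto simp: bij_betw_def)
  have "orthonormal u"
    unfolding orthonormal_def
  proof (intro allI)
    fix i j
    show "u i \<bullet> u j = (if i = j then 1 else 0)"
    proof (cases "i = j")
      case True
      then show ?thesis using B(2)[OF uB[of j]] by (simp add: norm_eq_1)
    next
      case False
      then have "u i \<noteq> u j" using u by (auto simp: bij_betw_def inj_def)
      then show ?thesis using False pairwiseD[OF B(1) uB uB] by (simp add: orthogonal_def)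
    qed
  qed
  moreover have "\<forall>i. \<exists>\<mu>. M *v u i = \<mu> *\<^sub>R u i" using B(3) uB by blast
  then have "\<exists>e. \<forall>i. M *v u i = e i *\<^sub>R u i" by (rule choice)
  ultimately show ?thesis by blast
qed

text \<open>The vectors \<open>\<Theta>\<^sup>T u\<^sub>i\<close> are orthogonal with squared norms \<open>e\<^sub>i\<close>. The nonzero ones are normalised
  and extended to an orthonormal basis \<open>C\<close>, indexed by itself; \<open>\<iota>\<close> pairs each left singular vector
  with an element of \<open>C\<close>, arbitrarily and injectively where \<open>e\<^sub>i = 0\<close>.\<close>

lemma singular_value_decomposition:
  fixes \<Theta> :: "real ^ 'q ^ 'r"
  assumes card: "CARD('r) \<le> CARD('q)"
    and u: "orthonormal u" and eig: "\<And>i::'r. (\<Theta> ** transpose \<Theta>) *v u i = e i *\<^sub>R u i"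
  obtains C \<iota> where "pairwise orthogonal C" "\<And>c. c \<in> C \<Longrightarrow> norm c = 1" "span C = UNIV"
    "inj \<iota>" "range \<iota> \<subseteq> C" "\<And>i. 0 \<le> e i" "\<And>i. transpose \<Theta> *v u i = sqrt (e i) *\<^sub>R \<iota> i"
proof -
  define w where "w i = transpose \<Theta> *v u i" for i
  have ww: "w i \<bullet> w j = (if i = j then e i else 0)" for i j
  proof -
    have "w i \<bullet> w j = u i \<bullet> (\<Theta> *v (transpose \<Theta> *v u j))"
      by (simp add: w_def transpose_matrix_vector dot_lmul_matrix)
    also have "\<dots> = u i \<bullet> (e j *\<^sub>R u j)" by (simp only: matrix_vector_mul_assoc eig)
    finally show ?thesis using orthonormal_inner[OF u, of i j] by simp
  qed
  have e0: "0 \<le> e i" for i using ww[of i i] inner_ge_zero[of "w i"] by simp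
  define I where "I = {i. e i > 0}"
  define z where "z i = (1 / sqrt (e i)) *\<^sub>R w i" for i
  have zz: "z i \<bullet> z j = (if i = j then 1 else 0)" if "i \<in> I" "j \<in> I" for i j
    using that ww[of i j] by (auto simp: z_def I_def)
  have injz: "inj_on z I" by (rule inj_onI) (metis zz zero_neq_one)
  have "pairwise orthogonal (z ` I)" "\<And>c. c \<in> z ` I \<Longrightarrow> norm c = 1"
    using zz by (auto simp: pairwise_def orthogonal_def norm_eq_1)
  then obtain C where C: "z ` I \<subseteq> C" "pairwise orthogonal C" "\<And>c. c \<in> C \<Longrightarrow> norm c = 1" "span C = UNIV"
    using orthonormal_set_extension by metis
  have finC: "finite C" "card C = CARD('q)" using orthonormal_set_basis[OF C(2-4)] by auto
  have "card (- I) \<le> card (C - z ` I)"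
    using card finC C(1) card_image[OF injz] by (simp add: card_Diff_subset Compl_eq_Diff_UNIV)
  then obtain k where k: "k ` (- I) \<subseteq> C - z ` I" "inj_on k (- I)"
    using card_le_inj[of "- I" "C - z ` I"] finC by auto
  define \<iota> where "\<iota> i = (if i \<in> I then z i else k i)" for i
  show ?thesis
  proof
    show "inj \<iota>"
      using injz k by (auto simp: inj_on_def \<iota>_def split: if_splits)
    show "range \<iota> \<subseteq> C" using C(1) k(1) by (auto simp: \<iota>_def)
    show "transpose \<Theta> *v u i = sqrt (e i) *\<^sub>R \<iota> i" for i
    proof (cases "i \<in> I")
      case True
      then show ?thesis by (simp add: \<iota>_def z_def I_def w_def)
    next
      case False
      then have "e i = 0" using e0[of i] by (simp add: I_def)
      then have "w i = 0" using ww[of i i] by simp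
      then show ?thesis using \<open>e i = 0\<close> by (simp add: w_def)
    qed
  qed (use C e0 in auto)
qed

lemma orthonormal_rows_conjugate:
  fixes M :: "real ^ 'r ^ 'r"
  assumes u: "orthonormal u" and eig: "\<And>i::'r. M *v u i = e i *\<^sub>R u i"
  shows "orthogonal_matrix (\<chi> i. u i)" "(\<chi> i. u i) ** M ** transpose (\<chi> i. u i) = diag_mat (\<chi> i. e i)"
proof -
  have "(\<chi> i. u i) ** transpose (\<chi> i. u i) = mat 1"
    using orthonormal_inner[OF u] by (simp add: matrix_matrix_mult_def transpose_def mat_def vec_eq_iff inner_vec_def)
  then have "transpose (\<chi> i. u i) ** (\<chi> i. u i) = mat 1"
    by (rule matrix_left_right_inverse[THEN iffD1])
  then show "orthogonal_matrix (\<chi> i. u i)"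
    unfolding orthogonal_matrix .
  have "((\<chi> i. u i) ** M ** transpose (\<chi> i. u i)) $ i $ j = u i \<bullet> (M *v u j)" for i j
    by (simp add: matrix_matrix_mult_def transpose_def matrix_vector_mult_def inner_vec_def
        sum_distrib_left sum_distrib_right mult_ac) (rule sum.swap)
  then show "(\<chi> i. u i) ** M ** transpose (\<chi> i. u i) = diag_mat (\<chi> i. e i)"
    using orthonormal_inner[OF u] by (simp add: eig diag_mat_def vec_eq_iff)
qed

lemma det_char_eigenbasis:
  fixes M :: "real ^ 'r ^ 'r"
  assumes u: "orthonormal u" and eig: "\<And>i::'r. M *v u i = e i *\<^sub>R u i"
  shows "det (mat x - M) = (\<Prod>i\<in>UNIV. x - e i)"
proof -
  let ?P = "\<chi> i. u i"
  have "(mat x - M) *v u i = (x - e i) *\<^sub>R u i" for i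
  proof -
    have "mat x *v u i = x *\<^sub>R u i"
      by (simp add: mat_def matrix_vector_mult_def vec_eq_iff if_distrib[of "\<lambda>y. y * _"] sum.delta cong: if_cong)
    then show ?thesis by (simp add: matrix_vector_mult_diff_rdistrib eig scaleR_diff_left)
  qed
  note P = orthonormal_rows_conjugate[OF u this]
  have "det ?P * det (transpose ?P) = 1"
    using P(1) unfolding orthogonal_matrix_def by (metis det_I det_mul mult.commute)
  then have "det (mat x - M) = det (?P ** (mat x - M) ** transpose ?P)"
    by (simp add: det_mul)
  also have "\<dots> = (\<Prod>i\<in>UNIV. x - e i)"
    unfolding P(2) by (subst det_diagonal) (simp_all add: diag_mat_def)
  finally show ?thesis .
qed

text \<open>Both products are polynomials in \<open>x\<close>, and equal polynomials have the same multiset of roots.\<close>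

lemma monic_product_roots_permutation:
  fixes l e :: "'r::finite \<Rightarrow> real"
  assumes "\<And>x. (\<Prod>i\<in>UNIV. x - l i) = (\<Prod>i\<in>UNIV. x - e i)"
  obtains \<sigma> where "\<sigma> permutes UNIV" "\<And>i. l i = e (\<sigma> i)"
proof -
  have "poly (\<Prod>i\<in>UNIV. [:- l i, 1:]) x = poly (\<Prod>i\<in>UNIV. [:- e i, 1:]) x" for x
    using assms[of x] by (simp add: poly_prod)
  then have "(\<Prod>i\<in>UNIV. [:- l i, 1:]) = (\<Prod>i\<in>UNIV. [:- e i, 1:])"
    by (intro iffD1[OF poly_eq_poly_eq_iff]) auto
  then have "proots (\<Prod>i\<in>UNIV. [:- l i, 1:]) = proots (\<Prod>i\<in>UNIV. [:- e i, 1:])" by simp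
  moreover have "proots (\<Prod>i\<in>UNIV. [:- f i, 1:]) = image_mset f (mset_set (UNIV :: 'r set))" for f :: "'r \<Rightarrow> real"
    by (subst proots_prod) (auto simp: sum_unfold_sum_mset)
  ultimately have "image_mset l (mset_set UNIV) = image_mset e (mset_set UNIV)" by simp
  then show ?thesis
    using image_mset_eq_implies_permutes[of "UNIV :: 'r set" l e] that by auto
qed

section \<open>Derivatives of spectral functions on the orthant\<close>

lemma convex_nonneg_orthant: "convex (nonneg_orthant :: (real ^ 'r) set)"
  by (rule convexI) (simp add: nonneg_orthant_def)

lemma upd_coord_eq: "upd_coord l i t = l + (t - l $ i) *\<^sub>R axis i 1"
  by (simp add: upd_coord_def vec_eq_iff axis_def)

lemma upd_coord_self [simp]: "upd_coord l i (l $ i) = l"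
  by (simp add: upd_coord_eq)

lemma upd_coord_orthant: "l \<in> nonneg_orthant \<Longrightarrow> 0 \<le> t \<Longrightarrow> upd_coord l i t \<in> nonneg_orthant"
  by (simp add: upd_coord_def nonneg_orthant_def)

lemma at_within_atLeast_neq_bot: "0 \<le> x \<Longrightarrow> at (x::real) within {0..} \<noteq> bot"
proof
  assume "0 \<le> x" "at x within {0..} = bot"
  moreover have "{x<..} \<subseteq> {0..}" using \<open>0 \<le> x\<close> by auto
  ultimately have "at_right x \<le> bot" using at_le[of "{x<..}" "{0..}" x] by simp
  then show False using trivial_limit_at_right_real[of x] by (simp add: bot_unique)
qed

lemma has_vector_derivative_upd_coord:
  fixes h :: "real ^ 'r \<Rightarrow> 'b::real_normed_vector"
  assumes h: "(h has_derivative D) (at l within nonneg_orthant)" and l: "l \<in> nonneg_orthant"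
    and eq: "\<And>t. 0 \<le> t \<Longrightarrow> f t = h (upd_coord l i t)"
  shows "(f has_vector_derivative D (axis i 1)) (at (l $ i) within {0..})"
proof -
  have lin: "linear D" using h by (simp add: has_derivative_def bounded_linear.linear)
  have li: "l $ i \<in> {0..}" using l by (simp add: nonneg_orthant_def)
  have "((\<lambda>t. h (upd_coord l i t)) has_derivative (\<lambda>t. D (t *\<^sub>R axis i 1))) (at (l $ i) within {0..})"
  proof -
    have 1: "(upd_coord l i has_derivative (\<lambda>t. t *\<^sub>R axis i 1)) (at (l $ i) within {0..})"
      unfolding upd_coord_eq[abs_def] by (auto intro!: derivative_eq_intros)
    have "upd_coord l i ` {0..} \<subseteq> nonneg_orthant" using l by (auto intro: upd_coord_orthant)
    with h have "(h has_derivative D) (at (upd_coord l i (l $ i)) within upd_coord l i ` {0..})"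
      by (simp add: has_derivative_subset)
    from has_derivative_in_compose[OF 1 this] show ?thesis .
  qed
  then have "((\<lambda>t. h (upd_coord l i t)) has_vector_derivative D (axis i 1)) (at (l $ i) within {0..})"
    by (simp add: has_vector_derivative_def linear_cmul[OF lin])
  then show ?thesis
    by (rule has_vector_derivative_transform[OF li, rotated]) (simp add: eq)
qed

lemma partial_orthant_eqI:
  assumes "(h has_derivative D) (at l within nonneg_orthant)" "l \<in> nonneg_orthant"
    and "\<And>\<mu>. \<mu> \<in> nonneg_orthant \<Longrightarrow> f \<mu> = h \<mu>"
  shows "partial_orthant i f l = D (axis i 1)"
  unfolding partial_orthant_def
proof (rule vector_derivative_within)
  show "at (l $ i) within {0..} \<noteq> bot"
    using assms(2) by (intro at_within_atLeast_neq_bot) (simp add: nonneg_orthant_def)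
  show "((\<lambda>t. f (upd_coord l i t)) has_vector_derivative D (axis i 1)) (at (l $ i) within {0..})"
    by (rule has_vector_derivative_upd_coord[OF assms(1,2)]) (intro assms(3) upd_coord_orthant assms(2))
qed

lemma psd_diag_mat: "l \<in> nonneg_orthant \<Longrightarrow> diag_mat l \<in> psd_matrices"
proof -
  assume l: "l \<in> nonneg_orthant"
  have "diag_mat l *v x = (\<chi> i. l $ i * x $ i)" for x
    by (simp add: diag_mat_def matrix_vector_mult_def vec_eq_iff if_distrib[of "\<lambda>y. y * _"] sum.delta cong: if_cong)
  then have "x \<bullet> (diag_mat l *v x) = (\<Sum>i\<in>UNIV. l $ i * (x $ i)\<^sup>2)" for x
    by (simp add: inner_vec_def power2_eq_square mult_ac)
  moreover have "transpose (diag_mat l) = diag_mat l"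
    by (auto simp: diag_mat_def transpose_def vec_eq_iff)
  ultimately show ?thesis
    using l by (auto simp: psd_matrices_def nonneg_orthant_def intro!: sum_nonneg)
qed

lemma psd_mult_transpose:
  fixes A :: "real ^ 'q ^ 'r"
  shows "A ** transpose A \<in> psd_matrices"
proof -
  have "x \<bullet> ((A ** transpose A) *v x) = (transpose A *v x) \<bullet> (transpose A *v x)" for x
    by (simp add: matrix_vector_mul_assoc[symmetric] transpose_matrix_vector dot_lmul_matrix)
  then show ?thesis by (simp add: psd_matrices_def matrix_transpose_mul)
qed

lemma psd_eigenvalue_nonneg:
  assumes "M \<in> psd_matrices" "orthonormal u" "M *v u i = e *\<^sub>R u i"
  shows "0 \<le> e"
proof -
  have "0 \<le> u i \<bullet> (M *v u i)" using assms(1) by (simp add: psd_matrices_def)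
  then show ?thesis using orthonormal_inner[OF assms(2), of i i] by (simp add: assms(3))
qed

locale spectral_function =
  fixes g :: "real ^ 'r ^ 'r \<Rightarrow> real"
    and F' :: "real ^ 'r \<Rightarrow> (real ^ 'r) \<Rightarrow>\<^sub>L real"
    and F'' :: "real ^ 'r \<Rightarrow> real ^ 'r \<Rightarrow> (real ^ 'r) \<Rightarrow>\<^sub>L real"
  assumes inv: "orthogonally_invariant g"
    and F': "l \<in> nonneg_orthant \<Longrightarrow>
      ((\<lambda>l. g (diag_mat l)) has_derivative blinfun_apply (F' l)) (at l within nonneg_orthant)"
    and F'': "l \<in> nonneg_orthant \<Longrightarrow> (F' has_derivative F'' l) (at l within nonneg_orthant)"
begin

lemma g_eq_diag:
  assumes "M \<in> psd_matrices" and u: "orthonormal u" and eig: "\<And>i. M *v u i = e i *\<^sub>R u i"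
  shows "g M = g (diag_mat (\<chi> i. e i))"
  using inv orthonormal_rows_conjugate[OF u eig] assms(1) unfolding orthogonally_invariant_def by metis

lemma F''_apply: "l \<in> nonneg_orthant \<Longrightarrow>
    ((\<lambda>l. F' l v) has_derivative (\<lambda>w. F'' l w v)) (at l within nonneg_orthant)"
  using bounded_linear.has_derivative[OF blinfun.bounded_linear_left F''] .

lemma phi_eq:
  assumes "l \<in> nonneg_orthant"
  shows "phi g i l = F' l (axis i 1)"
  unfolding phi_def by (rule partial_orthant_eqI[OF F']) (use assms in auto)

lemma partial_phi_eq:
  assumes "l \<in> nonneg_orthant"
  shows "partial_orthant i (phi g k) l = F'' l (axis i 1) (axis k 1)"
  by (rule partial_orthant_eqI[OF F''_apply]) (use assms phi_eq in auto)

definition swap :: "'r \<Rightarrow> 'r \<Rightarrow> real ^ 'r \<Rightarrow> real ^ 'r" where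
  "swap i j l = (\<chi> k. l $ Transposition.transpose i j k)"

lemma swap_orthant: "l \<in> nonneg_orthant \<Longrightarrow> swap i j l \<in> nonneg_orthant"
  by (simp add: swap_def nonneg_orthant_def)

lemma swap_fixed: "l $ i = l $ j \<Longrightarrow> swap i j l = l"
  by (simp add: swap_def vec_eq_iff Transposition.transpose_def)

lemma swap_upd_coord:
  "swap i j (upd_coord l k t) = upd_coord (swap i j l) (Transposition.transpose i j k) t"
  by (auto simp: swap_def upd_coord_def vec_eq_iff Transposition.transpose_def)

text \<open>Exchanging two eigenvalues is conjugation by a permutation matrix, so the spectral function is
  symmetric. The next two lemmas differentiate this symmetry.\<close>

lemma g_swap:
  assumes "l \<in> nonneg_orthant"
  shows "g (diag_mat (swap i j l)) = g (diag_mat l)"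
proof -
  define u :: "'r \<Rightarrow> real ^ 'r" where "u k = axis (Transposition.transpose i j k) 1" for k
  have "orthonormal u"
    by (auto simp: orthonormal_def u_def inner_axis_axis dest: transpose_eq_imp_eq)
  moreover have "diag_mat l *v u k = l $ Transposition.transpose i j k *\<^sub>R u k" for k
    by (auto simp: u_def diag_mat_def matrix_vector_mult_def vec_eq_iff axis_def
        if_distrib[of "\<lambda>y. _ * y"] sum.delta cong: if_cong)
  ultimately show ?thesis
    using g_eq_diag[OF psd_diag_mat[OF assms], of u "\<lambda>k. l $ Transposition.transpose i j k"]
    by (simp add: swap_def)
qed

lemma F'_swap:
  assumes l: "l \<in> nonneg_orthant"
  shows "F' (swap i j l) (axis (Transposition.transpose i j k) 1) = F' l (axis k 1)"
proof -
  let ?k = "Transposition.transpose i j k"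
  have sl: "swap i j l $ ?k = l $ k" by (simp add: swap_def)
  have eq: "g (diag_mat (upd_coord l k t)) = g (diag_mat (upd_coord (swap i j l) ?k t))" if "0 \<le> t" for t
    using g_swap[OF upd_coord_orthant[OF l that], of i j k] by (simp add: swap_upd_coord)
  have 1: "((\<lambda>t. g (diag_mat (upd_coord l k t))) has_vector_derivative F' l (axis k 1)) (at (l $ k) within {0..})"
    by (rule has_vector_derivative_upd_coord[OF F'[OF l] l]) simp
  have 2: "((\<lambda>t. g (diag_mat (upd_coord l k t))) has_vector_derivative F' (swap i j l) (axis ?k 1)) (at (l $ k) within {0..})"
    using has_vector_derivative_upd_coord[OF F'[OF swap_orthant[OF l]] swap_orthant[OF l] eq] by (simp add: sl)
  show ?thesis
    using vector_derivative_within[OF at_within_atLeast_neq_bot 1] vector_derivative_within[OF at_within_atLeast_neq_bot 2]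
      l by (simp add: nonneg_orthant_def)
qed

lemma F''_swap:
  assumes l: "l \<in> nonneg_orthant" and ij: "l $ i = l $ j"
  shows "F'' l (axis j 1) (axis (Transposition.transpose i j k) 1) = F'' l (axis i 1) (axis k 1)"
proof -
  let ?k = "Transposition.transpose i j k"
  have eq: "F' (upd_coord l i t) (axis k 1) = F' (upd_coord l j t) (axis ?k 1)" if "0 \<le> t" for t
    using F'_swap[OF upd_coord_orthant[OF l that], of i j i k] by (simp add: swap_upd_coord swap_fixed[OF ij])
  have 1: "((\<lambda>t. F' (upd_coord l i t) (axis k 1)) has_vector_derivative F'' l (axis i 1) (axis k 1)) (at (l $ i) within {0..})"
    by (rule has_vector_derivative_upd_coord[OF F''_apply[OF l] l]) simp
  have 2: "((\<lambda>t. F' (upd_coord l i t) (axis k 1)) has_vector_derivative F'' l (axis j 1) (axis ?k 1)) (at (l $ i) within {0..})"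
    unfolding ij by (rule has_vector_derivative_upd_coord[OF F''_apply[OF l] l eq])
  show ?thesis
    using vector_derivative_within[OF at_within_atLeast_neq_bot 1] vector_derivative_within[OF at_within_atLeast_neq_bot 2]
      l by (simp add: nonneg_orthant_def)
qed

lemma phi_quotient_neq:
  assumes "l \<in> nonneg_orthant" "l $ i \<noteq> l $ j"
  shows "phi_quotient g i j l = (l $ i * F' l (axis i 1) - l $ j * F' l (axis j 1)) / (l $ i - l $ j)"
  using assms by (simp add: phi_quotient_def phi_eq)

text \<open>At the point with \<open>i\<close>-th coordinate \<open>t\<close> the quotient equals
  \<open>\<phi>\<^sub>i + l\<^sub>j (\<phi>\<^sub>i - \<phi>\<^sub>j) / (t - l\<^sub>j)\<close>. By symmetry \<open>\<phi>\<^sub>i\<close> and \<open>\<phi>\<^sub>j\<close> agree at \<open>l\<close>, so the fraction is a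
  difference of two difference quotients.\<close>

lemma phi_quotient_eq:
  assumes l: "l \<in> nonneg_orthant" and ij: "l $ i = l $ j" "i \<noteq> j"
  shows "phi_quotient g i j l =
    F' l (axis i 1) + l $ i * (F'' l (axis i 1) (axis i 1) - F'' l (axis i 1) (axis j 1))"
proof -
  let ?e = "\<lambda>k. axis k (1::real) :: real ^ 'r" and ?x = "l $ i"
  let ?Q = "\<lambda>\<mu>. (\<mu> $ i * phi g i \<mu> - \<mu> $ j * phi g j \<mu>) / (\<mu> $ i - \<mu> $ j)"
  have x0: "0 \<le> ?x" using l by (simp add: nonneg_orthant_def)
  have phi0: "F' l (?e j) = F' l (?e i)"
    using F'_swap[OF l, of i j i] by (simp add: swap_fixed[OF ij(1)])
  have lim: "((\<lambda>t. (F' (upd_coord l i t) (?e k) - F' l (?e k)) / (t - ?x)) \<longlongrightarrow> F'' l (?e i) (?e k)) (at ?x within {0..})" for k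
  proof -
    have "((\<lambda>t. F' (upd_coord l i t) (?e k)) has_vector_derivative F'' l (?e i) (?e k)) (at ?x within {0..})"
      by (rule has_vector_derivative_upd_coord[OF F''_apply[OF l] l]) simp
    then show ?thesis
      by (simp add: has_real_derivative_iff_has_vector_derivative[symmetric] has_field_derivative_iff)
  qed
  have cont: "((\<lambda>t. F' (upd_coord l i t) (?e i)) \<longlongrightarrow> F' l (?e i)) (at ?x within {0..})"
  proof -
    have "((\<lambda>t. F' (upd_coord l i t) (?e i)) has_vector_derivative F'' l (?e i) (?e i)) (at ?x within {0..})"
      by (rule has_vector_derivative_upd_coord[OF F''_apply[OF l] l]) simp
    from has_vector_derivative_continuous[OF this] show ?thesis
      by (simp add: continuous_within)
  qed
  have "((\<lambda>t. F' (upd_coord l i t) (?e i) + ?x * ((F' (upd_coord l i t) (?e i) - F' l (?e i)) / (t - ?x)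
      - (F' (upd_coord l i t) (?e j) - F' l (?e j)) / (t - ?x))) \<longlongrightarrow>
    F' l (?e i) + ?x * (F'' l (?e i) (?e i) - F'' l (?e i) (?e j))) (at ?x within {0..})"
    by (intro tendsto_add tendsto_mult tendsto_diff tendsto_const lim cont)
  then have "((\<lambda>t. ?Q (upd_coord l i t)) \<longlongrightarrow> F' l (?e i) + ?x * (F'' l (?e i) (?e i) - F'' l (?e i) (?e j))) (at ?x within {0..})"
  proof (rule Lim_transform_eventually)
    show "\<forall>\<^sub>F t in at ?x within {0..}. F' (upd_coord l i t) (?e i) + ?x * ((F' (upd_coord l i t) (?e i) - F' l (?e i)) / (t - ?x)
      - (F' (upd_coord l i t) (?e j) - F' l (?e j)) / (t - ?x)) = ?Q (upd_coord l i t)"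
      unfolding eventually_at_filter
    proof (intro always_eventually allI impI)
      fix t assume t: "t \<noteq> ?x" "t \<in> {0..}"
      have c: "upd_coord l i t $ i = t" "upd_coord l i t $ j = ?x"
        using ij by (simp_all add: upd_coord_def)
      have p: "phi g k (upd_coord l i t) = F' (upd_coord l i t) (?e k)" for k
        using t l by (intro phi_eq upd_coord_orthant) auto
      show "F' (upd_coord l i t) (?e i) + ?x * ((F' (upd_coord l i t) (?e i) - F' l (?e i)) / (t - ?x)
        - (F' (upd_coord l i t) (?e j) - F' l (?e j)) / (t - ?x)) = ?Q (upd_coord l i t)"
        using t(1) unfolding c p phi0 diff_divide_distrib[symmetric] by (simp add: field_simps)
    qed
  qed
  from tendsto_Lim[OF at_within_atLeast_neq_bot[OF x0] this] show ?thesis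
    unfolding phi_quotient_def Let_def using ij(1) by (simp only: simp_thms if_False)
qed

end

section \<open>The Laplacian in singular coordinates\<close>

text \<open>Singular vectors and values of \<open>\<Theta>\<close> as produced by \<open>singular_value_decomposition\<close>, together with
  the derivatives of the prior \<open>\<Theta> \<mapsto> g (\<Theta> \<Theta>\<^sup>T)\<close>.\<close>

locale singular_values = spectral_function g F' F''
  for g :: "real ^ 'r ^ 'r \<Rightarrow> real" and F' F'' +
  fixes \<Theta> :: "real ^ 'q ^ 'r" and u :: "'r \<Rightarrow> real ^ 'r" and d :: "'r \<Rightarrow> real"
    and C :: "(real ^ 'q) set" and \<iota> :: "'r \<Rightarrow> real ^ 'q"
    and P' :: "real ^ 'q ^ 'r \<Rightarrow> (real ^ 'q ^ 'r) \<Rightarrow>\<^sub>L real"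
    and P'' :: "real ^ 'q ^ 'r \<Rightarrow> (real ^ 'q ^ 'r) \<Rightarrow>\<^sub>L real"
  assumes u: "orthonormal u" and d0: "0 \<le> d k"
    and C: "pairwise orthogonal C" "c \<in> C \<Longrightarrow> norm c = 1"
    and \<iota>: "inj \<iota>" "range \<iota> \<subseteq> C"
    and svd: "transpose \<Theta> *v u k = d k *\<^sub>R \<iota> k"
    and P': "((\<lambda>\<Theta>. g (\<Theta> ** transpose \<Theta>)) has_derivative blinfun_apply (P' A)) (at A)"
    and P'': "(P' has_derivative P'') (at \<Theta>)"
begin

definition l :: "real ^ 'r" where "l = (\<chi> k. (d k)\<^sup>2)"

lemma l_nth [simp]: "l $ k = (d k)\<^sup>2"
  by (simp add: l_def)

lemma l_orthant: "l \<in> nonneg_orthant"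
  by (simp add: nonneg_orthant_def)

lemma linear_F'': "linear (F'' l)"
  using F''[OF l_orthant] by (simp add: has_derivative_def bounded_linear.linear)

lemma C_inner: "c \<in> C \<Longrightarrow> c' \<in> C \<Longrightarrow> c \<bullet> c' = (if c = c' then 1 else 0)"
  using C by (auto simp: pairwise_def orthogonal_def norm_eq_1)

lemma \<iota>_C [simp]: "\<iota> k \<in> C"
  using \<iota> by auto

lemma \<iota>_inner: "\<iota> j \<bullet> \<iota> k = (if j = k then 1 else 0)"
  using C_inner[of "\<iota> j" "\<iota> k"] \<iota>(1) by (simp add: inj_eq)

lemma mult_right_vector: "\<Theta> *v c = (\<Sum>k\<in>UNIV. (d k * (\<iota> k \<bullet> c)) *\<^sub>R u k)"
proof -
  have "(\<Theta> *v c) \<bullet> u k = d k * (\<iota> k \<bullet> c)" for k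
  proof -
    have "(\<Theta> *v c) \<bullet> u k = u k \<bullet> (\<Theta> *v c)" by (rule inner_commute)
    also have "\<dots> = (transpose \<Theta> *v u k) \<bullet> c" by (simp add: dot_lmul_matrix)
    finally show ?thesis unfolding svd by simp
  qed
  moreover have "(\<Sum>k\<in>UNIV. ((\<Theta> *v c) \<bullet> u k) *\<^sub>R u k) = \<Theta> *v c"
    using orthonormal_parseval[OF u] by (simp add: parseval_family_def)
  ultimately show ?thesis by simp
qed

lemma mult_\<iota>: "\<Theta> *v \<iota> k = d k *\<^sub>R u k"
  by (simp add: mult_right_vector \<iota>_inner if_distrib[of "\<lambda>y. _ * y"] if_distrib[of "\<lambda>y. y *\<^sub>R _"] sum.delta cong: if_cong)

text \<open>The argument of \<open>g\<close> along the line through \<open>\<Theta>\<close> in direction \<open>u\<^sub>i c\<^sup>T\<close>.\<close>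

definition gram :: "'r \<Rightarrow> real ^ 'q \<Rightarrow> real \<Rightarrow> real ^ 'r ^ 'r" where
  "gram i c t = (\<Theta> + t *\<^sub>R outer (u i) c) ** transpose (\<Theta> + t *\<^sub>R outer (u i) c)"

lemma gram_psd: "gram i c t \<in> psd_matrices"
  unfolding gram_def by (rule psd_mult_transpose)

lemma gram_mult_u:
  "gram i c t *v u k = d k *\<^sub>R (d k *\<^sub>R u k + (t * (c \<bullet> \<iota> k)) *\<^sub>R u i) +
     (if k = i then t *\<^sub>R (\<Theta> *v c + (t * (c \<bullet> c)) *\<^sub>R u i) else 0)"
proof -
  have A: "(\<Theta> + t *\<^sub>R outer (u i) c) *v y = \<Theta> *v y + (t * (c \<bullet> y)) *\<^sub>R u i" for y
    by (simp add: matrix_vector_mult_add_rdistrib scaleR_matrix_vector_assoc[symmetric] outer_mult_vec)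
  have T: "transpose (\<Theta> + t *\<^sub>R outer (u i) c) *v u k = d k *\<^sub>R \<iota> k + (if k = i then t *\<^sub>R c else 0)"
  proof -
    have "transpose (\<Theta> + t *\<^sub>R outer (u i) c) = transpose \<Theta> + t *\<^sub>R outer c (u i)"
      by (simp add: transpose_def outer_def vec_eq_iff mult.commute)
    then show ?thesis
      using orthonormal_inner[OF u, of i k]
      by (simp add: matrix_vector_mult_add_rdistrib scaleR_matrix_vector_assoc[symmetric] outer_mult_vec svd
          del: transpose_matrix_vector)
  qed
  show ?thesis
    unfolding gram_def matrix_vector_mul_assoc[symmetric] T A
    by (simp add: matrix_vector_right_distrib matrix_vector_mult_scaleR mult_\<iota> algebra_simps inner_add_right)
qed

lemma g_gram_0: "g (\<Theta> ** transpose \<Theta>) = g (diag_mat l)"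
proof -
  have "gram i 0 0 *v u k = (d k)\<^sup>2 *\<^sub>R u k" for i k
    by (simp add: gram_mult_u power2_eq_square)
  from g_eq_diag[OF gram_psd u this] show ?thesis
    by (simp add: gram_def l_def)
qed

text \<open>The second difference of the prior along the line is also a second difference of the spectral
  function along any curve \<open>m\<close> of eigenvalues.\<close>

lemma P''_eq:
  assumes m: "\<forall>\<^sub>F t in at 0. m t \<in> nonneg_orthant \<and> g (gram i c t) = g (diag_mat (m t))"
    and \<kappa>: "((\<lambda>t. (1 / t) *\<^sub>R (m t - l)) \<longlongrightarrow> \<kappa>) (at 0)"
    and \<nu>: "((\<lambda>t. (1 / t\<^sup>2) *\<^sub>R (m t + m (- t) - 2 *\<^sub>R l)) \<longlongrightarrow> \<nu>) (at 0)"
  shows "P'' (outer (u i) c) (outer (u i) c) = F' l \<nu> + F'' l \<kappa> \<kappa>"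
proof -
  let ?p = "\<lambda>t. g (gram i c t)" and ?q = "g (\<Theta> ** transpose \<Theta>)"
  have "((\<lambda>t. (?p t + ?p (- t) - 2 * ?q) / t\<^sup>2) \<longlongrightarrow> P'' (outer (u i) c) (outer (u i) c)) (at 0)"
    using second_difference_line[OF P' P'', of "outer (u i) c"] by (simp add: gram_def)
  moreover have "((\<lambda>t. (?p t + ?p (- t) - 2 * ?q) / t\<^sup>2) \<longlongrightarrow> F' l \<nu> + F'' l \<kappa> \<kappa>) (at 0)"
  proof (rule Lim_transform_eventually)
    show "((\<lambda>t. (g (diag_mat (m t)) + g (diag_mat (m (- t))) - 2 * g (diag_mat l)) / t\<^sup>2) \<longlongrightarrow> F' l \<nu> + F'' l \<kappa> \<kappa>) (at 0)"
      using m by (intro symmetric_second_difference[OF convex_nonneg_orthant l_orthant F' F''[OF l_orthant] _ \<kappa> \<nu>])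
        (auto elim: eventually_mono)
    have "\<forall>\<^sub>F t in at 0. m (- t) \<in> nonneg_orthant \<and> g (gram i c (- t)) = g (diag_mat (m (- t)))"
      using filterlim_uminus_at_0 m by (auto simp: filterlim_iff)
    with m show "\<forall>\<^sub>F t in at 0. (g (diag_mat (m t)) + g (diag_mat (m (- t))) - 2 * g (diag_mat l)) / t\<^sup>2 =
        (?p t + ?p (- t) - 2 * ?q) / t\<^sup>2"
      by eventually_elim (simp add: g_gram_0)
  qed
  ultimately show ?thesis by (rule tendsto_unique[OF at_neq_bot])
qed

lemma eventually_nonzero: "\<forall>\<^sub>F t in at (0::real). t \<noteq> 0"
  by (simp add: eventually_at_filter)

lemma P''_of_eigenvalue_curve:
  assumes m: "\<forall>\<^sub>F t in at 0. l + y t *\<^sub>R axis i 1 + z t *\<^sub>R axis j 1 \<in> nonneg_orthant \<and>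
      g (gram k c t) = g (diag_mat (l + y t *\<^sub>R axis i 1 + z t *\<^sub>R axis j 1))"
    and y: "((\<lambda>t. y t / t) \<longlongrightarrow> y1) (at 0)" "((\<lambda>t. (y t + y (- t)) / t\<^sup>2) \<longlongrightarrow> y2) (at 0)"
    and z: "((\<lambda>t. z t / t) \<longlongrightarrow> z1) (at 0)" "((\<lambda>t. (z t + z (- t)) / t\<^sup>2) \<longlongrightarrow> z2) (at 0)"
  shows "P'' (outer (u k) c) (outer (u k) c) = F' l (y2 *\<^sub>R axis i 1 + z2 *\<^sub>R axis j 1) +
    F'' l (y1 *\<^sub>R axis i 1 + z1 *\<^sub>R axis j 1) (y1 *\<^sub>R axis i 1 + z1 *\<^sub>R axis j 1)"
proof (rule P''_eq[OF m])
  have "(1 / t) *\<^sub>R (l + y t *\<^sub>R axis i 1 + z t *\<^sub>R axis j 1 - l) = (y t / t) *\<^sub>R axis i 1 + (z t / t) *\<^sub>R axis j 1" for t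
    by (simp add: scaleR_add_right)
  then show "((\<lambda>t. (1 / t) *\<^sub>R (l + y t *\<^sub>R axis i 1 + z t *\<^sub>R axis j 1 - l)) \<longlongrightarrow>
      y1 *\<^sub>R axis i 1 + z1 *\<^sub>R axis j 1) (at 0)"
    by (simp only:) (intro tendsto_intros y z)
  have "(1 / t\<^sup>2) *\<^sub>R (l + y t *\<^sub>R axis i 1 + z t *\<^sub>R axis j 1 + (l + y (- t) *\<^sub>R axis i 1 + z (- t) *\<^sub>R axis j 1) - 2 *\<^sub>R l)
      = ((y t + y (- t)) / t\<^sup>2) *\<^sub>R axis i 1 + ((z t + z (- t)) / t\<^sup>2) *\<^sub>R axis j 1" for t
    by (simp add: vec_eq_iff add_divide_distrib algebra_simps)
  then show "((\<lambda>t. (1 / t\<^sup>2) *\<^sub>R (l + y t *\<^sub>R axis i 1 + z t *\<^sub>R axis j 1 +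
      (l + y (- t) *\<^sub>R axis i 1 + z (- t) *\<^sub>R axis j 1) - 2 *\<^sub>R l)) \<longlongrightarrow>
      y2 *\<^sub>R axis i 1 + z2 *\<^sub>R axis j 1) (at 0)"
    by (simp only:) (intro tendsto_intros y z)
qed

lemma symmetric_square_lim: "((\<lambda>t::real. (t\<^sup>2 + (- t)\<^sup>2) / t\<^sup>2) \<longlongrightarrow> 2) (at 0)"
  by (rule Lim_transform_eventually[OF tendsto_const]) (simp add: eventually_at_filter)

text \<open>Along the direction that pairs \<open>u\<^sub>i\<close> with its partner, the \<open>i\<close>-th singular value moves as
  \<open>d\<^sub>i + t\<close>.\<close>

lemma P''_diagonal:
  "P'' (outer (u i) (\<iota> i)) (outer (u i) (\<iota> i)) =
     2 * F' l (axis i 1) + 4 * l $ i * F'' l (axis i 1) (axis i 1)"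
proof -
  let ?y = "\<lambda>t. 2 * d i * t + t\<^sup>2"
  have m: "l + ?y t *\<^sub>R axis i 1 + 0 *\<^sub>R axis i 1 = (\<chi> k. (d k + (if k = i then t else 0))\<^sup>2)" for t
    by (auto simp: vec_eq_iff axis_def power2_eq_square algebra_simps)
  have "g (gram i (\<iota> i) t) = g (diag_mat (\<chi> k. (d k + (if k = i then t else 0))\<^sup>2))" for t
  proof (rule g_eq_diag[OF gram_psd u])
    show "gram i (\<iota> i) t *v u k = (d k + (if k = i then t else 0))\<^sup>2 *\<^sub>R u k" for k
      by (simp add: gram_mult_u \<iota>_inner mult_\<iota> vec_eq_iff power2_eq_square algebra_simps)
  qed
  then have ev: "\<forall>\<^sub>F t in at 0. l + ?y t *\<^sub>R axis i 1 + 0 *\<^sub>R axis i 1 \<in> nonneg_orthant \<and>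
      g (gram i (\<iota> i) t) = g (diag_mat (l + ?y t *\<^sub>R axis i 1 + 0 *\<^sub>R axis i 1))"
    unfolding m by (simp add: nonneg_orthant_def)
  have y1: "((\<lambda>t. ?y t / t) \<longlongrightarrow> 2 * d i) (at 0)"
  proof (rule Lim_transform_eventually)
    show "((\<lambda>t. 2 * d i + t) \<longlongrightarrow> 2 * d i) (at 0)" by (auto intro!: tendsto_eq_intros)
    show "\<forall>\<^sub>F t in at 0. 2 * d i + t = ?y t / t"
      using eventually_nonzero by eventually_elim (simp add: power2_eq_square add_divide_distrib)
  qed
  have y2: "((\<lambda>t. (?y t + ?y (- t)) / t\<^sup>2) \<longlongrightarrow> 2) (at 0)"
    using symmetric_square_lim by simp
  from P''_of_eigenvalue_curve[OF ev y1 y2, of 0 0] show ?thesis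
    by (simp add: blinfun.scaleR_right blinfun.scaleR_left linear_cmul[OF linear_F''] power2_eq_square)
qed

text \<open>Adding to row \<open>u\<^sub>i\<close> a direction that \<open>\<Theta>\<close> annihilates: the square \<open>t\<^sup>2\<close> adds to the
  eigenvalue.\<close>

lemma P''_null:
  assumes c: "c \<in> C" and null: "\<And>k. d k * (c \<bullet> \<iota> k) = 0"
  shows "P'' (outer (u i) c) (outer (u i) c) = 2 * F' l (axis i 1)"
proof -
  have m: "l + t\<^sup>2 *\<^sub>R axis i 1 + 0 *\<^sub>R axis i 1 = (\<chi> k. (d k)\<^sup>2 + (if k = i then t\<^sup>2 else 0))" for t
    by (auto simp: vec_eq_iff axis_def)
  have tc: "\<Theta> *v c = 0"
    unfolding mult_right_vector by (rule sum.neutral) (use null in \<open>auto simp: inner_commute\<close>)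
  have "g (gram i c t) = g (diag_mat (\<chi> k. (d k)\<^sup>2 + (if k = i then t\<^sup>2 else 0)))" for t
  proof (rule g_eq_diag[OF gram_psd u])
    fix k
    have "d k *\<^sub>R ((t * (c \<bullet> \<iota> k)) *\<^sub>R u i) = 0" using null[of k] by auto
    then show "gram i c t *v u k = ((d k)\<^sup>2 + (if k = i then t\<^sup>2 else 0)) *\<^sub>R u k"
      using C_inner[OF c c]
      by (cases "k = i") (simp_all add: gram_mult_u tc scaleR_add_right scaleR_add_left power2_eq_square)
  qed
  then have ev: "\<forall>\<^sub>F t in at 0. l + t\<^sup>2 *\<^sub>R axis i 1 + 0 *\<^sub>R axis i 1 \<in> nonneg_orthant \<and>
      g (gram i c t) = g (diag_mat (l + t\<^sup>2 *\<^sub>R axis i 1 + 0 *\<^sub>R axis i 1))"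
    unfolding m by (simp add: nonneg_orthant_def)
  have "((\<lambda>t::real. t\<^sup>2 / t) \<longlongrightarrow> 0) (at 0)"
    by (simp add: power2_eq_square)
  from P''_of_eigenvalue_curve[OF ev this symmetric_square_lim, of 0 0] show ?thesis
    by (simp add: blinfun.scaleR_right linear_0[OF linear_F''])
qed

text \<open>Pairing \<open>u\<^sub>i\<close> with the partner of \<open>u\<^sub>j\<close> perturbs only the span of these two vectors, on which the
  matrix is \<open>[[d\<^sub>i\<^sup>2 + t\<^sup>2, t d\<^sub>j], [t d\<^sub>j, d\<^sub>j\<^sup>2]]\<close>. The equation for \<open>\<alpha>\<close> is its characteristic equation;
  the other eigenvalue follows from the trace. The eigenvectors \<open>(X, Y)\<close> and \<open>(- Y, X)\<close> are nonzero
  because \<open>t d\<^sub>j \<noteq> 0\<close>.\<close>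

lemma gram_block:
  assumes ij: "i \<noteq> j" and dj: "d j > 0" and t: "t \<noteq> 0"
    and \<alpha>: "(\<alpha> - (d i)\<^sup>2 - t\<^sup>2) * (\<alpha> - (d j)\<^sup>2) = t\<^sup>2 * (d j)\<^sup>2"
  defines "m \<equiv> l + (\<alpha> - (d i)\<^sup>2) *\<^sub>R axis i 1 + (t\<^sup>2 - (\<alpha> - (d i)\<^sup>2)) *\<^sub>R axis j 1"
  shows "m \<in> nonneg_orthant" "g (gram i (\<iota> j) t) = g (diag_mat m)"
proof -
  let ?M = "gram i (\<iota> j) t"
  define X Y where "X = \<alpha> - (d j)\<^sup>2" and "Y = t * d j"
  define \<beta> where "\<beta> = (d i)\<^sup>2 + (d j)\<^sup>2 + t\<^sup>2 - \<alpha>"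
  define n where "n = sqrt (X\<^sup>2 + Y\<^sup>2)"
  have "Y \<noteq> 0" using dj t by (simp add: Y_def)
  then have "X\<^sup>2 + Y\<^sup>2 > 0" by (simp add: add_nonneg_pos)
  then have n: "n > 0" "n\<^sup>2 = X\<^sup>2 + Y\<^sup>2" by (simp_all add: n_def)
  have YX: "Y\<^sup>2 = X * (\<alpha> - (d i)\<^sup>2 - t\<^sup>2)"
    using \<alpha> by (simp add: X_def Y_def power_mult_distrib mult.commute)
  define p q where "p = (X / n) *\<^sub>R u i + (Y / n) *\<^sub>R u j" and "q = (- Y / n) *\<^sub>R u i + (X / n) *\<^sub>R u j"
  have uu: "u k \<bullet> u k' = (if k = k' then 1 else 0)" for k k' by (rule orthonormal_inner[OF u])
  have one: "X / n * (X / n) + Y / n * (Y / n) = 1"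
  proof -
    have "X / n * (X / n) + Y / n * (Y / n) = (X\<^sup>2 + Y\<^sup>2) / n\<^sup>2"
      by (simp add: power2_eq_square add_divide_distrib)
    then show ?thesis unfolding n(2)[symmetric] using n(1) by simp
  qed
  define w where "w = u(i := p, j := q)"
  have w: "orthonormal w"
    using ij one
    by (simp add: orthonormal_def w_def p_def q_def uu inner_add_left inner_add_right algebra_simps)
  have Mi: "?M *v u i = ((d i)\<^sup>2 + t\<^sup>2) *\<^sub>R u i + Y *\<^sub>R u j"
    using ij by (simp add: gram_mult_u mult_\<iota> \<iota>_inner Y_def power2_eq_square algebra_simps)
  have Mj: "?M *v u j = (d j)\<^sup>2 *\<^sub>R u j + Y *\<^sub>R u i"
    using ij by (simp add: gram_mult_u \<iota>_inner Y_def power2_eq_square algebra_simps)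
  have Mk: "?M *v u k = (d k)\<^sup>2 *\<^sub>R u k" if "k \<noteq> i" "k \<noteq> j" for k
    using that by (simp add: gram_mult_u \<iota>_inner power2_eq_square)
  define e where "e k = (if k = i then \<alpha> else if k = j then \<beta> else (d k)\<^sup>2)" for k
  have Mp: "?M *v p = \<alpha> *\<^sub>R p"
  proof -
    have "?M *v p = (X / n * ((d i)\<^sup>2 + t\<^sup>2) + Y / n * Y) *\<^sub>R u i + (X / n * Y + Y / n * (d j)\<^sup>2) *\<^sub>R u j"
      unfolding p_def matrix_vector_right_distrib matrix_vector_mult_scaleR Mi Mj by (simp add: algebra_simps)
    also have "X / n * ((d i)\<^sup>2 + t\<^sup>2) + Y / n * Y = (X * ((d i)\<^sup>2 + t\<^sup>2) + Y\<^sup>2) / n"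
      by (simp add: power2_eq_square add_divide_distrib)
    also have "X * ((d i)\<^sup>2 + t\<^sup>2) + Y\<^sup>2 = \<alpha> * X" unfolding YX by (simp add: algebra_simps)
    also have "X / n * Y + Y / n * (d j)\<^sup>2 = \<alpha> * (Y / n)"
      by (simp add: X_def left_diff_distrib diff_divide_distrib)
    finally show ?thesis by (simp add: p_def scaleR_add_right)
  qed
  have Mq: "?M *v q = \<beta> *\<^sub>R q"
  proof -
    have "?M *v q = (- Y / n * ((d i)\<^sup>2 + t\<^sup>2) + X / n * Y) *\<^sub>R u i + (- Y / n * Y + X / n * (d j)\<^sup>2) *\<^sub>R u j"
      unfolding q_def matrix_vector_right_distrib matrix_vector_mult_scaleR Mi Mj by (simp add: algebra_simps)
    also have "- Y / n * ((d i)\<^sup>2 + t\<^sup>2) + X / n * Y = \<beta> * (- Y / n)"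
      by (simp add: X_def \<beta>_def divide_inverse algebra_simps)
    also have "- Y / n * Y + X / n * (d j)\<^sup>2 = (X * (d j)\<^sup>2 - Y\<^sup>2) / n"
      by (simp add: power2_eq_square diff_divide_distrib)
    also have "X * (d j)\<^sup>2 - Y\<^sup>2 = \<beta> * X" unfolding YX by (simp add: \<beta>_def algebra_simps)
    finally show ?thesis by (simp add: q_def scaleR_add_right scaleR_diff_right)
  qed
  have eig: "?M *v w k = e k *\<^sub>R w k" for k
    using ij Mp Mq Mk by (auto simp: w_def e_def)
  have m: "m = (\<chi> k. e k)"
    using ij by (auto simp: m_def vec_eq_iff axis_def e_def \<beta>_def)
  show "m \<in> nonneg_orthant"
    unfolding m nonneg_orthant_def using psd_eigenvalue_nonneg[OF gram_psd w eig] by simp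
  show "g ?M = g (diag_mat m)"
    unfolding m by (rule g_eq_diag[OF gram_psd w eig])
qed

text \<open>At distinct eigenvalues the block eigenvalues are even and smooth in \<open>t\<close>, with leading terms
  \<open>\<lambda>\<^sub>i + t\<^sup>2 \<lambda>\<^sub>i / (\<lambda>\<^sub>i - \<lambda>\<^sub>j)\<close> and \<open>\<lambda>\<^sub>j - t\<^sup>2 \<lambda>\<^sub>j / (\<lambda>\<^sub>i - \<lambda>\<^sub>j)\<close>; only first derivatives of the
  spectral function contribute.\<close>

lemma P''_mixed_distinct:
  assumes ij: "i \<noteq> j" and dj: "d j > 0" and neq: "l $ i \<noteq> l $ j"
  shows "P'' (outer (u i) (\<iota> j)) (outer (u i) (\<iota> j)) = 2 * phi_quotient g i j l"
proof -
  define D where "D = l $ i - l $ j"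
  have "D \<noteq> 0" using neq by (simp add: D_def)
  \<comment> \<open>The sign selects the root that starts at \<open>\<lambda>\<^sub>i\<close>; as a function of \<open>s = t\<^sup>2\<close> it is smooth.\<close>
  define y where "y s = (s - D + sgn D * sqrt ((D + s)\<^sup>2 + 4 * s * l $ j)) / 2" for s
  have sg: "sgn D * sgn D = 1" "sgn D * \<bar>D\<bar> = D" using \<open>D \<noteq> 0\<close> by (auto simp: sgn_real_def)
  have root: "(y s + l $ i - (d i)\<^sup>2 - s) * (y s + l $ i - (d j)\<^sup>2) = s * (d j)\<^sup>2" if "s \<ge> 0" for s
  proof -
    define R where "R = sqrt ((D + s)\<^sup>2 + 4 * s * l $ j)"
    have R: "R * R = (D + s)\<^sup>2 + 4 * s * l $ j" using that by (simp add: R_def)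
    have "(y s + l $ i - (d i)\<^sup>2 - s) * (y s + l $ i - (d j)\<^sup>2) = (sgn D * R - (D + s)) / 2 * ((sgn D * R + (D + s)) / 2)"
      by (simp add: y_def R_def D_def field_simps)
    also have "\<dots> = ((sgn D * sgn D) * (R * R) - (D + s)\<^sup>2) / 4"
      by (simp add: power2_eq_square algebra_simps)
    also have "\<dots> = s * (d j)\<^sup>2" unfolding sg R by simp
    finally show ?thesis .
  qed
  have y0: "y 0 = 0" using sg by (simp add: y_def)
  have dy: "(y has_real_derivative l $ i / D) (at 0)"
  proof -
    have poly: "((\<lambda>s. (D + s)\<^sup>2 + 4 * s * l $ j) has_real_derivative 2 * D + 4 * l $ j) (at 0)"
      by (auto intro!: derivative_eq_intros)
    have root_deriv: "((\<lambda>s. sqrt ((D + s)\<^sup>2 + 4 * s * l $ j)) has_real_derivative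
        (2 * D + 4 * l $ j) / (2 * \<bar>D\<bar>)) (at 0)"
    proof (rule DERIV_cong[OF DERIV_chain2[OF DERIV_real_sqrt poly]])
      show "0 < (D + 0)\<^sup>2 + 4 * 0 * l $ j" using \<open>D \<noteq> 0\<close> by simp
      show "inverse (sqrt ((D + 0)\<^sup>2 + 4 * 0 * l $ j)) / 2 * (2 * D + 4 * l $ j) =
          (2 * D + 4 * l $ j) / (2 * \<bar>D\<bar>)"
        using \<open>D \<noteq> 0\<close> by (simp add: field_simps)
    qed
    have "(y has_real_derivative (1 - 0 + sgn D * ((2 * D + 4 * l $ j) / (2 * \<bar>D\<bar>))) / 2) (at 0)"
      unfolding y_def
      by (intro DERIV_cdivide DERIV_add DERIV_diff DERIV_ident DERIV_const DERIV_cmult root_deriv)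
    also have "(1 - 0 + sgn D * ((2 * D + 4 * l $ j) / (2 * \<bar>D\<bar>))) / 2 = l $ i / D"
      using \<open>D \<noteq> 0\<close> by (cases "D > 0") (simp_all add: D_def field_simps)
    finally show ?thesis .
  qed
  have y_lim: "((\<lambda>t. y (t\<^sup>2) / t\<^sup>2) \<longlongrightarrow> l $ i / D) (at 0)"
  proof -
    have "((\<lambda>s. y s / s) \<longlongrightarrow> l $ i / D) (at 0)"
      using dy y0 by (simp add: has_field_derivative_iff)
    moreover have "filterlim (\<lambda>t::real. t\<^sup>2) (at 0) (at 0)"
      by (auto simp: filterlim_at eventually_at_filter intro!: tendsto_eq_intros)
    ultimately show ?thesis by (rule filterlim_compose)
  qed
  have "\<forall>\<^sub>F t in at 0. l + y (t\<^sup>2) *\<^sub>R axis i 1 + (t\<^sup>2 - y (t\<^sup>2)) *\<^sub>R axis j 1 \<in> nonneg_orthant \<and>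
      g (gram i (\<iota> j) t) = g (diag_mat (l + y (t\<^sup>2) *\<^sub>R axis i 1 + (t\<^sup>2 - y (t\<^sup>2)) *\<^sub>R axis j 1))"
    using eventually_nonzero
  proof eventually_elim
    case (elim t)
    show ?case using gram_block[OF ij dj elim root[of "t\<^sup>2"]] by simp
  qed
  moreover have "((\<lambda>t. y (t\<^sup>2) / t) \<longlongrightarrow> 0) (at 0)"
  proof (rule Lim_transform_eventually)
    show "((\<lambda>t. t * (y (t\<^sup>2) / t\<^sup>2)) \<longlongrightarrow> 0) (at 0)"
      using tendsto_mult[OF tendsto_ident_at y_lim] by (simp only: mult_zero_left)
    show "\<forall>\<^sub>F t in at 0. t * (y (t\<^sup>2) / t\<^sup>2) = y (t\<^sup>2) / t"
      using eventually_nonzero by eventually_elim (simp add: power2_eq_square)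
  qed
  moreover have "((\<lambda>t. (y (t\<^sup>2) + y ((- t)\<^sup>2)) / t\<^sup>2) \<longlongrightarrow> 2 * (l $ i / D)) (at 0)"
    using tendsto_mult[OF tendsto_const[of 2] y_lim] by simp
  moreover have "((\<lambda>t. (t\<^sup>2 - y (t\<^sup>2)) / t) \<longlongrightarrow> 0) (at 0)"
    using tendsto_diff[OF tendsto_ident_at calculation(2)]
    by (simp add: diff_divide_distrib power2_eq_square)
  moreover have "((\<lambda>t. (t\<^sup>2 - y (t\<^sup>2) + ((- t)\<^sup>2 - y ((- t)\<^sup>2))) / t\<^sup>2) \<longlongrightarrow> 2 - 2 * (l $ i / D)) (at 0)"
  proof -
    have "t\<^sup>2 - y (t\<^sup>2) + ((- t)\<^sup>2 - y ((- t)\<^sup>2)) = (t\<^sup>2 + (- t)\<^sup>2) - (y (t\<^sup>2) + y ((- t)\<^sup>2))" for t by simp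
    with tendsto_diff[OF symmetric_square_lim calculation(3)] show ?thesis
      by (simp only: diff_divide_distrib)
  qed
  ultimately have "P'' (outer (u i) (\<iota> j)) (outer (u i) (\<iota> j)) =
      F' l ((2 * (l $ i / D)) *\<^sub>R axis i 1 + (2 - 2 * (l $ i / D)) *\<^sub>R axis j 1) +
      F'' l (0 *\<^sub>R axis i 1 + 0 *\<^sub>R axis j 1) (0 *\<^sub>R axis i 1 + 0 *\<^sub>R axis j 1)"
    by (rule P''_of_eigenvalue_curve)
  also have "\<dots> = 2 * ((l $ i / D) * F' l (axis i 1) + (1 - l $ i / D) * F' l (axis j 1))"
    unfolding blinfun.add_right blinfun.scaleR_right by (simp add: algebra_simps del: l_nth)
  also have "\<dots> = 2 * phi_quotient g i j l"
  proof -
    have "1 - l $ i / D = - (l $ j) / D"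
      using \<open>D \<noteq> 0\<close> by (simp add: D_def field_simps del: l_nth)
    then show ?thesis
      unfolding phi_quotient_neq[OF l_orthant neq] D_def[symmetric]
      by (simp add: diff_divide_distrib del: l_nth)
  qed
  finally show ?thesis .
qed

text \<open>At a double eigenvalue the block eigenvalues are \<open>\<lambda> \<plusminus> d t + O(t\<^sup>2)\<close>, so second derivatives
  of the spectral function enter; its symmetry reduces them to the two in \<open>phi_quotient_eq\<close>.\<close>

lemma P''_mixed_equal:
  assumes ij: "i \<noteq> j" and dj: "d j > 0" and eq: "l $ i = l $ j"
  shows "P'' (outer (u i) (\<iota> j)) (outer (u i) (\<iota> j)) = 2 * phi_quotient g i j l"
proof -
  define r where "r t = sqrt ((d j)\<^sup>2 + t\<^sup>2 / 4)" for t
  define y where "y t = t\<^sup>2 / 2 + t * r t" for t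
  have dij: "(d i)\<^sup>2 = (d j)\<^sup>2" using eq by simp
  have root: "(y t + l $ i - (d i)\<^sup>2 - t\<^sup>2) * (y t + l $ i - (d j)\<^sup>2) = t\<^sup>2 * (d j)\<^sup>2" for t
  proof -
    have R: "r t * r t = (d j)\<^sup>2 + t\<^sup>2 / 4" by (simp add: r_def)
    have "(y t + l $ i - (d i)\<^sup>2 - t\<^sup>2) * (y t + l $ i - (d j)\<^sup>2) = (t * r t - t\<^sup>2 / 2) * (t * r t + t\<^sup>2 / 2)"
      unfolding y_def by (simp add: dij algebra_simps)
    also have "\<dots> = t\<^sup>2 * (r t * r t) - t\<^sup>2 * t\<^sup>2 / 4" by (simp add: power2_eq_square algebra_simps)
    also have "\<dots> = t\<^sup>2 * (d j)\<^sup>2" unfolding R by (simp add: algebra_simps)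
    finally show ?thesis .
  qed
  have "\<forall>\<^sub>F t in at 0. l + y t *\<^sub>R axis i 1 + (t\<^sup>2 - y t) *\<^sub>R axis j 1 \<in> nonneg_orthant \<and>
      g (gram i (\<iota> j) t) = g (diag_mat (l + y t *\<^sub>R axis i 1 + (t\<^sup>2 - y t) *\<^sub>R axis j 1))"
    using eventually_nonzero
  proof eventually_elim
    case (elim t)
    show ?case using gram_block[OF ij dj elim root[of t]] by simp
  qed
  moreover have "((\<lambda>t. y t / t) \<longlongrightarrow> d j) (at 0)"
  proof (rule Lim_transform_eventually)
    show "((\<lambda>t. t / 2 + r t) \<longlongrightarrow> d j) (at 0)"
      unfolding r_def using dj by (auto intro!: tendsto_eq_intros)
    show "\<forall>\<^sub>F t in at 0. t / 2 + r t = y t / t"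
      using eventually_nonzero by eventually_elim (simp add: y_def power2_eq_square add_divide_distrib)
  qed
  moreover have sym: "y t + y (- t) = t\<^sup>2" "t\<^sup>2 - y t + ((- t)\<^sup>2 - y (- t)) = t\<^sup>2" for t
    by (simp_all add: y_def r_def)
  have one: "((\<lambda>t::real. t\<^sup>2 / t\<^sup>2) \<longlongrightarrow> 1) (at 0)"
    by (rule Lim_transform_eventually[OF tendsto_const]) (simp add: eventually_at_filter)
  then have "((\<lambda>t. (y t + y (- t)) / t\<^sup>2) \<longlongrightarrow> 1) (at 0)" by (simp only: sym)
  moreover have "((\<lambda>t. (t\<^sup>2 - y t) / t) \<longlongrightarrow> 0 - d j) (at 0)"
    using tendsto_diff[OF tendsto_ident_at calculation(2)]
    by (simp add: diff_divide_distrib power2_eq_square)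
  moreover have "((\<lambda>t. (t\<^sup>2 - y t + ((- t)\<^sup>2 - y (- t))) / t\<^sup>2) \<longlongrightarrow> 1) (at 0)"
    using one by (simp only: sym)
  ultimately have "P'' (outer (u i) (\<iota> j)) (outer (u i) (\<iota> j)) = F' l (1 *\<^sub>R axis i 1 + 1 *\<^sub>R axis j 1) +
      F'' l (d j *\<^sub>R axis i 1 + (0 - d j) *\<^sub>R axis j 1) (d j *\<^sub>R axis i 1 + (0 - d j) *\<^sub>R axis j 1)"
    by (rule P''_of_eigenvalue_curve)
  also have "\<dots> = 2 * phi_quotient g i j l"
  proof -
    have s: "F' l (axis j 1) = F' l (axis i 1)"
      using F'_swap[OF l_orthant, of i j i] by (simp add: swap_fixed[OF eq])
    have s2: "F'' l (axis j 1) (axis j 1) = F'' l (axis i 1) (axis i 1)" "F'' l (axis j 1) (axis i 1) = F'' l (axis i 1) (axis j 1)"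
      using F''_swap[OF l_orthant eq, of i] F''_swap[OF l_orthant eq, of j] by simp_all
    show ?thesis
      unfolding phi_quotient_eq[OF l_orthant eq ij]
      by (simp add: linear_add[OF linear_F''] linear_diff[OF linear_F''] linear_neg[OF linear_F''] linear_cmul[OF linear_F'']
          blinfun.add_left blinfun.diff_left blinfun.minus_left blinfun.scaleR_left
          blinfun.add_right blinfun.diff_right blinfun.minus_right blinfun.scaleR_right s s2 dij)
        (simp add: power2_eq_square algebra_simps)
  qed
  finally show ?thesis .
qed

text \<open>If \<open>d\<^sub>j = 0\<close>, then \<open>\<Theta>\<close> annihilates the partner of \<open>u\<^sub>j\<close> and the quotient reduces to
  \<open>\<phi>\<^sub>i\<close>.\<close>

lemma P''_mixed:
  assumes ij: "i \<noteq> j"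
  shows "P'' (outer (u i) (\<iota> j)) (outer (u i) (\<iota> j)) = 2 * phi_quotient g i j l"
proof (cases "d j = 0")
  case True
  have "P'' (outer (u i) (\<iota> j)) (outer (u i) (\<iota> j)) = 2 * F' l (axis i 1)"
    by (rule P''_null) (use True \<iota>_inner in auto)
  also have "F' l (axis i 1) = phi_quotient g i j l"
    using True phi_quotient_neq[OF l_orthant, of i j] phi_quotient_eq[OF l_orthant _ ij]
    by (cases "d i = 0") auto
  finally show ?thesis .
next
  case False
  then show ?thesis
    using d0[of j] P''_mixed_distinct[OF ij] P''_mixed_equal[OF ij] by (cases "l $ i = l $ j") auto
qed

text \<open>For each \<open>i\<close> the basis \<open>C\<close> splits into the partner of \<open>u\<^sub>i\<close>, the partners of the other left
  singular vectors, and \<open>q - r\<close> vectors that \<open>\<Theta>\<close> annihilates. The first and the last kind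
  contribute the factor \<open>q - r + 1\<close> of \<open>\<phi>\<^sub>i\<close>.\<close>

lemma laplacian_singular_values:
  assumes span: "span C = UNIV"
  shows "(\<Sum>b\<in>Basis. P'' b b) =
    2 * (\<Sum>i\<in>UNIV. (real CARD('q) - real CARD('r) + 1) * phi g i l
        + (\<Sum>j\<in>UNIV - {i}. phi_quotient g i j l)
        + 2 * l $ i * partial_orthant i (phi g i) l)"
proof -
  have C_basis: "finite C" "card C = CARD('q)" "parseval_family C (\<lambda>c. c)"
    using orthonormal_set_basis[OF C span] by auto
  have bil: "bilinear (\<lambda>x y. P'' x y)"
    using P'' by (intro bilinear_blinfun_apply) (simp add: has_derivative_def bounded_linear.linear)
  have "(\<Sum>b\<in>Basis. P'' b b) = (\<Sum>(i, c)\<in>UNIV \<times> C. P'' (outer (u i) c) (outer (u i) c))"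
    using trace_bilinear_parseval[OF parseval_family_outer[OF orthonormal_parseval[OF u] C_basis(3)] bil]
    by (simp add: case_prod_unfold)
  also have "\<dots> = (\<Sum>i\<in>UNIV. \<Sum>c\<in>C. P'' (outer (u i) c) (outer (u i) c))"
    by (simp add: sum.cartesian_product)
  also have "\<dots> = (\<Sum>i\<in>UNIV. 2 * ((real CARD('q) - real CARD('r) + 1) * phi g i l
        + (\<Sum>j\<in>UNIV - {i}. phi_quotient g i j l)
        + 2 * l $ i * partial_orthant i (phi g i) l))"
  proof (rule sum.cong[OF refl])
    fix i
    let ?p = "\<lambda>c. P'' (outer (u i) c) (outer (u i) c)"
    have null: "?p c = 2 * phi g i l" if "c \<in> C - range \<iota>" for c
    proof -
      have "c \<bullet> \<iota> k = 0" for k using that C_inner[of c "\<iota> k"] by auto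
      then show ?thesis using that by (subst P''_null) (auto simp: phi_eq[OF l_orthant])
    qed
    have card: "card (C - range \<iota>) = CARD('q) - CARD('r)" "CARD('r) \<le> CARD('q)"
      using C_basis \<iota> card_image[OF \<iota>(1)] card_mono[OF C_basis(1) \<iota>(2)] by (auto simp: card_Diff_subset)
    have "(\<Sum>c\<in>C. ?p c) = (\<Sum>c\<in>C - range \<iota>. ?p c) + (\<Sum>c\<in>range \<iota>. ?p c)"
      using C_basis(1) \<iota>(2) by (rule sum.subset_diff[rotated])
    also have "(\<Sum>c\<in>C - range \<iota>. ?p c) = (real CARD('q) - real CARD('r)) * (2 * phi g i l)"
      using null card by simp
    also have "(\<Sum>c\<in>range \<iota>. ?p c) = (\<Sum>j\<in>UNIV. ?p (\<iota> j))"
      using \<iota>(1) by (simp add: sum.reindex)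
    also have "\<dots> = ?p (\<iota> i) + (\<Sum>j\<in>UNIV - {i}. ?p (\<iota> j))"
      by (subst sum.remove[of _ i]) auto
    also have "(\<Sum>j\<in>UNIV - {i}. ?p (\<iota> j)) = (\<Sum>j\<in>UNIV - {i}. 2 * phi_quotient g i j l)"
      by (intro sum.cong refl P''_mixed) auto
    also have "?p (\<iota> i) = 2 * phi g i l + 4 * l $ i * partial_orthant i (phi g i) l"
      by (simp add: P''_diagonal phi_eq[OF l_orthant] partial_phi_eq[OF l_orthant])
    finally show "(\<Sum>c\<in>C. ?p c) = 2 * ((real CARD('q) - real CARD('r) + 1) * phi g i l
        + (\<Sum>j\<in>UNIV - {i}. phi_quotient g i j l)
        + 2 * l $ i * partial_orthant i (phi g i) l)"
      by (simp add: sum_distrib_left[symmetric] algebra_simps)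
  qed
  finally show ?thesis by (simp only: sum_distrib_left)
qed

end

section \<open>The Laplacian formula and minimaxity\<close>

lemma has_derivative_imp_line_derivative:
  fixes f :: "'a::real_normed_vector \<Rightarrow> real"
  assumes "(f has_derivative D) (at x)"
  shows "((\<lambda>t. f (x + t *\<^sub>R b)) has_real_derivative D b) (at 0)"
proof -
  have lin: "linear D" using assms by (simp add: has_derivative_def bounded_linear.linear)
  have "((\<lambda>t. f (x + t *\<^sub>R b)) has_derivative (\<lambda>t. D (t *\<^sub>R b))) (at 0)"
    by (rule has_derivative_compose[of "\<lambda>t. x + t *\<^sub>R b" _ 0 UNIV f D])
      (use assms in \<open>auto intro!: derivative_eq_intros\<close>)
  then show ?thesis
    by (simp add: has_field_derivative_def linear_cmul[OF lin] mult_commute_abs)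
qed

lemma outer_axis: "outer (axis i 1) (axis j 1) = axis i (axis j 1)"
  by (auto simp: outer_def vec_eq_iff axis_def)

lemma trace_nabla_nabla_T:
  fixes f :: "real ^ 'q ^ 'r \<Rightarrow> real"
  assumes P': "\<And>A. (f has_derivative blinfun_apply (P' A)) (at A)"
    and P'': "(P' has_derivative P'') (at \<Theta>)"
  shows "trace (nabla_nabla_T f \<Theta>) = (\<Sum>b\<in>Basis. P'' b b)"
proof -
  have first: "partial_mat i j f = (\<lambda>A. P' A (axis i (axis j 1)))" for i j
    unfolding partial_mat_def by (intro ext DERIV_imp_deriv has_derivative_imp_line_derivative P')
  have "partial_mat i j (partial_mat i j f) \<Theta> = P'' (axis i (axis j 1)) (axis i (axis j 1))" for i j
    unfolding first unfolding partial_mat_def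
    by (intro DERIV_imp_deriv has_derivative_imp_line_derivative
        bounded_linear.has_derivative[OF blinfun.bounded_linear_left P''])
  then have "trace (nabla_nabla_T f \<Theta>) = (\<Sum>i\<in>UNIV. \<Sum>j\<in>UNIV. P'' (axis i (axis j 1)) (axis i (axis j 1)))"
    by (simp add: trace_def nabla_nabla_T_def)
  also have "\<dots> = (\<Sum>(i, j)\<in>UNIV \<times> UNIV. P'' (outer (axis i 1) (axis j 1)) (outer (axis i 1) (axis j 1)))"
    by (simp add: sum.cartesian_product outer_axis)
  also have "\<dots> = (\<Sum>b\<in>Basis. P'' b b)"
  proof -
    have "orthonormal (\<lambda>i. axis i 1 :: real ^ 'n)"
      by (simp add: orthonormal_def inner_axis_axis)
    note on = orthonormal_parseval[OF this]
    have "bilinear (\<lambda>x y. P'' x y)"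
      using P'' by (intro bilinear_blinfun_apply) (simp add: has_derivative_def bounded_linear.linear)
    from trace_bilinear_parseval[OF parseval_family_outer[OF on on] this] show ?thesis
      by (simp add: case_prod_unfold)
  qed
  finally show ?thesis .
qed

lemma twice_differentiable_onE:
  assumes "twice_differentiable_on f S"
  obtains f' f'' where "\<And>x. x \<in> S \<Longrightarrow> (f has_derivative blinfun_apply (f' x)) (at x within S)"
    "\<And>x. x \<in> S \<Longrightarrow> (f' has_derivative f'' x) (at x within S)"
proof -
  obtain f' where f': "\<And>x. x \<in> S \<Longrightarrow> (f has_derivative blinfun_apply (f' x)) (at x within S)"
    "f' differentiable_on S"
    using assms unfolding twice_differentiable_on_def by blast
  then have "\<forall>x\<in>S. \<exists>D. (f' has_derivative D) (at x within S)"
    by (simp add: differentiable_on_def differentiable_def)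
  then obtain f'' where "\<forall>x\<in>S. (f' has_derivative f'' x) (at x within S)"
    using bchoice[of S "\<lambda>x D. (f' has_derivative D) (at x within S)"] by blast
  with f'(1) that show ?thesis by blast
qed

text \<open>If the Laplacian of the prior is nonpositive, the prior is superharmonic, so the risk of
  its predictive density is everywhere at most the constant \<open>uniform_prior_risk\<close>, below which
  no maximal risk can go.\<close>

theorem kl_minimax_superharmonic:
  fixes prior :: "real ^ ('q::finite) ^ ('r::finite) \<Rightarrow> real"
  assumes v: "vx > 0" "vy > 0" and nonneg: "\<And>\<Theta>. 0 \<le> prior \<Theta>" and nonzero: "\<exists>\<Theta>. prior \<Theta> \<noteq> 0"
    and diff: "twice_differentiable_on prior UNIV"
    and laplacian: "\<And>\<Theta>. trace (nabla_nabla_T prior \<Theta>) \<le> 0"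
  shows "kl_minimax vx vy (bayes_predictive vx vy prior)"
proof -
  obtain P' P'' where P': "\<And>A. (prior has_derivative blinfun_apply (P' A)) (at A)"
    and P'': "\<And>A. (P' has_derivative P'' A) (at A)"
    using twice_differentiable_onE[OF diff] by auto
  have sh: "superharmonic_prior prior (\<lambda>b x. P' x b) (\<lambda>b x. P'' x b b)"
  proof
    show "continuous_on UNIV prior"
      using P' by (intro differentiable_imp_continuous_on) (auto simp: differentiable_on_def differentiable_def)
    show "((\<lambda>\<tau>. prior (x + \<tau> *\<^sub>R b)) has_real_derivative P' x b) (at 0)" for x b
      by (rule has_derivative_imp_line_derivative[OF P'])
    show "((\<lambda>\<tau>. P' (x + \<tau> *\<^sub>R b) b) has_real_derivative P'' x b b) (at 0)" for x b
      by (rule has_derivative_imp_line_derivative[OF bounded_linear.has_derivative[OF blinfun.bounded_linear_left P'']])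
    show "(\<Sum>b\<in>Basis. P'' x b b) \<le> 0" for x
      using laplacian[of x] by (simp add: trace_nabla_nabla_T[OF P' P''])
  qed (use nonneg nonzero in auto)
  note predictive = predictive_density_bayes[OF v sh] and le = kl_risk_bayes_le[OF v sh]
  let ?p = "bayes_predictive vx vy prior" and ?R = "ereal (uniform_prior_risk vx vy DIM(real ^ 'q ^ 'r))"
  have "(SUP \<Theta>. kl_risk vx vy \<Theta> ?p) = (INF p' \<in> {p' :: real ^ 'q ^ 'r \<Rightarrow> real ^ 'q ^ 'r \<Rightarrow> real. predictive_density p'}. SUP \<Theta>. kl_risk vx vy \<Theta> p')"
  proof (rule antisym)
    have "(SUP \<Theta>. kl_risk vx vy \<Theta> ?p) \<le> ?R" by (rule SUP_least) (rule le)
    also have "?R \<le> (INF p' \<in> {p' :: real ^ 'q ^ 'r \<Rightarrow> real ^ 'q ^ 'r \<Rightarrow> real. predictive_density p'}. SUP \<Theta>. kl_risk vx vy \<Theta> p')"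
      by (rule INF_greatest, rule uniform_prior_risk_le_max_risk[OF v]) (erule CollectD)
    finally show "(SUP \<Theta>. kl_risk vx vy \<Theta> ?p) \<le> \<dots>" .
    show "(INF p' \<in> {p' :: real ^ 'q ^ 'r \<Rightarrow> real ^ 'q ^ 'r \<Rightarrow> real. predictive_density p'}. SUP \<Theta>. kl_risk vx vy \<Theta> p') \<le> (SUP \<Theta>. kl_risk vx vy \<Theta> ?p)"
      by (rule INF_lower) (use predictive in simp)
  qed
  with predictive show ?thesis by (simp add: kl_minimax_def)
qed

text \<open>The given eigenvalues are the roots of the characteristic polynomial, so an eigenbasis of
  \<open>\<Theta> \<Theta>\<^sup>T\<close> can be reordered to match them; the singular value decomposition built on it puts
  \<open>\<Theta>\<close> into the position of \<open>laplacian_singular_values\<close>.\<close>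

theorem laplacian_spectral_prior:
  fixes g :: "real ^ ('r::{finite,linorder}) ^ ('r::{finite,linorder}) \<Rightarrow> real"
    and prior :: "real ^ ('q::finite) ^ ('r::{finite,linorder}) \<Rightarrow> real"
  assumes card: "CARD('r) \<le> CARD('q)"
    and prior: "\<And>\<Theta>. prior \<Theta> = g (\<Theta> ** transpose \<Theta>)"
    and inv: "orthogonally_invariant g"
    and diff: "twice_differentiable_on prior UNIV"
    and diff_diag: "twice_differentiable_on (\<lambda>l. g (diag_mat l)) nonneg_orthant"
    and ev: "ordered_eigenvalues (\<Theta> ** transpose \<Theta>) l"
  shows "trace (nabla_nabla_T prior \<Theta>) =
      2 * (\<Sum>i\<in>UNIV. (real CARD('q) - real CARD('r) + 1) * phi g i l
             + (\<Sum>j\<in>UNIV - {i}. phi_quotient g i j l)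
             + 2 * l $ i * partial_orthant i (phi g i) l)"
proof -
  let ?M = "\<Theta> ** transpose \<Theta>"
  obtain P' P'' where P': "\<And>A. (prior has_derivative blinfun_apply (P' A)) (at A)"
    and P'': "\<And>A. (P' has_derivative P'' A) (at A)"
    using twice_differentiable_onE[OF diff] by auto
  obtain F' F'' where F': "\<And>l. l \<in> nonneg_orthant \<Longrightarrow>
      ((\<lambda>l. g (diag_mat l)) has_derivative blinfun_apply (F' l)) (at l within nonneg_orthant)"
    and F'': "\<And>l. l \<in> nonneg_orthant \<Longrightarrow> (F' has_derivative F'' l) (at l within nonneg_orthant)"
    using twice_differentiable_onE[OF diff_diag] by blast
  have "transpose ?M = ?M" by (simp add: matrix_transpose_mul)
  from symmetric_matrix_eigenbasis[OF this] obtain u0 e where u0: "orthonormal u0" and e: "\<And>i :: 'r. ?M *v u0 i = e i *\<^sub>R u0 i"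
    by blast
  have "(\<Prod>i\<in>UNIV. x - l $ i) = (\<Prod>i\<in>UNIV. x - e i)" for x
    using ev det_char_eigenbasis[OF u0 e, of x] by (simp add: ordered_eigenvalues_def)
  then obtain \<sigma> where \<sigma>: "\<sigma> permutes UNIV" "\<And>i. l $ i = e (\<sigma> i)"
    using monic_product_roots_permutation[of "\<lambda>i. l $ i" e] by auto
  define u where "u i = u0 (\<sigma> i)" for i
  have u: "orthonormal u"
    using u0 permutes_inj[OF \<sigma>(1)] by (simp add: orthonormal_def u_def inj_eq)
  have ui: "?M *v u i = l $ i *\<^sub>R u i" for i by (simp add: u_def e \<sigma>(2))
  obtain C \<iota> where C: "pairwise orthogonal C" "\<And>c. c \<in> C \<Longrightarrow> norm c = 1" "span C = UNIV"
    and \<iota>: "inj \<iota>" "range \<iota> \<subseteq> C" and l0: "\<And>i. 0 \<le> l $ i"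
    and svd: "\<And>i. transpose \<Theta> *v u i = sqrt (l $ i) *\<^sub>R \<iota> i"
    by (rule singular_value_decomposition[OF card u ui]) (rule that)
  have prior_eq: "prior = (\<lambda>\<Theta>. g (\<Theta> ** transpose \<Theta>))" using prior by auto
  interpret S: singular_values g F' F'' \<Theta> u "\<lambda>i. sqrt (l $ i)" C \<iota> P' "P'' \<Theta>"
    by unfold_locales (use inv F' F'' u l0 C \<iota> svd P'[unfolded prior_eq] P'' in auto)
  have "S.l = l" using l0 by (simp add: S.l_def vec_eq_iff)
  then show ?thesis
    using S.laplacian_singular_values[OF C(3)] trace_nabla_nabla_T[OF P' P''] by simp
qed

theorem proposition4p1:
  fixes vx vy :: real
    and g :: "real ^ ('r::{finite,linorder}) ^ ('r::{finite,linorder}) \<Rightarrow> real"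
    and prior :: "real ^ ('q::finite) ^ ('r::{finite,linorder}) \<Rightarrow> real"
  assumes "CARD('r) \<le> CARD('q)"
    and "vx > 0" and "vy > 0"
    and "\<And>\<Theta>. prior \<Theta> = g (\<Theta> ** transpose \<Theta>)"
    and "\<And>\<Theta>. 0 \<le> prior \<Theta>" and "\<exists>\<Theta>. prior \<Theta> \<noteq> 0"
    and "orthogonally_invariant g"
    and "\<And>\<Sigma> l. \<Sigma> \<in> psd_matrices \<Longrightarrow> ordered_eigenvalues \<Sigma> l \<Longrightarrow> g \<Sigma> = g (diag_mat l)"
    and "twice_differentiable_on prior UNIV"
    and "twice_differentiable_on g psd_matrices"
    and "twice_differentiable_on (\<lambda>l. g (diag_mat l)) nonneg_orthant"
    and "\<And>X. integrable lborel (\<lambda>\<Theta>. normal_mat_density vx \<Theta> X * prior \<Theta>)"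
  shows "(\<forall>\<Theta> l. ordered_eigenvalues (\<Theta> ** transpose \<Theta>) l \<longrightarrow>
            trace (nabla_nabla_T prior \<Theta>) =
              2 * (\<Sum>i\<in>UNIV. (real CARD('q) - real CARD('r) + 1) * phi g i l
                     + (\<Sum>j\<in>UNIV - {i}. phi_quotient g i j l)
                     + 2 * l $ i * partial_orthant i (phi g i) l)) \<and>
         ((\<forall>\<Theta>. trace (nabla_nabla_T prior \<Theta>) \<le> 0) \<longrightarrow>
            kl_minimax vx vy (bayes_predictive vx vy prior))"
proof (intro conjI allI impI)
  fix \<Theta> :: "real ^ 'q ^ ('r::{finite,linorder})" and l
  assume "ordered_eigenvalues (\<Theta> ** transpose \<Theta>) l"
  then show "trace (nabla_nabla_T prior \<Theta>) =
      2 * (\<Sum>i\<in>UNIV. (real CARD('q) - real CARD('r) + 1) * phi g i l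
             + (\<Sum>j\<in>UNIV - {i}. phi_quotient g i j l)
             + 2 * l $ i * partial_orthant i (phi g i) l)"
    by (rule laplacian_spectral_prior[OF assms(1,4,7,9,11)])
next
  assume "\<forall>\<Theta>. trace (nabla_nabla_T prior \<Theta>) \<le> 0"
  then show "kl_minimax vx vy (bayes_predictive vx vy prior)"
    using assms by (intro kl_minimax_superharmonic) auto
qed

end
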